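(* Let $p$ be a prime and let $L\in\mathbb{N}$. A measurable set $G\subset\mathbb{Q}_p$ is a generalized scaling set of order $L$ if and only if there exists a multiwavelet set $W\subset\mathbb{Q}_p$ of order $L$ such that $G=\bigcup_{j=1}^{\infty}p^{j}W$ a.e. (that is, up to a set of Haar measure zero).
   Context: $\mathbb{Q}_p$ is the field of $p$-adic numbers, with norm $|\cdot|_p$ and ring of integers $\mathbb{Z}_p=\{x:|x|_p\le 1\}$. The Haar measure $\mu$ (also written $dx$) on $\mathbb{Q}_p$ is normalized by $\mu(\mathbb{Z}_p)=1$. For $x=\sum_{j\ge\gamma}x_jp^j$ with digits $x_j\in\{0,\dots,p-1\}$, the fractional part is $\{x\}_p=\sum_{j=\gamma}^{-1}x_jp^j$ (and $\{x\}_p=0$ if $x=0$ or $\gamma\ge 0$). $I_p=\{x\in\mathbb{Q}_p:\{x\}_p=x\}$. $\chi_p(x)=e^{2\pi i\{x\}_p}$. The Fourier transform on $L^2(\mathbb{Q}_p)$ is the unitary extension of $\hat f(\xi)=\int_{\mathbb{Q}_p}\chi_p(\xi x)f(x)\,dx$. For $A\subset\mathbb{Q}_p$, $p^jA=\{p^ja:a\in A\}$, and $\mathds{1}_A$ is the characteristic function of $A$. Multiwavelet: $\{\psi_1,\dots,\psi_L\}\subset L^2(\mathbb{Q}_p)$ is a multiwavelet if $\{p^{j/2}\psi_n(p^{-j}\cdot-a): 1\le n\le L,\ j\in\mathbb{Z},\ a\in I_p\}$ is an orthonormal basis of $L^2(\mathbb{Q}_p)$. Multiwavelet set: a measurable set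 $W\subset\mathbb{Q}_p$ is a multiwavelet set of order $L$ if $W=\bigcup_{n=1}^{L}W_n$ for measurable sets $W_1,\dots,W_L$ such that $\{\psi_1,\dots,\psi_L\}$ is a multiwavelet, where $\hat\psi_n=\mathds{1}_{W_n}$. Generalized scaling set: for fixed $L\in\mathbb{N}$, a (measurable) set $G\subset\mathbb{Q}_p$ is a generalized scaling set of order $L$ if $\mu(G)=\frac{L}{p-1}$ and $p^{-1}G\setminus G$ is a multiwavelet set of order $L$. *)

theory Defs
  imports
    "HOL-Probability.Probability"
    "HOL-Computational_Algebra.Fraction_Field"
    "Berlekamp_Zassenhaus.Finite_Field"
begin

abbreviation pint :: "'p::prime_card itself \<Rightarrow> int" where
  "pint T \<equiv> int CARD('p)"

lemma pint_gt_1: "pint TYPE('p::prime_card) > 1"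
  using prime_gt_1_nat[OF prime_card[where 'a='p]] by simp

lemma pint_pow_pos [simp]: "pint TYPE('p::prime_card) ^ n > 0"
  using pint_gt_1[where 'p='p] by simp

lemma mod_mod_pow_le:
  fixes k q :: int
  assumes "m \<le> n" shows "k mod q ^ n mod q ^ m = k mod q ^ m"
  by (simp add: mod_mod_cancel le_imp_power_dvd assms)

text \<open>The prime \<open>p\<close> is the cardinality of a type of class \<^class>\<open>prime_card\<close>.
  The ring of p-adic integers is the inverse limit of the rings of integers modulo \<open>p ^ n\<close>;
  \<open>residue x n\<close> is the representative of \<open>x\<close> modulo \<open>p ^ n\<close> in \<open>{0..<p ^ n}\<close>.\<close>

typedef (overloaded) ('p::prime_card) padic_int =
  "{f :: nat \<Rightarrow> int. \<forall>n. f n = f (Suc n) mod pint TYPE('p) ^ n}"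
  morphisms residue Abs_padic_int
  by (rule exI[of _ "\<lambda>_. 0"]) simp

setup_lifting type_definition_padic_int

lemma padic_int_eqI: "(\<And>n. residue x n = residue y n) \<Longrightarrow> x = y"
  by (metis residue_inject ext)

lemma residue_Suc: "residue (x::'p::prime_card padic_int) (Suc n) mod pint TYPE('p) ^ n = residue x n"
  using residue[of x] unfolding mem_Collect_eq by metis

lemma residue_mod_le:
  assumes "m \<le> n"
  shows "residue (x::'p::prime_card padic_int) n mod pint TYPE('p) ^ m = residue x m"
  using assms
proof (induction n rule: dec_induct)
  case base
  show ?case using residue_Suc[of x m] mod_mod_trivial[of "residue x (Suc m)" "pint TYPE('p) ^ m"] by simp
next
  case (step n)
  show ?case
    using mod_mod_pow_le[OF step.hyps(1), of "residue x (Suc n)" "pint TYPE('p)"] step.IH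
    unfolding residue_Suc by argo
qed

lemma residue_mod_self [simp]:
  "residue (x::'p::prime_card padic_int) n mod pint TYPE('p) ^ n = residue x n"
  by (simp add: residue_mod_le)

lemma residue_nonneg [simp]: "residue (x::'p::prime_card padic_int) n \<ge> 0"
  by (subst residue_mod_self[symmetric], rule pos_mod_sign, rule pint_pow_pos)

lemma residue_less [simp]: "residue (x::'p::prime_card padic_int) n < pint TYPE('p) ^ n"
  by (subst residue_mod_self[symmetric], rule pos_mod_bound, rule pint_pow_pos)

lemma residue_0 [simp]: "residue x 0 = 0"
  using residue_less[of x 0] residue_nonneg[of x 0] unfolding power_0 by linarith

instantiation padic_int :: (prime_card) comm_ring_1
begin

lift_definition zero_padic_int :: "'a padic_int" is "\<lambda>n. 0" by simp
lift_definition one_padic_int :: "'a padic_int" is "\<lambda>n. 1 mod pint TYPE('a) ^ n"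
  by (simp add: mod_mod_pow_le del: power_Suc)
lift_definition plus_padic_int :: "'a padic_int \<Rightarrow> 'a padic_int \<Rightarrow> 'a padic_int"
  is "\<lambda>f g n. (f n + g n) mod pint TYPE('a) ^ n"
  by (metis mod_add_cong mod_mod_pow_le mod_mod_trivial le_SucI order_refl)
lift_definition minus_padic_int :: "'a padic_int \<Rightarrow> 'a padic_int \<Rightarrow> 'a padic_int"
  is "\<lambda>f g n. (f n - g n) mod pint TYPE('a) ^ n"
  by (metis mod_diff_cong mod_mod_pow_le mod_mod_trivial le_SucI order_refl)
lift_definition uminus_padic_int :: "'a padic_int \<Rightarrow> 'a padic_int"
  is "\<lambda>f n. (- f n) mod pint TYPE('a) ^ n"
  by (metis mod_minus_cong mod_mod_pow_le mod_mod_trivial le_SucI order_refl)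
lift_definition times_padic_int :: "'a padic_int \<Rightarrow> 'a padic_int \<Rightarrow> 'a padic_int"
  is "\<lambda>f g n. (f n * g n) mod pint TYPE('a) ^ n"
  by (metis mod_mult_cong mod_mod_pow_le mod_mod_trivial le_SucI order_refl)

instance
proof
  fix a b c :: "'a padic_int"
  show "(0 :: 'a padic_int) \<noteq> 1"
  proof
    assume "(0 :: 'a padic_int) = 1"
    hence "residue (0 :: 'a padic_int) 1 = residue (1 :: 'a padic_int) 1" by simp
    thus False using pint_gt_1[where 'p='a]
      by (simp add: zero_padic_int.rep_eq one_padic_int.rep_eq)
  qed
qed (rule padic_int_eqI; simp add: plus_padic_int.rep_eq times_padic_int.rep_eq
  zero_padic_int.rep_eq one_padic_int.rep_eq minus_padic_int.rep_eq uminus_padic_int.rep_eq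
  mod_simps algebra_simps)+

end

lemmas residue_simps = plus_padic_int.rep_eq times_padic_int.rep_eq
  zero_padic_int.rep_eq one_padic_int.rep_eq minus_padic_int.rep_eq uminus_padic_int.rep_eq

lemma residue_of_nat: "residue (of_nat k :: 'p::prime_card padic_int) n = int k mod pint TYPE('p) ^ n"
  by (induction k) (simp_all add: residue_simps mod_simps add.commute)

lemma residue_of_int: "residue (of_int k :: 'p::prime_card padic_int) n = k mod pint TYPE('p) ^ n"
  by (cases k rule: int_cases2)
     (simp_all add: residue_of_nat residue_simps mod_simps)

definition val_int :: "'p::prime_card padic_int \<Rightarrow> nat" where
  "val_int x = (LEAST n. residue x (Suc n) \<noteq> 0)"

lemma residue_eq_0_iff: "residue x n = 0 \<longleftrightarrow> x = 0 \<or> n \<le> val_int x"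
proof (cases "x = 0")
  case True
  thus ?thesis by (simp add: residue_simps)
next
  case False
  then obtain k where "residue x k \<noteq> 0"
    by (metis padic_int_eqI zero_padic_int.rep_eq)
  hence ex: "\<exists>n. residue x (Suc n) \<noteq> 0" by (metis residue_0 not0_implies_Suc)
  have nz: "residue x (Suc (val_int x)) \<noteq> 0"
    unfolding val_int_def by (rule LeastI_ex[OF ex])
  show ?thesis
  proof
    assume "residue x n = 0"
    hence "\<not> Suc (val_int x) \<le> n" using nz by (metis residue_mod_le mod_0)
    thus "x = 0 \<or> n \<le> val_int x" by simp
  next
    assume "x = 0 \<or> n \<le> val_int x"
    hence n: "n \<le> val_int x" using False by simp
    show "residue x n = 0"
    proof (cases n)
      case (Suc m)
      hence "m < val_int x" using n by simp
      thus ?thesis unfolding Suc val_int_def using not_less_Least by blast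
    qed simp
  qed
qed

lemma val_int_dvd:
  assumes "x \<noteq> (0 :: 'p::prime_card padic_int)" "val_int x < n"
  shows "\<exists>u. residue x n = pint TYPE('p) ^ val_int x * u \<and> \<not> pint TYPE('p) dvd u"
proof -
  let ?p = "pint TYPE('p)"
  have "residue x n mod ?p ^ val_int x = 0"
    using residue_eq_0_iff[of x "val_int x"] residue_mod_le[of "val_int x" n x] assms by simp
  then obtain u where u: "residue x n = ?p ^ val_int x * u" by auto
  have "\<not> ?p dvd u"
  proof
    assume "?p dvd u"
    hence "residue x n mod ?p ^ Suc (val_int x) = 0" using u by auto
    hence "residue x (Suc (val_int x)) = 0" using assms residue_mod_le[of "Suc (val_int x)" n x] by simp
    thus False using assms residue_eq_0_iff[of x] by simp
  qed
  thus ?thesis using u by blast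
qed

lemma mult_padic_int:
  assumes "x \<noteq> (0 :: 'p::prime_card padic_int)" "y \<noteq> 0"
  shows "x * y \<noteq> 0 \<and> val_int (x * y) = val_int x + val_int y"
proof -
  let ?p = "pint TYPE('p)"
  let ?n = "val_int x + val_int y"
  obtain u where u: "residue x (Suc ?n) = ?p ^ val_int x * u" "\<not> ?p dvd u"
    using val_int_dvd[of x "Suc ?n"] assms by auto
  obtain v where v: "residue y (Suc ?n) = ?p ^ val_int y * v" "\<not> ?p dvd v"
    using val_int_dvd[of y "Suc ?n"] assms by auto
  have uv: "\<not> ?p dvd u * v"
    using u v prime_card_int[where 'a='p] prime_dvd_mult_iff by blast
  have r: "residue (x * y) (Suc ?n) = (?p ^ ?n * (u * v)) mod ?p ^ Suc ?n"
    by (simp add: residue_simps u v power_add mult_ac)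
  have p0: "?p \<noteq> 0" using pint_gt_1[where 'p='p] by simp
  have 1: "residue (x * y) (Suc ?n) \<noteq> 0"
  proof
    assume "residue (x * y) (Suc ?n) = 0"
    hence "?p ^ ?n * ?p dvd ?p ^ ?n * (u * v)" using r by (simp add: mod_eq_0_iff_dvd mult_ac)
    hence "?p dvd u * v" using p0 by (subst (asm) dvd_mult_cancel_left) auto
    thus False using uv by simp
  qed
  have 2: "residue (x * y) ?n = 0"
    using residue_Suc[of "x * y" ?n] r by (simp add: mod_mod_cancel)
  from 1 have "x * y \<noteq> 0" by (metis zero_padic_int.rep_eq)
  thus ?thesis using 1 2 residue_eq_0_iff[of "x*y"] by (metis le_antisym not_less_eq_eq)
qed

instance padic_int :: (prime_card) idom
  by standard (use mult_padic_int in blast)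

definition norm_int :: "'p::prime_card padic_int \<Rightarrow> real" where
  "norm_int x = (if x = 0 then 0 else inverse (real CARD('p)) ^ val_int x)"

lemma CARD_gt_1: "real CARD('p::prime_card) > 1"
  using prime_gt_1_nat[OF prime_card[where 'a='p]] by simp

lemma norm_int_nonneg [simp]: "norm_int x \<ge> 0"
  by (simp add: norm_int_def)

lemma norm_int_eq_0 [simp]: "norm_int x = 0 \<longleftrightarrow> x = 0"
  by (simp add: norm_int_def)

lemma norm_int_mult: "norm_int (x * y) = norm_int x * norm_int y"
  using mult_padic_int[of x y] by (auto simp: norm_int_def power_add)

lemma norm_int_le_iff:
  "norm_int (x::'p::prime_card padic_int) \<le> inverse (real CARD('p)) ^ n \<longleftrightarrow> residue x n = 0"
proof -
  have "inverse (real CARD('p)) ^ a \<le> inverse (real CARD('p)) ^ b \<longleftrightarrow> b \<le> a" for a b :: nat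
    using CARD_gt_1[where 'p='p] by (intro power_decreasing_iff) (auto simp: field_simps)
  thus ?thesis unfolding norm_int_def residue_eq_0_iff by simp
qed

lemma norm_int_le_1: "norm_int x \<le> 1"
  using norm_int_le_iff[of x 0] by simp

lemma norm_int_ultra: "norm_int (x + y) \<le> max (norm_int x) (norm_int (y::'p::prime_card padic_int))"
proof -
  have *: "norm_int (x + y) \<le> max (norm_int x) (norm_int y)" if "norm_int x \<le> norm_int y" for x y :: "'p padic_int"
  proof (cases "y = 0")
    case True
    thus ?thesis by auto
  next
    case False
    hence "norm_int y \<le> inverse (real CARD('p)) ^ val_int y" by (simp add: norm_int_def)
    moreover from this have "norm_int x \<le> inverse (real CARD('p)) ^ val_int y" using that by simp
    ultimately have "residue (x + y) (val_int y) = 0"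
      unfolding norm_int_le_iff by (simp add: residue_simps)
    hence "norm_int (x + y) \<le> norm_int y"
      unfolding norm_int_le_iff[symmetric] using False by (simp add: norm_int_def)
    thus ?thesis by simp
  qed
  show ?thesis using *[of x y] *[of y x] by (cases "norm_int x \<le> norm_int y") (auto simp: add.commute max.commute)
qed

lemma norm_int_minus [simp]: "norm_int (- x) = norm_int x"
proof -
  have "norm_int (-1 :: 'a padic_int) ^ 2 = norm_int ((-1) * (-1) :: 'a padic_int)"
    by (simp only: norm_int_mult power2_eq_square)
  also have "\<dots> = norm_int (1 * 1 :: 'a padic_int)" by simp
  finally have "norm_int (-1 :: 'a padic_int) ^ 2 = norm_int (1 :: 'a padic_int) ^ 2"
    by (simp only: norm_int_mult power2_eq_square)
  hence "norm_int (-1 :: 'a padic_int) = norm_int (1 :: 'a padic_int)"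
    by (rule power2_eq_imp_eq) auto
  thus ?thesis by (metis norm_int_mult mult_minus1 mult_1)
qed

lemma mult_residue_ex:
  fixes a b :: "'p::prime_card padic_int"
  assumes b: "b \<noteq> 0" and le: "norm_int a \<le> norm_int b"
  shows "\<exists>!z. z \<in> {0..<pint TYPE('p) ^ n} \<and>
    [residue b (n + val_int b) * z = residue a (n + val_int b)] (mod pint TYPE('p) ^ (n + val_int b))"
proof -
  let ?p = "pint TYPE('p)" and ?v = "val_int b"
  have p0: "?p ^ ?v \<noteq> 0" using pint_gt_1[where 'p='p] by simp
  obtain u where u: "residue b (n + ?v) = ?p ^ ?v * u" "coprime u (?p ^ n)"
  proof (cases "n = 0")
    case True
    hence "residue b (n + ?v) = 0" by (simp add: residue_eq_0_iff)
    thus ?thesis using that[of 0] True by simp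
  next
    case False
    then obtain u where u: "residue b (n + ?v) = ?p ^ ?v * u" "\<not> ?p dvd u"
      using val_int_dvd[of b "n + ?v"] b by auto
    have "coprime u (?p ^ n)"
      using u(2) prime_imp_coprime[OF prime_card_int[where 'a='p]] by (simp add: coprime_commute)
    thus ?thesis using u that by blast
  qed
  have "norm_int a \<le> inverse (real CARD('p)) ^ ?v" using le b by (simp add: norm_int_def)
  hence "residue a ?v = 0" by (simp add: norm_int_le_iff)
  hence "residue a (n + ?v) mod ?p ^ ?v = 0" using residue_mod_le[of ?v "n + ?v" a] by simp
  then obtain w where w: "residue a (n + ?v) = ?p ^ ?v * w" by auto
  have eq: "[residue b (n + ?v) * z = residue a (n + ?v)] (mod ?p ^ (n + ?v))
      \<longleftrightarrow> [u * z = w] (mod ?p ^ n)" for z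
  proof -
    have "[residue b (n + ?v) * z = residue a (n + ?v)] (mod ?p ^ (n + ?v)) \<longleftrightarrow>
      ?p ^ ?v * ?p ^ n dvd ?p ^ ?v * (u * z - w)"
      unfolding cong_iff_dvd_diff u w by (simp add: power_add algebra_simps)
    also have "\<dots> \<longleftrightarrow> ?p ^ n dvd u * z - w" using p0 by (subst dvd_mult_cancel_left) auto
    finally show ?thesis by (simp add: cong_iff_dvd_diff)
  qed
  obtain i where i: "[u * i = 1] (mod ?p ^ n)"
    using cong_solve_coprime_int[OF u(2)] by blast
  let ?z = "(i * w) mod ?p ^ n"
  have "[u * ?z = u * i * w] (mod ?p ^ n)" by (simp add: cong_def mod_simps mult_ac)
  also have "[u * i * w = 1 * w] (mod ?p ^ n)" using i by (rule cong_scalar_right)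
  finally have z: "[u * ?z = w] (mod ?p ^ n)" by simp
  show ?thesis unfolding eq
  proof (rule ex1I[of _ ?z])
    fix y assume y: "y \<in> {0..<?p ^ n} \<and> [u * y = w] (mod ?p ^ n)"
    hence "[u * y = u * ?z] (mod ?p ^ n)" using z by (metis cong_sym cong_trans)
    hence "[y = ?z] (mod ?p ^ n)" using u(2) by (simp add: cong_mult_lcancel)
    thus "y = ?z" using y by (simp add: cong_def)
  qed (use z in simp)
qed

lemma padic_int_dvdI:
  fixes a b :: "'p::prime_card padic_int"
  assumes b: "b \<noteq> 0" and le: "norm_int a \<le> norm_int b"
  shows "b dvd a"
proof -
  let ?p = "pint TYPE('p)" and ?v = "val_int b"
  define P where "P n z \<longleftrightarrow> z \<in> {0..<?p ^ n} \<and>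
    [residue b (n + ?v) * z = residue a (n + ?v)] (mod ?p ^ (n + ?v))" for n z
  have ex1: "\<exists>!z. P n z" for n unfolding P_def by (rule mult_residue_ex[OF assms])
  define f where "f n = (THE z. P n z)" for n
  have f: "P n (f n)" for n unfolding f_def by (rule theI'[OF ex1])
  have coh: "f n = f (Suc n) mod ?p ^ n" for n
  proof -
    have dvd: "?p ^ (n + ?v) dvd ?p ^ (Suc n + ?v)" by (rule le_imp_power_dvd) simp
    have r: "[residue c (Suc n + ?v) = residue c (n + ?v)] (mod ?p ^ (n + ?v))" for c :: "'p padic_int"
      unfolding cong_def by (subst residue_mod_le) simp_all
    have b0: "?p ^ ?v dvd residue b (n + ?v)"
      using residue_eq_0_iff[of b ?v] residue_mod_le[of ?v "n + ?v" b] by (simp add: dvd_eq_mod_eq_0)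
    obtain k where k: "f (Suc n) mod ?p ^ n = f (Suc n) - ?p ^ n * k"
      by (metis minus_mult_div_eq_mod)
    have "[residue b (n + ?v) * (f (Suc n) mod ?p ^ n) = residue b (n + ?v) * f (Suc n)] (mod ?p ^ (n + ?v))"
      unfolding cong_iff_dvd_diff k using b0 by (auto simp: power_add algebra_simps)
    also have "[residue b (n + ?v) * f (Suc n) = residue b (Suc n + ?v) * f (Suc n)] (mod ?p ^ (n + ?v))"
      by (rule cong_scalar_right[OF cong_sym[OF r]])
    also have "[residue b (Suc n + ?v) * f (Suc n) = residue a (Suc n + ?v)] (mod ?p ^ (n + ?v))"
      using f[of "Suc n"] unfolding P_def by (blast intro: cong_dvd_modulus[OF _ dvd])
    also note r
    finally have "P n (f (Suc n) mod ?p ^ n)" unfolding P_def by simp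
    thus ?thesis using f ex1 by blast
  qed
  define c :: "'p padic_int" where "c = Abs_padic_int f"
  have "f \<in> {f. \<forall>n. f n = f (Suc n) mod ?p ^ n}"
    unfolding mem_Collect_eq by (intro allI coh)
  hence c: "residue c n = f n" for n
    unfolding c_def by (simp only: Abs_padic_int_inverse)
  have "a = b * c"
  proof (rule padic_int_eqI)
    fix n
    have "[residue b (n + ?v) * f n = residue a (n + ?v)] (mod ?p ^ (n + ?v))"
      using f[of n] unfolding P_def by blast
    hence *: "[residue b (n + ?v) * f n = residue a (n + ?v)] (mod ?p ^ n)"
      by (rule cong_dvd_modulus) (simp add: le_imp_power_dvd)
    have r: "[residue d (n + ?v) = residue d n] (mod ?p ^ n)" for d :: "'p padic_int"
      unfolding cong_def by (subst residue_mod_le) simp_all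
    have "[residue b n * f n = residue a n] (mod ?p ^ n)"
      using * r[of a] cong_scalar_right[OF r[of b], of "f n"] by (metis cong_sym cong_trans)
    thus "residue a n = residue (b * c) n"
      by (simp add: residue_simps c cong_def)
  qed
  thus ?thesis by simp
qed

text \<open>The field of p-adic numbers is the fraction field of the ring of p-adic integers.\<close>

typedef (overloaded) ('p::prime_card) padic = "UNIV :: 'p padic_int fract set"
  morphisms fract_of_padic padic_of_fract ..

setup_lifting type_definition_padic

instantiation padic :: (prime_card) field
begin
lift_definition zero_padic :: "'a padic" is 0 .
lift_definition one_padic :: "'a padic" is 1 .
lift_definition plus_padic :: "'a padic \<Rightarrow> 'a padic \<Rightarrow> 'a padic" is "(+)" .
lift_definition minus_padic :: "'a padic \<Rightarrow> 'a padic \<Rightarrow> 'a padic" is "(-)" .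
lift_definition uminus_padic :: "'a padic \<Rightarrow> 'a padic" is uminus .
lift_definition times_padic :: "'a padic \<Rightarrow> 'a padic \<Rightarrow> 'a padic" is "(*)" .
lift_definition inverse_padic :: "'a padic \<Rightarrow> 'a padic" is inverse .
lift_definition divide_padic :: "'a padic \<Rightarrow> 'a padic \<Rightarrow> 'a padic" is "(/)" .
instance
  by standard (transfer; simp add: algebra_simps divide_inverse)+
end

definition norm_fract :: "'p::prime_card padic_int fract \<Rightarrow> real" where
  "norm_fract q = (THE r. \<exists>a b. b \<noteq> 0 \<and> q = Fract a b \<and> r = norm_int a / norm_int b)"

lemma norm_fract_Fract:
  fixes a b :: "'p::prime_card padic_int"
  assumes b: "b \<noteq> 0"
  shows "norm_fract (Fract a b) = norm_int a / norm_int b"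
  unfolding norm_fract_def
proof (rule the_equality)
  fix r
  assume "\<exists>c d. d \<noteq> 0 \<and> Fract a b = Fract c d \<and> r = norm_int c / norm_int d"
  then obtain c d where cd: "d \<noteq> 0" "Fract a b = Fract c d" "r = norm_int c / norm_int d" by blast
  hence "norm_int (a * d) = norm_int (c * b)" using b by (simp add: eq_fract)
  hence "norm_int a * norm_int d = norm_int c * norm_int b" by (simp only: norm_int_mult)
  thus "r = norm_int a / norm_int b" using b cd(1) unfolding cd(3) by (simp add: frac_eq_eq)
qed (use b in blast)

definition padic_norm :: "'p::prime_card padic \<Rightarrow> real" where
  "padic_norm x = norm_fract (fract_of_padic x)"

definition of_padic_int :: "'p::prime_card padic_int \<Rightarrow> 'p padic" where
  "of_padic_int x = padic_of_fract (Fract x 1)"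

lemma fract_of_padic_int [simp]: "fract_of_padic (of_padic_int x) = Fract x 1"
  by (simp add: of_padic_int_def padic_of_fract_inverse)

lemmas padic_rep_simps = fract_of_padic_inject[symmetric] zero_padic.rep_eq one_padic.rep_eq
  plus_padic.rep_eq minus_padic.rep_eq uminus_padic.rep_eq times_padic.rep_eq divide_padic.rep_eq

lemma of_padic_int_simps:
  "of_padic_int 0 = 0" "of_padic_int 1 = 1"
  "of_padic_int (x + y) = of_padic_int x + of_padic_int y"
  "of_padic_int (x - y) = of_padic_int x - of_padic_int y"
  "of_padic_int (x * y) = of_padic_int x * of_padic_int y"
  by (simp_all add: padic_rep_simps fract_expand)

lemma of_padic_int_of_nat: "of_padic_int (of_nat k) = of_nat k"
  by (induction k) (simp_all add: of_padic_int_simps)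

lemma of_padic_int_power: "of_padic_int (x ^ k) = of_padic_int x ^ k"
  by (induction k) (simp_all add: of_padic_int_simps)

lemma padic_norm_of_padic_int [simp]: "padic_norm (of_padic_int x) = norm_int x"
  by (simp add: padic_norm_def norm_fract_Fract norm_int_def[of 1]
    val_int_def residue_simps Least_equality)

lemma of_padic_int_eq_iff: "of_padic_int x = of_padic_int y \<longleftrightarrow> x = y"
  by (simp add: padic_rep_simps eq_fract)

lemma padic_quotientE:
  obtains a b where "x = of_padic_int a / of_padic_int b" "b \<noteq> 0"
proof -
  obtain a b where "b \<noteq> 0" "fract_of_padic x = Fract a b" by (cases "fract_of_padic x")
  hence "x = of_padic_int a / of_padic_int b" by (simp add: padic_rep_simps)
  thus ?thesis using that \<open>b \<noteq> 0\<close> by blast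
qed

lemma padic_norm_divide_int:
  "b \<noteq> 0 \<Longrightarrow> padic_norm (of_padic_int a / of_padic_int b) = norm_int a / norm_int b"
  by (simp add: padic_norm_def padic_rep_simps norm_fract_Fract)

lemma padic_norm_mult: "padic_norm (x * y) = padic_norm x * padic_norm y"
proof -
  obtain a b where x: "x = of_padic_int a / of_padic_int b" "b \<noteq> 0" by (rule padic_quotientE)
  obtain c d where y: "y = of_padic_int c / of_padic_int d" "d \<noteq> 0" by (rule padic_quotientE)
  have eq: "x * y = of_padic_int (a * c) / of_padic_int (b * d)"
    unfolding x(1) y(1) of_padic_int_simps by simp
  have bd: "b * d \<noteq> 0" using x y by simp
  have "padic_norm (x * y) = norm_int (a * c) / norm_int (b * d)"
    unfolding eq by (rule padic_norm_divide_int[OF bd])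
  also have "\<dots> = padic_norm x * padic_norm y"
    unfolding x(1) y(1) padic_norm_divide_int[OF x(2)] padic_norm_divide_int[OF y(2)] by (simp add: norm_int_mult)
  finally show ?thesis .
qed

lemma padic_norm_nonneg [simp]: "padic_norm x \<ge> 0"
  by (rule padic_quotientE[of x]) (simp add: padic_norm_divide_int)

lemma padic_norm_eq_0 [simp]: "padic_norm x = 0 \<longleftrightarrow> x = 0"
proof -
  obtain a b where x: "x = of_padic_int a / of_padic_int b" "b \<noteq> 0" by (rule padic_quotientE)
  have b: "of_padic_int b \<noteq> 0"
    using x(2) of_padic_int_eq_iff[of b 0] by (simp add: of_padic_int_simps)
  have a: "of_padic_int a = 0 \<longleftrightarrow> a = 0"
    using of_padic_int_eq_iff[of a 0] by (simp add: of_padic_int_simps)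
  show ?thesis using b x(2) unfolding x(1) padic_norm_divide_int[OF x(2)] by (simp add: a)
qed

lemma padic_norm_0 [simp]: "padic_norm 0 = 0"
  by simp

lemma padic_norm_minus [simp]: "padic_norm (- x) = padic_norm x"
proof -
  have "of_padic_int (- a) = - of_padic_int a" for a :: "'a padic_int"
    by (simp add: padic_rep_simps)
  hence *: "- (of_padic_int a / y) = of_padic_int (- a) / y" for a and y :: "'a padic" by simp
  obtain a b where x: "x = of_padic_int a / of_padic_int b" "b \<noteq> 0" by (rule padic_quotientE)
  show ?thesis unfolding x(1) * padic_norm_divide_int[OF x(2)] by simp
qed

lemma padic_norm_diff_commute: "padic_norm (x - y) = padic_norm (y - x)"
  by (metis padic_norm_minus minus_diff_eq)

lemma padic_norm_1 [simp]: "padic_norm (1 :: 'p::prime_card padic) = 1"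
proof -
  have "padic_norm (1 :: 'p padic) * padic_norm (1 :: 'p padic) = padic_norm (1 :: 'p padic)"
    using padic_norm_mult[of 1 "1 :: 'p padic"] by simp
  moreover have "padic_norm (1 :: 'p padic) \<noteq> 0" by simp
  ultimately show ?thesis by simp
qed

lemma padic_norm_ultra: "padic_norm (x + y) \<le> max (padic_norm x) (padic_norm y)"
proof -
  obtain a b where x: "x = of_padic_int a / of_padic_int b" "b \<noteq> 0" by (rule padic_quotientE)
  obtain c d where y: "y = of_padic_int c / of_padic_int d" "d \<noteq> 0" by (rule padic_quotientE)
  have nz: "of_padic_int b \<noteq> 0" "of_padic_int d \<noteq> 0"
    using x(2) y(2) of_padic_int_eq_iff[of b 0] of_padic_int_eq_iff[of d 0] by (simp_all add: of_padic_int_simps)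
  have eq: "x + y = of_padic_int (a * d + c * b) / of_padic_int (b * d)"
    using nz by (simp add: x y of_padic_int_simps add_frac_eq)
  have bd: "b * d \<noteq> 0" using x y by simp
  have "padic_norm (x + y) = norm_int (a * d + c * b) / norm_int (b * d)"
    unfolding eq by (rule padic_norm_divide_int[OF bd])
  also have "\<dots> \<le> max (norm_int (a * d)) (norm_int (c * b)) / norm_int (b * d)"
    by (intro divide_right_mono norm_int_ultra) simp
  also have "\<dots> = max (norm_int (a * d) / norm_int (b * d)) (norm_int (c * b) / norm_int (b * d))"
    unfolding max_divide_distrib_right using norm_int_nonneg[of "b * d"] by argo
  also have "\<dots> = max (padic_norm x) (padic_norm y)"
    using x y by (simp add: padic_norm_divide_int norm_int_mult)
  finally show ?thesis .
qed

lemma padic_norm_ultra_diff: "padic_norm (x - y) \<le> max (padic_norm (x - z)) (padic_norm (z - y))"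
  using padic_norm_ultra[of "x - z" "z - y"] by simp

instantiation padic :: (prime_card) metric_space
begin
definition dist_padic :: "'a padic \<Rightarrow> 'a padic \<Rightarrow> real" where
  "dist_padic x y = padic_norm (x - y)"
definition uniformity_padic :: "('a padic \<times> 'a padic) filter" where
  "uniformity_padic = (INF e\<in>{0 <..}. principal {(x, y). dist x y < e})"
definition open_padic :: "'a padic set \<Rightarrow> bool" where
  "open_padic U \<longleftrightarrow> (\<forall>x\<in>U. \<forall>\<^sub>F (x', y) in uniformity. x' = x \<longrightarrow> y \<in> U)"
instance
proof
  fix x y z :: "'a padic"
  show "dist x y \<le> dist x z + dist y z"
    using padic_norm_ultra_diff[of x y z] padic_norm_nonneg[of "x - z"] padic_norm_nonneg[of "z - y"]
    unfolding dist_padic_def padic_norm_diff_commute[of y z] by linarith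
qed (simp_all add: dist_padic_def uniformity_padic_def open_padic_def)
end

lemma padic_norm_le_1_iff: "padic_norm x \<le> 1 \<longleftrightarrow> x \<in> range of_padic_int"
proof
  assume le: "padic_norm x \<le> 1"
  obtain a b where x: "x = of_padic_int a / of_padic_int b" "b \<noteq> 0" by (rule padic_quotientE)
  have "norm_int b > 0" using x(2) norm_int_nonneg[of b] norm_int_eq_0[of b] by linarith
  hence "norm_int a \<le> norm_int b" using le x by (simp add: padic_norm_divide_int)
  then obtain c where "a = b * c" using padic_int_dvdI[OF x(2)] by blast
  moreover have "of_padic_int b \<noteq> 0"
    using x(2) of_padic_int_eq_iff[of b 0] by (simp add: of_padic_int_simps)
  ultimately have "x = of_padic_int c"
    unfolding x(1) by (simp add: of_padic_int_simps)
  thus "x \<in> range of_padic_int" by (rule range_eqI)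
next
  assume "x \<in> range of_padic_int"
  then obtain c where "x = of_padic_int c" by (rule imageE)
  thus "padic_norm x \<le> 1" by (simp add: norm_int_le_1)
qed

lemma norm_int_prime: "norm_int (of_nat CARD('p) :: 'p::prime_card padic_int) = inverse (real CARD('p))"
proof -
  let ?x = "of_nat CARD('p) :: 'p padic_int"
  have 1: "residue ?x 1 = 0" unfolding residue_of_nat by (simp only: power_one_right mod_self)
  have "pint TYPE('p) * 1 < pint TYPE('p) * pint TYPE('p)"
    using pint_gt_1[where 'p='p] by (intro mult_strict_left_mono) simp_all
  hence 2: "residue ?x 2 \<noteq> 0" using pint_gt_1[where 'p='p]
    unfolding residue_of_nat power2_eq_square by (subst mod_pos_pos_trivial) simp_all
  have "?x \<noteq> 0"
  proof
    assume "?x = 0"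
    hence "residue ?x 2 = 0" by (simp only: zero_padic_int.rep_eq)
    thus False using 2 by simp
  qed
  moreover from this have "val_int ?x = 1" using 1 2 unfolding residue_eq_0_iff by linarith
  ultimately show ?thesis unfolding norm_int_def by (simp only: if_False power_one_right)
qed

lemma padic_norm_prime [simp]: "padic_norm (of_nat CARD('p) :: 'p::prime_card padic) = inverse (real CARD('p))"
  unfolding of_padic_int_of_nat[symmetric] padic_norm_of_padic_int by (rule norm_int_prime)

instance padic :: (prime_card) field_char_0
proof
  show "inj (of_nat :: nat \<Rightarrow> 'a padic)"
  proof (rule injI)
    fix m n :: nat assume "of_nat m = (of_nat n :: 'a padic)"
    hence "of_padic_int (of_nat m) = (of_padic_int (of_nat n) :: 'a padic)"
      unfolding of_padic_int_of_nat .
    hence "of_nat m = (of_nat n :: 'a padic_int)" unfolding of_padic_int_eq_iff .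
    hence "residue (of_nat m :: 'a padic_int) (m + n) = residue (of_nat n :: 'a padic_int) (m + n)" by (rule arg_cong)
    hence eq: "int m mod pint TYPE('a) ^ (m + n) = int n mod pint TYPE('a) ^ (m + n)"
      unfolding residue_of_nat .
    have lt: "int k < pint TYPE('a) ^ (m + n)" if "k \<le> m + n" for k
    proof -
      have "m + n < CARD('a) ^ (m + n)"
        using prime_gt_1_nat[OF prime_card[where 'a='a]] by (intro power_gt_expt) auto
      hence "int k < int (CARD('a) ^ (m + n))" using that by linarith
      thus ?thesis unfolding of_nat_power .
    qed
    have "int m = int n" using eq
      unfolding mod_pos_pos_trivial[OF of_nat_0_le_iff lt[of m, OF le_add1]]
        mod_pos_pos_trivial[OF of_nat_0_le_iff lt[of n, OF le_add2]] .
    thus "m = n" by (simp only: of_nat_eq_iff)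
  qed
qed

lemma of_padic_int_of_int: "of_padic_int (of_int k) = of_int k"
proof -
  have "of_padic_int (- a) = - of_padic_int a" for a :: "'a padic_int"
    by (simp add: padic_rep_simps)
  thus ?thesis by (cases k rule: int_cases2) (simp_all add: of_padic_int_of_nat)
qed

lemma padic_norm_of_int_le_iff:
  "padic_norm (of_int k :: 'p::prime_card padic) \<le> inverse (real CARD('p)) ^ n \<longleftrightarrow> pint TYPE('p) ^ n dvd k"
  unfolding of_padic_int_of_int[symmetric] padic_norm_of_padic_int norm_int_le_iff residue_of_int
  by (simp add: dvd_eq_mod_eq_0)

lemma padic_norm_of_int_le_1: "padic_norm (of_int k) \<le> 1"
  using padic_norm_of_int_le_iff[of k 0] by simp

lemma padic_norm_inverse: "padic_norm (inverse x) = inverse (padic_norm x)"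
proof (cases "x = 0")
  case False
  have "padic_norm x * padic_norm (inverse x) = 1"
    using False by (simp flip: padic_norm_mult)
  thus ?thesis by (metis inverse_unique)
qed simp

lemma padic_norm_power: "padic_norm (x ^ n) = padic_norm x ^ n"
  by (induction n) (simp_all add: padic_norm_mult)

lemma padic_norm_powi: "padic_norm (x powi k) = padic_norm x powi k"
  by (simp add: power_int_def padic_norm_power padic_norm_inverse)

lemma padic_norm_sum_le:
  assumes "\<And>i. i \<in> A \<Longrightarrow> padic_norm (f i) \<le> c" "c \<ge> 0"
  shows "padic_norm (sum f A) \<le> c"
  using assms(1)
proof (induction A rule: infinite_finite_induct)
  case (insert a A)
  thus ?case using padic_norm_ultra[of "f a" "sum f A"] by force
qed (use assms(2) in simp_all)

lemma padic_norm_limit_le: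
  assumes "f \<longlonglongrightarrow> x" "\<forall>\<^sub>F n in sequentially. padic_norm (f n - c) \<le> r"
  shows "padic_norm (x - c) \<le> r"
proof (rule tendsto_upperbound)
  show "((\<lambda>n. dist (f n) c) \<longlongrightarrow> padic_norm (x - c)) sequentially"
    unfolding dist_padic_def[symmetric] using assms(1) by (intro tendsto_intros)
qed (use assms(2) in \<open>auto simp: dist_padic_def\<close>)

definition is_padic_expansion :: "'p::prime_card padic \<Rightarrow> int \<Rightarrow> (int \<Rightarrow> nat) \<Rightarrow> bool" where
  "is_padic_expansion x g d \<longleftrightarrow> (\<forall>j. d j < CARD('p)) \<and> (\<forall>j<g. d j = 0) \<and>
     (\<lambda>i. of_nat (d (g + int i)) * of_nat CARD('p) powi (g + int i)) sums x"

text \<open>Well-defined by \<open>is_padic_expansion_ex\<close> and \<open>is_padic_expansion_unique\<close> below.\<close>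

definition padic_digit :: "'p::prime_card padic \<Rightarrow> int \<Rightarrow> nat" where
  "padic_digit x = (THE d. \<exists>g. is_padic_expansion x g d)"

lemma is_padic_expansion_extend:
  fixes x :: "'p::prime_card padic"
  assumes "is_padic_expansion x (g + int k) d"
  shows "is_padic_expansion x g d"
proof -
  let ?t = "\<lambda>j. of_nat (d j) * (of_nat CARD('p) :: 'p padic) powi j"
  have 0: "d j = 0" if "j < g + int k" for j
    using assms that unfolding is_padic_expansion_def by blast
  have "(\<Sum>i<n + k. ?t (g + int i)) = (\<Sum>i<n. ?t (g + int k + int i))" for n
    by (induction n) (simp_all add: 0 add_ac)
  hence "(\<lambda>n. \<Sum>i<n + k. ?t (g + int i)) \<longlonglongrightarrow> x"
    using assms by (simp add: is_padic_expansion_def sums_def)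
  hence "(\<lambda>n. \<Sum>i<n. ?t (g + int i)) \<longlonglongrightarrow> x" by (rule LIMSEQ_offset)
  thus ?thesis using assms 0 unfolding is_padic_expansion_def sums_def by auto
qed

lemma p_powi_pos: "inverse (real CARD('p::prime_card)) powi k > 0"
  using CARD_gt_1[where 'p='p] by simp

lemma is_padic_expansion_tail:
  fixes x :: "'p::prime_card padic"
  assumes "is_padic_expansion x g d"
  shows "padic_norm (x - (\<Sum>i<n. of_nat (d (g + int i)) * of_nat CARD('p) powi (g + int i)))
    \<le> inverse (real CARD('p)) powi (g + int n)"
proof (rule padic_norm_limit_le)
  let ?t = "\<lambda>i. of_nat (d (g + int i)) * (of_nat CARD('p) :: 'p padic) powi (g + int i)"
  show "(\<lambda>n. \<Sum>i<n. ?t i) \<longlonglongrightarrow> x"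
    using assms by (simp add: is_padic_expansion_def sums_def)
  show "\<forall>\<^sub>F m in sequentially. padic_norm ((\<Sum>i<m. ?t i) - (\<Sum>i<n. ?t i))
    \<le> inverse (real CARD('p)) powi (g + int n)"
  proof (rule eventually_sequentiallyI[of n])
    fix m assume "n \<le> m"
    hence "(\<Sum>i<m. ?t i) - (\<Sum>i<n. ?t i) = (\<Sum>i\<in>{n..<m}. ?t i)"
      by (simp add: sum_diff_nat_ivl lessThan_atLeast0)
    also have "padic_norm \<dots> \<le> inverse (real CARD('p)) powi (g + int n)"
    proof (rule padic_norm_sum_le)
      fix i assume "i \<in> {n..<m}"
      have "padic_norm (?t i) \<le> 1 * inverse (real CARD('p)) powi (g + int i)"
        unfolding padic_norm_mult padic_norm_powi padic_norm_prime
        using padic_norm_of_int_le_1[of "int (d (g + int i))"] p_powi_pos[where 'p='p and k="g + int i"]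
        by (intro mult_right_mono) simp_all
      also have "\<dots> \<le> inverse (real CARD('p)) powi (g + int n)"
        unfolding mult_1 using CARD_gt_1[where 'p='p] \<open>i \<in> {n..<m}\<close>
        by (intro power_int_decreasing) (auto simp: field_simps)
      finally show "padic_norm (?t i) \<le> inverse (real CARD('p)) powi (g + int n)" .
    qed (rule less_imp_le[OF p_powi_pos])
    finally show "padic_norm ((\<Sum>i<m. ?t i) - (\<Sum>i<n. ?t i))
      \<le> inverse (real CARD('p)) powi (g + int n)" .
  qed
qed

lemma is_padic_expansion_unique:
  fixes x :: "'p::prime_card padic"
  assumes "is_padic_expansion x g d" "is_padic_expansion x g' d'"
  shows "d = d'"
proof -
  define h where "h = min g g'"
  have "is_padic_expansion x h d" "is_padic_expansion x h d'"
    using assms is_padic_expansion_extend[of x h "nat (g - h)" d]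
      is_padic_expansion_extend[of x h "nat (g' - h)" d'] by (simp_all add: h_def)
  note e = this
  let ?P = "of_nat CARD('p) :: 'p padic"
  let ?q = "inverse (real CARD('p))"
  have eq: "d (h + int i) = d' (h + int i)" for i
  proof (induction i rule: less_induct)
    case (less i)
    let ?S = "\<lambda>d. \<Sum>k<Suc i. of_nat (d (h + int k)) * ?P powi (h + int k)"
    let ?k = "int (d (h + int i)) - int (d' (h + int i))"
    have "padic_norm (?S d - ?S d') \<le> max (padic_norm (x - ?S d)) (padic_norm (x - ?S d'))"
      using padic_norm_ultra_diff[of "?S d" "?S d'" x] by (simp only: padic_norm_diff_commute)
    also have "\<dots> \<le> ?q powi (h + int (Suc i))"
      using is_padic_expansion_tail[OF e(1), of "Suc i"] is_padic_expansion_tail[OF e(2), of "Suc i"] by simp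
    also have "?S d - ?S d' = of_int ?k * ?P powi (h + int i)"
      using less.IH by (simp add: algebra_simps)
    also have "padic_norm \<dots> = padic_norm (of_int ?k :: 'p padic) * ?q powi (h + int i)"
      unfolding padic_norm_mult padic_norm_powi padic_norm_prime ..
    also have "?q powi (h + int (Suc i)) = ?q ^ 1 * ?q powi (h + int i)"
      using CARD_gt_1[where 'p='p] by (simp add: power_int_add)
    finally have "padic_norm (of_int ?k :: 'p padic) \<le> ?q ^ 1"
      using p_powi_pos[where 'p='p and k="h + int i"] by (rule mult_right_le_imp_le)
    hence "pint TYPE('p) dvd ?k" unfolding padic_norm_of_int_le_iff by simp
    moreover have "\<bar>?k\<bar> < pint TYPE('p)"
    proof -
      have "d (h + int i) < CARD('p)" "d' (h + int i) < CARD('p)"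
        using e unfolding is_padic_expansion_def by blast+
      thus ?thesis by linarith
    qed
    ultimately have "?k = 0" using zdvd_not_zless[of "\<bar>?k\<bar>" "pint TYPE('p)"] by fastforce
    thus ?case by simp
  qed
  show ?thesis
  proof
    fix j show "d j = d' j"
    proof (cases "j < h")
      case True
      thus ?thesis using e unfolding is_padic_expansion_def by simp
    next
      case False
      thus ?thesis using eq[of "nat (j - h)"] by simp
    qed
  qed
qed

lemma tendsto_p_power: "(\<lambda>n. inverse (real CARD('p::prime_card)) ^ n) \<longlonglongrightarrow> 0"
  using CARD_gt_1[where 'p='p] by (intro LIMSEQ_realpow_zero) (auto simp: field_simps)

lemma padic_scaleE:
  fixes x :: "'p::prime_card padic"
  obtains N z where "x = of_padic_int z * of_nat CARD('p) powi (- int N)"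
proof -
  let ?P = "of_nat CARD('p) :: 'p padic"
  have P0: "?P \<noteq> 0" by simp
  obtain N where N: "padic_norm x < real CARD('p) ^ N"
    using real_arch_pow[OF CARD_gt_1[where 'p='p]] by blast
  have "padic_norm (x * ?P ^ N) = padic_norm x / real CARD('p) ^ N"
    by (simp add: padic_norm_mult padic_norm_power field_simps)
  also have "\<dots> \<le> 1" using N CARD_gt_1[where 'p='p] by simp
  finally obtain z where "x * ?P ^ N = of_padic_int z" unfolding padic_norm_le_1_iff by blast
  hence "x = of_padic_int z * ?P powi (- int N)"
    using P0 by (simp add: power_int_minus field_simps)
  thus ?thesis by (rule that)
qed

lemma padic_norm_diff_residue:
  "padic_norm (of_padic_int z - of_int (residue z n) :: 'p::prime_card padic) \<le> inverse (real CARD('p)) ^ n"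
  unfolding of_padic_int_of_int[symmetric] of_padic_int_simps(4)[symmetric] padic_norm_of_padic_int norm_int_le_iff
  by (simp add: residue_simps residue_of_int)

lemma is_padic_expansion_ex: "\<exists>g d. is_padic_expansion (x :: 'p::prime_card padic) g d"
proof -
  let ?P = "of_nat CARD('p) :: 'p padic" and ?p = "pint TYPE('p)"
  have P0: "?P \<noteq> 0" by simp
  obtain N z where x: "x = of_padic_int z * ?P powi (- int N)" by (rule padic_scaleE)
  define e where "e n = nat (residue z (Suc n) div ?p ^ n)" for n
  define d where "d j = (if j < - int N then 0 else e (nat (j + int N)))" for j
  have e: "int (e n) = residue z (Suc n) div ?p ^ n" for n
    unfolding e_def by (simp add: pos_imp_zdiv_nonneg_iff)
  have e_less: "e n < CARD('p)" for n
  proof -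
    have "residue z (Suc n) < ?p ^ n * ?p" using residue_less[of z "Suc n"] by (simp add: mult.commute)
    moreover have "?p ^ n * (residue z (Suc n) div ?p ^ n) + residue z n = residue z (Suc n)"
      using mult_div_mod_eq[of "?p ^ n" "residue z (Suc n)"] unfolding residue_Suc .
    ultimately have "?p ^ n * (residue z (Suc n) div ?p ^ n) < ?p ^ n * ?p"
      using residue_nonneg[of z n] by linarith
    hence "int (e n) < ?p" unfolding e by (simp only: mult_less_cancel_left_pos pint_pow_pos)
    thus ?thesis by simp
  qed
  have step: "residue z (Suc n) = residue z n + int (e n) * ?p ^ n" for n
    using div_mult_mod_eq[of "residue z (Suc n)" "?p ^ n"] unfolding e residue_Suc by simp
  have sum: "(\<Sum>i<n. of_nat (d (- int N + int i)) * ?P powi (- int N + int i))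
      = of_int (residue z n) * ?P powi (- int N)" for n
  proof (induction n)
    case (Suc n)
    have "d (- int N + int n) = e n" by (simp add: d_def)
    moreover have "?P powi (- int N + int n) = ?P powi (- int N) * ?P ^ n"
      using P0 by (simp only: power_int_add power_int_of_nat simp_thms)
    ultimately show ?case
      unfolding sum.lessThan_Suc Suc step by (simp add: algebra_simps)
  qed simp
  have "(\<lambda>n. of_int (residue z n) * ?P powi (- int N)) \<longlonglongrightarrow> x"
  proof (rule metric_LIMSEQ_I)
    fix r :: real assume "r > 0"
    have "(\<lambda>n. inverse (real CARD('p)) ^ n * real CARD('p) ^ N) \<longlonglongrightarrow> 0 * real CARD('p) ^ N"
      by (intro tendsto_intros tendsto_p_power)
    hence "\<forall>\<^sub>F n in sequentially. inverse (real CARD('p)) ^ n * real CARD('p) ^ N < r"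
      using \<open>r > 0\<close> by (intro order_tendstoD) auto
    then obtain n0 where n0: "\<And>n. n \<ge> n0 \<Longrightarrow> inverse (real CARD('p)) ^ n * real CARD('p) ^ N < r"
      unfolding eventually_sequentially by blast
    show "\<exists>n0. \<forall>n\<ge>n0. dist (of_int (residue z n) * ?P powi (- int N)) x < r"
    proof (intro exI allI impI)
      fix n assume "n \<ge> n0"
      have "dist (of_int (residue z n) * ?P powi (- int N)) x
        = padic_norm ((of_padic_int z - of_int (residue z n)) * ?P powi (- int N))"
        unfolding dist_commute[of _ x] unfolding dist_padic_def x by (simp add: left_diff_distrib)
      also have "\<dots> = padic_norm (of_padic_int z - of_int (residue z n) :: 'p padic) * real CARD('p) ^ N"
        unfolding padic_norm_mult padic_norm_powi padic_norm_prime by (simp add: power_int_minus power_inverse)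
      also have "\<dots> \<le> inverse (real CARD('p)) ^ n * real CARD('p) ^ N"
        by (intro mult_right_mono padic_norm_diff_residue) simp
      also have "\<dots> < r" by (rule n0) fact
      finally show "dist (of_int (residue z n) * ?P powi (- int N)) x < r" .
    qed
  qed
  hence "is_padic_expansion x (- int N) d"
    unfolding is_padic_expansion_def sums_def sum by (simp add: d_def e_less)
  thus ?thesis by blast
qed

lemma padic_digit_expansion: "\<exists>g. is_padic_expansion x g (padic_digit x)"
proof -
  have "\<exists>!d. \<exists>g. is_padic_expansion x g d"
    using is_padic_expansion_ex is_padic_expansion_unique by metis
  thus ?thesis unfolding padic_digit_def by (rule theI')
qed

text \<open>The sum ranges over finitely many indices, since almost all digits at negative places are 0.\<close>

definition padic_frac :: "'p::prime_card padic \<Rightarrow> rat" where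
  "padic_frac x = (\<Sum>j | j < 0 \<and> padic_digit x j \<noteq> 0. of_nat (padic_digit x j) * of_nat CARD('p) powi j)"

lemma finite_negative_digits: "finite {j. j < 0 \<and> padic_digit x j \<noteq> 0}"
proof -
  obtain g where "is_padic_expansion x g (padic_digit x)" using padic_digit_expansion by blast
  hence "padic_digit x j = 0" if "j < g" for j
    using that unfolding is_padic_expansion_def by blast
  hence "{j. j < 0 \<and> padic_digit x j \<noteq> 0} \<subseteq> {g..<0}"
    by (auto simp: not_less[symmetric])
  thus ?thesis by (rule finite_subset) simp
qed

lemma mem_cball_padic: "x \<in> cball c r \<longleftrightarrow> padic_norm (x - c) \<le> r"
  by (simp add: dist_padic_def padic_norm_diff_commute)

abbreviation (input) padic_ball :: "'p::prime_card padic \<Rightarrow> nat \<Rightarrow> 'p padic set" where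
  "padic_ball c n \<equiv> cball c (inverse (real CARD('p)) ^ n)"

lemma cball_padic_eq:
  assumes "padic_norm (c - d) \<le> r"
  shows "cball c r = cball (d :: 'p::prime_card padic) r"
proof -
  have "cball c r \<subseteq> cball d r" if "padic_norm (c - d) \<le> r" for c d :: "'p padic"
    using that padic_norm_ultra_diff[of _ d c] unfolding subset_iff mem_cball_padic
    by (meson max.boundedI order_trans)
  thus ?thesis using assms padic_norm_diff_commute[of c d] by fastforce
qed

lemma padic_dense_rat: "\<exists>q. padic_norm (x - of_rat q) \<le> inverse (real CARD('p)) ^ n"
  for x :: "'p::prime_card padic"
proof -
  let ?P = "of_nat CARD('p) :: 'p padic"
  obtain N z where x: "x = of_padic_int z * ?P powi (- int N)" by (rule padic_scaleE)
  have eq: "of_rat (of_int (residue z (n + N)) / of_nat (CARD('p) ^ N)) =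
      of_int (residue z (n + N)) * ?P powi (- int N)"
    by (simp add: of_rat_divide power_int_minus divide_inverse of_rat_power of_rat_mult of_rat_inverse)
  have "padic_norm (x - of_int (residue z (n + N)) * ?P powi (- int N))
      = padic_norm ((of_padic_int z - of_int (residue z (n + N))) * ?P powi (- int N))"
    unfolding x by (simp add: algebra_simps)
  also have "\<dots> = padic_norm (of_padic_int z - of_int (residue z (n + N)) :: 'p padic) * real CARD('p) ^ N"
    unfolding padic_norm_mult padic_norm_powi padic_norm_prime by (simp add: power_int_minus power_inverse)
  also have "\<dots> \<le> inverse (real CARD('p)) ^ (n + N) * real CARD('p) ^ N"
    by (intro mult_right_mono padic_norm_diff_residue) simp
  also have "\<dots> = inverse (real CARD('p)) ^ n"
    by (simp add: power_add power_inverse)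
  finally show ?thesis unfolding eq[symmetric] by blast
qed

definition padic_balls :: "'p::prime_card padic set set" where
  "padic_balls = insert {} {padic_ball c n | c n. True}"

lemma Int_stable_padic_balls: "Int_stable (padic_balls :: 'p::prime_card padic set set)"
proof (rule Int_stableI)
  fix A B :: "'p padic set"
  assume A: "A \<in> padic_balls" and B: "B \<in> padic_balls"
  show "A \<inter> B \<in> padic_balls"
  proof (cases "A \<inter> B = {}")
    case False
    then obtain x c n d m where x: "x \<in> A" "x \<in> B" and AB: "A = padic_ball c n" "B = padic_ball d m"
      using A B unfolding padic_balls_def by blast
    have "A = padic_ball x n" "B = padic_ball x m"
      using x unfolding AB mem_cball_padic by (auto intro!: cball_padic_eq simp: padic_norm_diff_commute)
    note AB' = this
    have sub: "padic_ball x l \<subseteq> padic_ball x k" if "k \<le> l" for k l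
      using that CARD_gt_1[where 'p='p] by (intro subset_cball power_decreasing) (auto simp: field_simps)
    have "A \<inter> B = padic_ball x (max n m)"
    proof (cases "n \<le> m")
      case True
      thus ?thesis using sub[OF True] unfolding AB' max_def by (simp only: if_True Int_absorb1)
    next
      case False
      hence "m \<le> n" by simp
      thus ?thesis using sub[of m n] False unfolding AB' max_def by (simp only: if_False Int_absorb2)
    qed
    thus ?thesis unfolding padic_balls_def by blast
  qed (simp add: padic_balls_def)
qed

lemma open_padic_ballE:
  assumes "open (U :: 'p::prime_card padic set)" "x \<in> U"
  obtains n where "padic_ball x n \<subseteq> U"
proof -
  obtain e where e: "e > 0" "cball x e \<subseteq> U" using assms open_contains_cball by blast
  have "\<forall>\<^sub>F n in sequentially. inverse (real CARD('p)) ^ n < e"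
    using tendsto_p_power[where 'p='p] e(1) by (rule order_tendstoD)
  then obtain n where "inverse (real CARD('p)) ^ n < e" by (auto simp: eventually_sequentially)
  hence "padic_ball x n \<subseteq> cball x e" by (auto simp: mem_cball)
  thus ?thesis using e that by blast
qed

lemma borel_eq_padic_balls: "sets (borel :: 'p::prime_card padic measure) = sigma_sets UNIV padic_balls"
proof -
  have "sets (borel :: 'p padic measure) = sigma_sets UNIV {U. open U}"
    by (simp add: borel_def)
  also have "\<dots> = sigma_sets UNIV padic_balls"
  proof (rule sigma_sets_eqI)
    fix U :: "'p padic set" assume "U \<in> {U. open U}"
    hence "open U" by simp
    let ?I = "{(q :: rat, n). padic_ball (of_rat q) n \<subseteq> U}"
    have "U = (\<Union>(q, n)\<in>?I. padic_ball (of_rat q) n)"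
    proof (intro equalityI subsetI)
      fix x assume "x \<in> U"
      then obtain n where n: "padic_ball x n \<subseteq> U" using \<open>open U\<close> open_padic_ballE by blast
      obtain q where q: "padic_norm (x - of_rat q) \<le> inverse (real CARD('p)) ^ n"
        using padic_dense_rat by blast
      have "padic_ball x n = padic_ball (of_rat q) n" by (rule cball_padic_eq[OF q])
      moreover have "x \<in> padic_ball (of_rat q) n" using q unfolding mem_cball_padic .
      ultimately show "x \<in> (\<Union>(q, n)\<in>?I. padic_ball (of_rat q) n)" using n by blast
    qed blast
    also have "\<dots> \<in> sigma_sets UNIV padic_balls"
    proof (rule sigma_sets_UNION)
      show "countable ((\<lambda>(q, n). padic_ball (of_rat q :: 'p padic) n) ` ?I)"
        by (rule countable_image) simp
      fix B assume "B \<in> (\<lambda>(q, n). padic_ball (of_rat q :: 'p padic) n) ` ?I"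
      thus "B \<in> sigma_sets UNIV padic_balls" unfolding padic_balls_def by (auto intro!: sigma_sets.Basic)
    qed
    finally show "U \<in> sigma_sets UNIV padic_balls" .
  next
    fix B :: "'p padic set" assume "B \<in> padic_balls"
    hence "B \<in> sets borel" by (auto simp: padic_balls_def simp del: mem_cball)
    thus "B \<in> sigma_sets UNIV {U. open U}" by (simp add: borel_def)
  qed
  finally show ?thesis .
qed

lemma padic_measure_eqI:
  fixes M N :: "'p::prime_card padic measure"
  assumes sets: "sets M = sets borel" "sets N = sets borel"
    and eq: "\<And>c n. emeasure M (padic_ball c n) = emeasure N (padic_ball c n)"
    and fin: "\<And>c. emeasure M (padic_ball c 0) \<noteq> \<infinity>"
  shows "M = N"
proof (rule measure_eqI_generator_eq_countable[where E = padic_balls and \<Omega> = UNIV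
    and A = "(\<lambda>q. padic_ball (of_rat q :: 'p padic) 0) ` UNIV"])
  show "(\<Union>q. padic_ball (of_rat q :: 'p padic) 0) = UNIV"
    using padic_dense_rat[where n = 0] unfolding mem_cball_padic[symmetric] by blast
  show "Int_stable (padic_balls :: 'p padic set set)" by (rule Int_stable_padic_balls)
  show "sets M = sigma_sets UNIV padic_balls" "sets N = sigma_sets UNIV padic_balls"
    using sets by (simp_all add: borel_eq_padic_balls)
  show "range (\<lambda>q. padic_ball (of_rat q :: 'p padic) 0) \<subseteq> padic_balls"
    unfolding padic_balls_def by blast
  show "emeasure M X = emeasure N X" if "X \<in> padic_balls" for X
    using that eq unfolding padic_balls_def by auto
  show "emeasure M X \<noteq> \<infinity>" if "X \<in> range (\<lambda>q. padic_ball (of_rat q) 0)" for X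
    using that fin by auto
qed simp_all

definition is_normalized_haar :: "'p::prime_card padic measure \<Rightarrow> bool" where
  "is_normalized_haar M \<longleftrightarrow> sets M = sets borel \<and>
     (\<forall>a. \<forall>A\<in>sets borel. emeasure M ((+) a ` A) = emeasure M A) \<and>
     emeasure M {x. padic_norm x \<le> 1} = 1"

text \<open>Well-defined by \<open>normalized_haar_ex\<close> and \<open>normalized_haar_unique\<close> below.\<close>

definition padic_haar :: "'p::prime_card padic measure" where
  "padic_haar = (THE M. is_normalized_haar M)"

lemma translate_padic_ball: "(+) a ` cball c r = cball (a + c :: 'p::prime_card padic) r"
proof (intro equalityI subsetI)
  fix x assume "x \<in> cball (a + c) r"
  hence "x - a \<in> cball c r" unfolding mem_cball_padic by (simp add: algebra_simps)
  thus "x \<in> (+) a ` cball c r" by (rule rev_image_eqI) simp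
qed (auto simp: mem_cball_padic simp del: mem_cball)

lemma padic_int_eq_ball: "{x :: 'p::prime_card padic. padic_norm x \<le> 1} = padic_ball 0 0"
  by (auto simp: mem_cball_padic simp del: mem_cball)

lemma padic_norm_p_power: "padic_norm (of_nat CARD('p) ^ n :: 'p::prime_card padic) = inverse (real CARD('p)) ^ n"
  unfolding padic_norm_power padic_norm_prime ..

lemma padic_ball_split:
  fixes c :: "'p::prime_card padic" and n :: nat
  defines "D \<equiv> \<lambda>i. padic_ball (c + of_nat i * of_nat CARD('p) ^ n) (Suc n)"
  shows "padic_ball c n = (\<Union>i<CARD('p). D i)" "disjoint_family_on D {..<CARD('p)}"
proof -
  let ?P = "of_nat CARD('p) :: 'p padic" and ?q = "inverse (real CARD('p))"
  have P0: "?P ^ n \<noteq> 0" by simp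
  have q: "?q ^ n > 0" by simp
  have le_Suc: "padic_norm (y * ?P ^ n) \<le> ?q ^ Suc n \<longleftrightarrow> padic_norm y \<le> ?q ^ 1" for y :: "'p padic"
    unfolding padic_norm_mult padic_norm_p_power power_Suc power_one_right
    by (rule mult_le_cancel_right_pos[OF q])
  show "padic_ball c n = (\<Union>i<CARD('p). D i)"
  proof (intro equalityI subsetI)
    fix x assume "x \<in> padic_ball c n"
    hence le: "padic_norm (x - c) \<le> ?q ^ n" unfolding mem_cball_padic .
    define y where "y = (x - c) / ?P ^ n"
    have y: "x - c = y * ?P ^ n" using P0 by (simp add: y_def)
    have "padic_norm y * ?q ^ n \<le> 1 * ?q ^ n"
      using le unfolding y padic_norm_mult padic_norm_p_power by simp
    hence "padic_norm y \<le> 1" using q by (rule mult_right_le_imp_le)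
    then obtain z where z: "y = of_padic_int z" unfolding padic_norm_le_1_iff by blast
    define i where "i = nat (residue z 1)"
    have i: "int i = residue z 1" "i < CARD('p)"
      using residue_nonneg[of z 1] residue_less[of z 1] unfolding i_def by (simp_all add: nat_less_iff)
    have "padic_norm (y - of_int (int i)) \<le> ?q ^ 1" unfolding z i(1) by (rule padic_norm_diff_residue)
    hence "padic_norm ((y - of_nat i) * ?P ^ n) \<le> ?q ^ Suc n" unfolding le_Suc by simp
    also have "(y - of_nat i) * ?P ^ n = x - (c + of_nat i * ?P ^ n)"
      unfolding left_diff_distrib y[symmetric] by simp
    finally have "x \<in> D i" unfolding D_def mem_cball_padic .
    thus "x \<in> (\<Union>i<CARD('p). D i)" using i(2) by blast
  next
    fix x assume "x \<in> (\<Union>i<CARD('p). D i)"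
    then obtain i where i: "padic_norm (x - (c + of_nat i * ?P ^ n)) \<le> ?q ^ Suc n"
      unfolding D_def mem_cball_padic UN_iff by blast
    have "?q ^ Suc n \<le> ?q ^ n"
      using CARD_gt_1[where 'p='p] by (intro power_decreasing) (auto simp: field_simps)
    moreover have "padic_norm (of_nat i * ?P ^ n) \<le> 1 * ?q ^ n"
      unfolding padic_norm_mult padic_norm_p_power
      using padic_norm_of_int_le_1[of "int i", where 'a='p] by (intro mult_right_mono) simp_all
    ultimately have "max (padic_norm (x - (c + of_nat i * ?P ^ n))) (padic_norm (of_nat i * ?P ^ n)) \<le> ?q ^ n"
      using i unfolding mult_1 by (intro max.boundedI) (blast intro: order_trans, assumption)
    hence "padic_norm (x - (c + of_nat i * ?P ^ n) + of_nat i * ?P ^ n) \<le> ?q ^ n"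
      using padic_norm_ultra order_trans by blast
    thus "x \<in> padic_ball c n" unfolding mem_cball_padic by (simp add: diff_diff_eq[symmetric])
  qed
  show "disjoint_family_on D {..<CARD('p)}"
    unfolding disjoint_family_on_def
  proof (intro ballI impI equals0I)
    fix i j x assume ij: "i \<in> {..<CARD('p)}" "j \<in> {..<CARD('p)}" "i \<noteq> j" and "x \<in> D i \<inter> D j"
    hence x: "padic_norm (x - (c + of_nat i * ?P ^ n)) \<le> ?q ^ Suc n"
      "padic_norm (x - (c + of_nat j * ?P ^ n)) \<le> ?q ^ Suc n"
      unfolding D_def Int_iff mem_cball_padic by blast+
    have "padic_norm ((c + of_nat i * ?P ^ n) - (c + of_nat j * ?P ^ n)) \<le> ?q ^ Suc n"
      using padic_norm_ultra_diff[of "c + of_nat i * ?P ^ n" "c + of_nat j * ?P ^ n" x] x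
      unfolding padic_norm_diff_commute[of _ x] by linarith
    also have "(c + of_nat i * ?P ^ n) - (c + of_nat j * ?P ^ n) = of_int (int i - int j) * ?P ^ n"
      by (simp add: algebra_simps)
    finally have "pint TYPE('p) dvd int i - int j"
      unfolding le_Suc padic_norm_of_int_le_iff by simp
    thus False using ij zdvd_not_zless[of "\<bar>int i - int j\<bar>" "pint TYPE('p)"] by fastforce
  qed
qed

lemma normalized_haar_ball:
  fixes c :: "'p::prime_card padic"
  assumes M: "is_normalized_haar M"
  shows "emeasure M (padic_ball c n) = ennreal (inverse (real CARD('p)) ^ n)"
proof -
  have sets: "sets M = sets borel" using M by (simp add: is_normalized_haar_def)
  have ball: "cball d r \<in> sets M" for d :: "'p padic" and r unfolding sets by simp
  have tr: "emeasure M (padic_ball d k) = emeasure M (padic_ball 0 k)" for d k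
  proof -
    have "emeasure M ((+) d ` padic_ball 0 k) = emeasure M (padic_ball 0 k)"
      using M ball[of 0] unfolding is_normalized_haar_def by auto
    thus ?thesis unfolding translate_padic_ball by simp
  qed
  have "emeasure M (padic_ball (0 :: 'p padic) n) = ennreal (inverse (real CARD('p)) ^ n)"
  proof (induction n)
    case 0
    show ?case using M unfolding is_normalized_haar_def padic_int_eq_ball by simp
  next
    case (Suc n)
    let ?D = "\<lambda>i. padic_ball (0 + of_nat i * (of_nat CARD('p) :: 'p padic) ^ n) (Suc n)"
    have "ennreal (inverse (real CARD('p)) ^ n) = emeasure M (\<Union>i<CARD('p). ?D i)"
      unfolding Suc[symmetric] padic_ball_split(1)[of 0 n] ..
    also have "\<dots> = (\<Sum>i<CARD('p). emeasure M (?D i))"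
      by (intro sum_emeasure[symmetric] image_subsetI ball padic_ball_split(2) finite_lessThan)
    also have "\<dots> = (\<Sum>i<CARD('p). emeasure M (padic_ball (0 :: 'p padic) (Suc n)))"
      by (intro sum.cong refl tr)
    also have "\<dots> = of_nat CARD('p) * emeasure M (padic_ball (0 :: 'p padic) (Suc n))"
      by (simp only: sum_constant card_lessThan)
    finally have eq: "ennreal (inverse (real CARD('p)) ^ n)
      = of_nat CARD('p) * emeasure M (padic_ball (0 :: 'p padic) (Suc n))" .
    have "ennreal (inverse (real CARD('p)) ^ Suc n) = ennreal (inverse (real CARD('p))) * ennreal (inverse (real CARD('p)) ^ n)"
      by (simp add: ennreal_mult)
    also have "\<dots> = (ennreal (inverse (real CARD('p))) * of_nat CARD('p)) * emeasure M (padic_ball (0 :: 'p padic) (Suc n))"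
      unfolding eq by (simp add: mult.assoc)
    also have "ennreal (inverse (real CARD('p))) * of_nat CARD('p) = 1"
      by (simp add: ennreal_of_nat_eq_real_of_nat ennreal_mult[symmetric])
    finally show ?case by simp
  qed
  thus ?thesis unfolding tr[of c n] .
qed

lemma normalized_haar_unique:
  assumes "is_normalized_haar M" "is_normalized_haar N"
  shows "M = N"
proof (rule padic_measure_eqI)
  show "sets M = sets borel" "sets N = sets borel"
    using assms by (simp_all add: is_normalized_haar_def)
  show "emeasure M (padic_ball c n) = emeasure N (padic_ball c n)" for c n
    unfolding normalized_haar_ball[OF assms(1)] normalized_haar_ball[OF assms(2)] ..
  show "emeasure M (padic_ball c 0) \<noteq> \<infinity>" for c
    unfolding normalized_haar_ball[OF assms(1)] by simp
qed

text \<open>Existence of the Haar measure: independent uniformly distributed digits give the Haar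
  measure of the p-adic integers, which is then translated to representatives of all cosets.\<close>

definition digit_sum :: "nat \<Rightarrow> nat \<Rightarrow> (nat \<Rightarrow> nat) \<Rightarrow> nat" where
  "digit_sum p n s = (\<Sum>i<n. s i * p ^ i)"

lemma digit_sum_less:
  assumes "\<And>i. s i < p"
  shows "digit_sum p n s < p ^ n"
proof (induction n)
  case (Suc n)
  have "s n * p ^ n + p ^ n \<le> p * p ^ n" using assms[of n] mult_le_mono1[of "Suc (s n)" p "p ^ n"] by simp
  thus ?case using Suc by (simp add: digit_sum_def)
qed (simp add: digit_sum_def)

lemma digit_sum_eq_iff:
  assumes s: "\<And>i. s i < p" and k: "k < p ^ n"
  shows "digit_sum p n s = k \<longleftrightarrow> (\<forall>i<n. s i = k div p ^ i mod p)"
  using k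
proof (induction n arbitrary: k)
  case (Suc n)
  have p: "p > 0" using s[of 0] by simp
  have lt: "digit_sum p n s < p ^ n" by (rule digit_sum_less[OF s])
  have "digit_sum p (Suc n) s = digit_sum p n s + s n * p ^ n" by (simp add: digit_sum_def)
  hence div: "digit_sum p (Suc n) s div p ^ n = s n" "digit_sum p (Suc n) s mod p ^ n = digit_sum p n s"
    using lt p by simp_all
  have kn: "k div p ^ n < p" using Suc.prems p by (simp add: less_mult_imp_div_less)
  have "digit_sum p (Suc n) s = k \<longleftrightarrow> s n = k div p ^ n \<and> digit_sum p n s = k mod p ^ n"
    using div by (metis div_mult_mod_eq)
  also have "digit_sum p n s = k mod p ^ n \<longleftrightarrow> (\<forall>i<n. s i = k mod p ^ n div p ^ i mod p)"
    using p by (intro Suc.IH) simp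
  also have "\<dots> \<longleftrightarrow> (\<forall>i<n. s i = k div p ^ i mod p)"
  proof (intro all_cong)
    fix i assume "i < n"
    have "k mod p ^ n div p ^ i mod p = k div p ^ i mod p"
    proof -
      have eq: "p ^ n = p ^ i * p ^ (n - i)" using \<open>i < n\<close> by (simp flip: power_add)
      have "k mod p ^ n div p ^ i = k div p ^ i mod p ^ (n - i)"
        unfolding eq using p by (simp add: mod_mult2_eq)
      moreover have "p dvd p ^ (n - i)" using \<open>i < n\<close> by (simp add: dvd_power)
      ultimately show ?thesis by (simp add: mod_mod_cancel)
    qed
    thus "(s i = k mod p ^ n div p ^ i mod p) = (s i = k div p ^ i mod p)" by simp
  qed
  also have "s n = k div p ^ n \<longleftrightarrow> s n = k div p ^ n mod p" using kn by simp
  finally show ?case by (auto simp: less_Suc_eq)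
qed (simp add: digit_sum_def)

definition digit_measure :: "nat \<Rightarrow> (nat \<Rightarrow> nat) measure" where
  "digit_measure p = (\<Pi>\<^sub>M i\<in>UNIV. uniform_count_measure {..<p})"

lemma prob_space_digit: "p > 0 \<Longrightarrow> prob_space (uniform_count_measure {..<p::nat})"
  by (rule prob_space_uniform_count_measure) auto

lemma digit_measure_cylinder:
  assumes p: "p > 0" and k: "k < p ^ n"
  shows "{s \<in> space (digit_measure p). digit_sum p n s = k} \<in> sets (digit_measure p)"
    and "emeasure (digit_measure p) {s \<in> space (digit_measure p). digit_sum p n s = k}
      = ennreal (inverse (real p) ^ n)"
proof -
  let ?U = "uniform_count_measure {..<p}"
  interpret U: prob_space ?U by (rule prob_space_digit[OF p])
  interpret P: product_prob_space "\<lambda>_::nat. ?U" UNIV by unfold_locales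
  let ?X = "\<lambda>i. {k div p ^ i mod p}"
  have "s \<in> space (digit_measure p) \<longleftrightarrow> (\<forall>i. s i < p)" for s
    by (auto simp: digit_measure_def space_PiM PiE_def Pi_def space_uniform_count_measure)
  note sp = this
  have "{s \<in> space (digit_measure p). digit_sum p n s = k}
      = {s. (\<forall>i. s i < p) \<and> (\<forall>i<n. s i = k div p ^ i mod p)}"
    unfolding sp by (intro Collect_cong conj_cong refl digit_sum_eq_iff[OF _ k]) simp
  also have "\<dots> = prod_emb UNIV (\<lambda>_. ?U) {..<n} (Pi\<^sub>E {..<n} ?X)"
    by (auto simp: prod_emb_def PiE_iff space_uniform_count_measure restrict_def extensional_def)
  finally have eq: "{s \<in> space (digit_measure p). digit_sum p n s = k}
      = prod_emb UNIV (\<lambda>_. ?U) {..<n} (Pi\<^sub>E {..<n} ?X)" .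
  have X: "?X i \<in> sets ?U" for i using p by (simp add: sets_uniform_count_measure)
  show "{s \<in> space (digit_measure p). digit_sum p n s = k} \<in> sets (digit_measure p)"
    unfolding eq unfolding digit_measure_def using X by (intro sets_PiM_I) auto
  have "emeasure (digit_measure p) {s \<in> space (digit_measure p). digit_sum p n s = k}
      = (\<Prod>i<n. emeasure ?U (?X i))"
    unfolding eq unfolding digit_measure_def using X by (intro P.emeasure_PiM_emb) auto
  also have "\<dots> = (\<Prod>i<n. ennreal (inverse (real p)))"
    using p by (intro prod.cong refl) (simp add: emeasure_uniform_count_measure inverse_eq_divide)
  also have "\<dots> = ennreal (inverse (real p) ^ n)"
    by (simp add: ennreal_power)
  finally show "emeasure (digit_measure p) {s \<in> space (digit_measure p). digit_sum p n s = k}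
      = ennreal (inverse (real p) ^ n)" .
qed

definition of_digits :: "(nat \<Rightarrow> nat) \<Rightarrow> 'p::prime_card padic_int" where
  "of_digits s = Abs_padic_int (\<lambda>n. int (digit_sum CARD('p) n s mod CARD('p) ^ n))"

lemma residue_of_digits:
  "residue (of_digits s :: 'p::prime_card padic_int) n = int (digit_sum CARD('p) n s mod CARD('p) ^ n)"
proof -
  let ?f = "\<lambda>n. int (digit_sum CARD('p) n s mod CARD('p) ^ n)"
  have "?f n = ?f (Suc n) mod pint TYPE('p) ^ n" for n
  proof -
    have "digit_sum CARD('p) (Suc n) s mod CARD('p) ^ Suc n mod CARD('p) ^ n
        = digit_sum CARD('p) (Suc n) s mod CARD('p) ^ n"
      by (rule mod_mod_cancel) (simp add: le_imp_power_dvd)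
    also have "\<dots> = digit_sum CARD('p) n s mod CARD('p) ^ n"
      by (simp add: digit_sum_def)
    finally have "int (digit_sum CARD('p) (Suc n) s mod CARD('p) ^ Suc n mod CARD('p) ^ n)
        = int (digit_sum CARD('p) n s mod CARD('p) ^ n)" by (rule arg_cong)
    thus ?thesis by (simp only: of_nat_mod of_nat_power)
  qed
  hence "?f \<in> {f. \<forall>n. f n = f (Suc n) mod pint TYPE('p) ^ n}"
    unfolding mem_Collect_eq by (intro allI)
  thus ?thesis unfolding of_digits_def by (simp only: Abs_padic_int_inverse)
qed

definition coset_rep :: "'p::prime_card padic \<Rightarrow> rat" where
  "coset_rep x = (SOME q. padic_norm (x - of_rat q) \<le> 1)"

lemma coset_rep: "padic_norm (x - of_rat (coset_rep x)) \<le> 1"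
proof -
  have "\<exists>q. padic_norm (x - of_rat q) \<le> 1" using padic_dense_rat[of x 0] unfolding power_0 .
  thus ?thesis unfolding coset_rep_def by (rule someI_ex)
qed

lemma coset_rep_cong:
  assumes "padic_norm (x - y) \<le> 1"
  shows "coset_rep x = coset_rep y"
proof -
  have "padic_norm (x - of_rat q) \<le> 1 \<longleftrightarrow> padic_norm (y - of_rat q) \<le> 1" for q
    using assms padic_norm_ultra_diff[of x "of_rat q" y] padic_norm_ultra_diff[of y "of_rat q" x]
    unfolding padic_norm_diff_commute[of y x] by linarith
  thus ?thesis unfolding coset_rep_def by simp
qed

lemma coset_rep_unique:
  assumes "q \<in> range (coset_rep :: 'p::prime_card padic \<Rightarrow> rat)"
  shows "padic_norm ((x :: 'p padic) - of_rat q) \<le> 1 \<longleftrightarrow> q = coset_rep x"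
proof
  obtain y :: "'p padic" where q: "q = coset_rep y" using assms by blast
  assume "padic_norm (x - of_rat q) \<le> 1"
  hence "coset_rep x = coset_rep (of_rat q :: 'p padic)" by (rule coset_rep_cong)
  also have "\<dots> = coset_rep y" unfolding q by (rule coset_rep_cong[OF coset_rep, symmetric])
  finally show "q = coset_rep x" using q by simp
next
  assume "q = coset_rep x"
  thus "padic_norm (x - of_rat q) \<le> 1" using coset_rep[of x] by (simp only:)
qed

lemma normalized_haar_ex: "\<exists>M :: 'p::prime_card padic measure. is_normalized_haar M"
proof -
  let ?D = "digit_measure CARD('p)" and ?q = "inverse (real CARD('p))"
  define R where "R = range (coset_rep :: 'p padic \<Rightarrow> rat)"
  let ?C = "count_space R"
  have p: "CARD('p) > 0" by simp
  interpret U: prob_space "uniform_count_measure {..<CARD('p)}" by (rule prob_space_digit[OF p])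
  interpret P: product_prob_space "\<lambda>_::nat. uniform_count_measure {..<CARD('p)}" UNIV by unfold_locales
  interpret D: prob_space ?D unfolding digit_measure_def by (rule P.prob_space_axioms)
  interpret C: sigma_finite_measure ?C
    by (rule sigma_finite_measure_count_space_countable) (simp add: countable_subset[OF subset_UNIV])
  define T :: "rat \<times> (nat \<Rightarrow> nat) \<Rightarrow> 'p padic" where
    "T = (\<lambda>(q, s). of_rat q + of_padic_int (of_digits s))"
  have digit_space: "digit_sum CARD('p) n s < CARD('p) ^ n" if "s \<in> space ?D" for s n
    using that by (intro digit_sum_less)
      (auto simp: digit_measure_def space_PiM PiE_def Pi_def space_uniform_count_measure)
  have vimage: "\<exists>k < CARD('p) ^ n. \<forall>q s. q \<in> R \<longrightarrow> s \<in> space ?D \<longrightarrow>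
      T (q, s) \<in> padic_ball c n \<longleftrightarrow> q = coset_rep c \<and> digit_sum CARD('p) n s = k" for c n
  proof -
    obtain z where z: "c - of_rat (coset_rep c) = of_padic_int z"
      using coset_rep[of c] unfolding padic_norm_le_1_iff by blast
    show ?thesis
    proof (intro exI[of _ "nat (residue z n)"] conjI allI impI)
      show "nat (residue z n) < CARD('p) ^ n"
        using residue_less[of z n] residue_nonneg[of z n] by (simp add: nat_less_iff)
      fix q s assume q: "q \<in> R" and s: "s \<in> space ?D"
      let ?w = "of_padic_int (of_digits s) :: 'p padic"
      have q_iff: "q = coset_rep c" if "T (q, s) \<in> padic_ball c n"
      proof -
        have "?q ^ n \<le> 1" using CARD_gt_1[where 'p='p] by (intro power_le_one) (auto simp: field_simps)
        hence "padic_norm (c - (of_rat q + ?w)) \<le> 1" using that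
          unfolding mem_cball_padic T_def prod.case padic_norm_diff_commute[of c] by linarith
        moreover have "padic_norm (of_rat q + ?w - of_rat q) \<le> 1"
          by (simp add: norm_int_le_1)
        ultimately have "padic_norm (c - of_rat q) \<le> 1"
          using padic_norm_ultra_diff[of c "of_rat q" "of_rat q + ?w"] by linarith
        thus ?thesis using coset_rep_unique q unfolding R_def by blast
      qed
      have "T (coset_rep c, s) \<in> padic_ball c n \<longleftrightarrow> digit_sum CARD('p) n s = nat (residue z n)"
      proof -
        have "T (coset_rep c, s) - c = of_padic_int (of_digits s - z)"
          unfolding of_padic_int_simps z[symmetric] T_def by simp
        hence "T (coset_rep c, s) \<in> padic_ball c n \<longleftrightarrow> residue (of_digits s - z :: 'p padic_int) n = 0"
          unfolding mem_cball_padic by (simp only: padic_norm_of_padic_int norm_int_le_iff)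
        also have "\<dots> \<longleftrightarrow> residue (of_digits s :: 'p padic_int) n mod pint TYPE('p) ^ n = residue z n mod pint TYPE('p) ^ n"
          unfolding minus_padic_int.rep_eq mod_eq_dvd_iff by (simp only: dvd_eq_mod_eq_0)
        also have "\<dots> \<longleftrightarrow> int (digit_sum CARD('p) n s) = residue z n"
          unfolding residue_mod_self residue_of_digits using digit_space[OF s, of n] by simp
        also have "\<dots> \<longleftrightarrow> digit_sum CARD('p) n s = nat (residue z n)"
          using residue_nonneg[of z n] by linarith
        finally show ?thesis .
      qed
      thus "T (q, s) \<in> padic_ball c n \<longleftrightarrow> q = coset_rep c \<and> digit_sum CARD('p) n s = nat (residue z n)"
        using q_iff by blast
    qed
  qed
  have vimage': "\<exists>S \<in> sets ?D. emeasure ?D S = ennreal (?q ^ n) \<and>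
      T -` padic_ball c n \<inter> space (?C \<Otimes>\<^sub>M ?D) = {coset_rep c} \<times> S" for c n
  proof -
    obtain k where k: "k < CARD('p) ^ n" and
      iff: "\<And>q s. q \<in> R \<Longrightarrow> s \<in> space ?D \<Longrightarrow>
        T (q, s) \<in> padic_ball c n \<longleftrightarrow> q = coset_rep c \<and> digit_sum CARD('p) n s = k"
      using vimage by metis
    have "coset_rep c \<in> R" by (simp add: R_def)
    hence "T -` padic_ball c n \<inter> space (?C \<Otimes>\<^sub>M ?D)
        = {coset_rep c} \<times> {s \<in> space ?D. digit_sum CARD('p) n s = k}"
      using iff by (auto simp: space_pair_measure simp del: mem_cball)
    thus ?thesis using digit_measure_cylinder[OF p k] by blast
  qed
  have T: "T \<in> measurable (?C \<Otimes>\<^sub>M ?D) borel"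
  proof (rule measurable_sigma_sets[OF borel_eq_padic_balls])
    fix B :: "'p padic set" assume "B \<in> padic_balls"
    then consider "B = {}" | c n where "B = padic_ball c n" unfolding padic_balls_def by blast
    thus "T -` B \<inter> space (?C \<Otimes>\<^sub>M ?D) \<in> sets (?C \<Otimes>\<^sub>M ?D)"
    proof cases
      case (2 c n)
      obtain S where S: "S \<in> sets ?D"
        "T -` B \<inter> space (?C \<Otimes>\<^sub>M ?D) = {coset_rep c} \<times> S" using vimage'[of n c] 2 by blast
      show ?thesis unfolding S(2) using S(1) by (intro pair_measureI) (simp_all add: R_def)
    qed simp
  qed auto
  define H where "H = distr (?C \<Otimes>\<^sub>M ?D) borel T"
  have sets_H: "sets H = sets borel" by (simp add: H_def)
  have ball: "emeasure H (padic_ball c n) = ennreal (?q ^ n)" for c n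
  proof -
    obtain S where S: "S \<in> sets ?D" "emeasure ?D S = ennreal (?q ^ n)"
      "T -` padic_ball c n \<inter> space (?C \<Otimes>\<^sub>M ?D) = {coset_rep c} \<times> S" using vimage'[of n c] by blast
    have "emeasure H (padic_ball c n) = emeasure (?C \<Otimes>\<^sub>M ?D) ({coset_rep c} \<times> S)"
      unfolding H_def S(3)[symmetric] by (rule emeasure_distr[OF T]) simp
    also have "\<dots> = emeasure ?C {coset_rep c} * emeasure ?D S"
      by (rule D.emeasure_pair_measure_Times) (use S in \<open>simp_all add: R_def\<close>)
    also have "emeasure ?C {coset_rep c} = 1"
      by (subst emeasure_count_space_finite) (simp_all add: R_def)
    finally show ?thesis using S by simp
  qed
  have shift: "(\<lambda>x. x - a) \<in> measurable borel (borel :: 'p padic measure)" for a :: "'p padic"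
  proof (rule borel_measurable_continuous_onI)
    show "continuous_on UNIV (\<lambda>x. x - a)"
      unfolding continuous_on_iff by (auto simp: dist_padic_def)
  qed
  have "emeasure H ((+) a ` A) = emeasure H A" if A: "A \<in> sets borel" for a A
  proof -
    have eq: "(\<lambda>x. x - a) -` B = (+) a ` B" for B
      by (auto intro!: image_eqI[of _ "(+) a" "_ - a"])
    have sp: "space H = UNIV" by (simp add: H_def)
    have shiftH: "(\<lambda>x. x - a) \<in> measurable H borel"
      using shift[of a] measurable_cong_sets[OF sets_H refl] by blast
    have em: "emeasure (distr H borel (\<lambda>x. x - a)) B = emeasure H ((+) a ` B)" if "B \<in> sets borel" for B
      using emeasure_distr[OF shiftH that] unfolding eq sp by simp
    have "distr H borel (\<lambda>x. x - a) = H"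
    proof (rule padic_measure_eqI)
      fix c n
      have "emeasure (distr H borel (\<lambda>x. x - a)) (padic_ball c n) = emeasure H ((+) a ` padic_ball c n)"
        by (rule em) simp
      thus "emeasure (distr H borel (\<lambda>x. x - a)) (padic_ball c n) = emeasure H (padic_ball c n)"
        "emeasure (distr H borel (\<lambda>x. x - a)) (padic_ball c 0) \<noteq> \<infinity>"
        unfolding translate_padic_ball ball using em[of "padic_ball c 0"]
        unfolding translate_padic_ball ball by simp_all
    qed (simp_all add: sets_H)
    thus ?thesis using em[OF A] by simp
  qed
  moreover have "emeasure H {x. padic_norm x \<le> 1} = 1"
    unfolding padic_int_eq_ball ball by simp
  ultimately have "is_normalized_haar H" unfolding is_normalized_haar_def using sets_H by blast
  thus ?thesis by blast
qed

lemma is_normalized_haar_padic_haar: "is_normalized_haar padic_haar"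
proof -
  have "\<exists>!M :: 'a padic measure. is_normalized_haar M"
    using normalized_haar_ex normalized_haar_unique by blast
  thus ?thesis unfolding padic_haar_def by (rule theI')
qed

text \<open>The completion of the Haar measure on the Borel sets: "measurable" means Haar-measurable.\<close>

definition haar :: "'p::prime_card padic measure" where
  "haar = completion padic_haar"

definition padic_char :: "'p::prime_card padic \<Rightarrow> complex" where
  "padic_char x = cis (2 * pi * of_rat (padic_frac x))"

definition padic_frac_reps :: "'p::prime_card padic set" where
  "padic_frac_reps = {x. of_rat (padic_frac x) = x}"

definition padic_dilate :: "int \<Rightarrow> 'p::prime_card padic set \<Rightarrow> 'p padic set" where
  "padic_dilate j A = (\<lambda>x. of_nat CARD('p) powi j * x) ` A"

text \<open>Elements of \<open>L\<^sup>2\<close> are represented by functions, so equality in \<open>L\<^sup>2\<close> is equality almost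
  everywhere; all notions below are invariant under it.\<close>

definition padic_L2 :: "('p::prime_card padic \<Rightarrow> complex) set" where
  "padic_L2 = {f \<in> borel_measurable haar. integrable haar (\<lambda>x. (cmod (f x))\<^sup>2)}"

definition padic_L2_inner :: "('p::prime_card padic \<Rightarrow> complex) \<Rightarrow> ('p padic \<Rightarrow> complex) \<Rightarrow> complex" where
  "padic_L2_inner f g = (LINT x|haar. f x * cnj (g x))"

definition padic_L2_norm :: "('p::prime_card padic \<Rightarrow> complex) \<Rightarrow> real" where
  "padic_L2_norm f = sqrt (LINT x|haar. (cmod (f x))\<^sup>2)"

definition padic_fourier_integral :: "('p::prime_card padic \<Rightarrow> complex) \<Rightarrow> 'p padic \<Rightarrow> complex" where
  "padic_fourier_integral f \<xi> = (LINT x|haar. padic_char (\<xi> * x) * f x)"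

text \<open>The extension of the Fourier integral from \<open>L\<^sup>1 \<inter> L\<^sup>2\<close> to \<open>L\<^sup>2\<close>, as the closure of its graph:
  \<open>g\<close> represents the Fourier transform of \<open>f\<close>. By Plancherel's theorem the Fourier integral of
  a function in \<open>L\<^sup>1 \<inter> L\<^sup>2\<close> is in \<open>L\<^sup>2\<close>; the requirement is stated because \<^const>\<open>padic_L2_norm\<close> is
  meaningless outside \<open>L\<^sup>2\<close>.\<close>

definition is_fourier_transform ::
    "('p::prime_card padic \<Rightarrow> complex) \<Rightarrow> ('p padic \<Rightarrow> complex) \<Rightarrow> bool" where
  "is_fourier_transform f g \<longleftrightarrow> f \<in> padic_L2 \<and> g \<in> padic_L2 \<and>
     (\<exists>h :: nat \<Rightarrow> 'p padic \<Rightarrow> complex.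
        (\<forall>k. integrable haar (h k) \<and> h k \<in> padic_L2 \<and> padic_fourier_integral (h k) \<in> padic_L2) \<and>
        (\<lambda>k. padic_L2_norm (\<lambda>x. h k x - f x)) \<longlonglongrightarrow> 0 \<and>
        (\<lambda>k. padic_L2_norm (\<lambda>\<xi>. padic_fourier_integral (h k) \<xi> - g \<xi>)) \<longlonglongrightarrow> 0)"

definition is_orthonormal_basis :: "'i set \<Rightarrow> ('i \<Rightarrow> 'p::prime_card padic \<Rightarrow> complex) \<Rightarrow> bool" where
  "is_orthonormal_basis I e \<longleftrightarrow>
     (\<forall>i\<in>I. e i \<in> padic_L2) \<and>
     (\<forall>i\<in>I. \<forall>j\<in>I. padic_L2_inner (e i) (e j) = (if i = j then 1 else 0)) \<and>
     (\<forall>f\<in>padic_L2. \<forall>\<epsilon>>0. \<exists>F c. finite F \<and> F \<subseteq> I \<and>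
        padic_L2_norm (\<lambda>x. f x - (\<Sum>i\<in>F. c i * e i x)) < \<epsilon>)"

definition wavelet_system ::
    "(nat \<Rightarrow> 'p::prime_card padic \<Rightarrow> complex) \<Rightarrow> nat \<times> int \<times> 'p padic \<Rightarrow> 'p padic \<Rightarrow> complex" where
  "wavelet_system \<psi> = (\<lambda>(n, j, a) x.
     of_real (real CARD('p) powr (real_of_int j / 2)) * \<psi> n (of_nat CARD('p) powi (- j) * x - a))"

text \<open>The system is a family indexed by \<open>(n, j, a)\<close>; in particular the \<open>\<psi> n\<close> are pairwise distinct.\<close>

definition is_multiwavelet :: "nat \<Rightarrow> (nat \<Rightarrow> 'p::prime_card padic \<Rightarrow> complex) \<Rightarrow> bool" where
  "is_multiwavelet L \<psi> \<longleftrightarrow> (\<forall>n\<in>{1..L}. \<psi> n \<in> padic_L2) \<and>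
     is_orthonormal_basis ({1..L} \<times> UNIV \<times> padic_frac_reps) (wavelet_system \<psi>)"

definition is_multiwavelet_set :: "nat \<Rightarrow> 'p::prime_card padic set \<Rightarrow> bool" where
  "is_multiwavelet_set L W \<longleftrightarrow> W \<in> sets haar \<and>
     (\<exists>Ws \<psi>. (\<forall>n\<in>{1..L}. Ws n \<in> sets haar \<and> is_fourier_transform (\<psi> n) (indicator (Ws n))) \<and>
        W = (\<Union>n\<in>{1..L}. Ws n) \<and> is_multiwavelet L \<psi>)"

definition is_generalized_scaling_set :: "nat \<Rightarrow> 'p::prime_card padic set \<Rightarrow> bool" where
  "is_generalized_scaling_set L G \<longleftrightarrow> G \<in> sets haar \<and>
     emeasure haar G = ennreal (real L / (real CARD('p) - 1)) \<and>
     is_multiwavelet_set L (padic_dilate (- 1) G - G)"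

end

theory Submission
  imports Defs
begin

text \<open>Write \<open>\<mu>\<close> for the Haar measure and \<open>p\<close> for the prime. The proof rests on two
  facts about a multiwavelet set \<open>W\<close> of order \<open>L\<close>: \<open>\<mu> W = L\<close>, and \<open>W\<close> meets each dilate \<open>p\<^sup>j W\<close> with \<open>j \<noteq> 0\<close> in a null set
  (\<open>multiwavelet_set_measure_disjoint\<close>).

  If \<open>G\<close> is a generalized scaling set and \<open>W = p\<^sup>-\<^sup>1G - G\<close>, then \<open>\<mu> (p\<^sup>-\<^sup>1G) = p L / (p - 1)\<close> and \<open>\<mu> W = L\<close>
  leave exactly \<open>L / (p - 1) = \<mu> G\<close> for \<open>p\<^sup>-\<^sup>1G \<inter> G\<close>, so \<open>G \<subseteq> p\<^sup>-\<^sup>1G\<close> almost everywhere. The sets \<open>p\<^sup>jG\<close>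
  therefore decrease, their measures tend to 0, and \<open>G\<close> is the union of the successive differences
  \<open>p\<^sup>j\<^sup>-\<^sup>1G - p\<^sup>jG = p\<^sup>jW\<close> over \<open>j \<ge> 1\<close>. Conversely, for \<open>U\<close> the union of the \<open>p\<^sup>jW\<close> over \<open>j \<ge> 1\<close> one has
  \<open>p\<^sup>-\<^sup>1U = W \<union> U\<close> with \<open>W \<inter> U\<close> null, hence \<open>p \<mu> U = L + \<mu> U\<close>, and \<open>p\<^sup>-\<^sup>1U - U\<close> is \<open>W\<close> up to a null set. A set
  equal to a multiwavelet set almost everywhere is a multiwavelet set
  (\<open>is_multiwavelet_set_cong_AE\<close>), because Fourier transforms are determined only up to null sets.

  The two facts are read off the orthonormality relations among the wavelets with \<open>a = 0\<close>: the
  Fourier transform turns \<open>\<psi>\<^sub>n\<close> into the indicator of \<open>W\<^sub>n\<close> and dilation by \<open>p\<^sup>j\<close> into dilation by \<open>p\<^sup>-\<^sup>j\<close>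
  (\<open>is_fourier_transform_unitary_dilation\<close>), so that inner products of wavelets are, up to positive
  factors, the measures of the sets \<open>W\<^sub>n \<inter> p\<^sup>jW\<^sub>m\<close>. This uses that the Fourier transform preserves inner
  products, that is, Plancherel's theorem (\<open>fourier_plancherel\<close>), which is proved here from the Haar
  measure. Truncating the frequency integral to the ball of radius \<open>p\<^sup>N\<close> replaces a function by its
  averages over balls of radius \<open>p\<^sup>-\<^sup>N\<close> (\<open>truncated_parseval\<close>); these averages do not
  increase norms, which gives Bessel's inequality (\<open>fourier_bessel\<close>), and they
  converge to the function in mean (\<open>integrable_imp_ball_approximable\<close>), which gives the reverse
  inequality.\<close>

section \<open>The standard character of the p-adic numbers\<close>

text \<open>The ring \<open>\<int>[1/p]\<close>. It contains all fractional parts, and its elements that are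
  p-adic integers are integers; hence the character can be computed from any element of \<open>\<int>[1/p]\<close> that
  is close enough to the argument.\<close>
abbreviation (input) Z_inv_p :: "'p::prime_card itself \<Rightarrow> rat set" where
  "Z_inv_p T \<equiv> {of_int k / of_nat CARD('p) ^ m | k m. True}"

lemma Z_inv_p_add: "r \<in> Z_inv_p TYPE('p::prime_card) \<Longrightarrow> s \<in> Z_inv_p TYPE('p) \<Longrightarrow> r + s \<in> Z_inv_p TYPE('p)"
proof clarify
  fix k l :: int and m n :: nat
  show "\<exists>k' m'. (of_int k / of_nat CARD('p) ^ m + of_int l / of_nat CARD('p) ^ n :: rat)
     = of_int k' / of_nat CARD('p) ^ m' \<and> True"
    by (rule exI[of _ "k * int CARD('p) ^ n + l * int CARD('p) ^ m"], rule exI[of _ "m + n"])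
       (simp add: field_simps power_add)
qed

lemma Z_inv_p_uminus: "r \<in> Z_inv_p TYPE('p::prime_card) \<Longrightarrow> - r \<in> Z_inv_p TYPE('p)"
proof clarify
  fix k :: int and m :: nat
  show "\<exists>k' m'. - (of_int k / of_nat CARD('p) ^ m :: rat) = of_int k' / of_nat CARD('p) ^ m' \<and> True"
    by (rule exI[of _ "- k"], rule exI[of _ m]) simp
qed

lemma Z_inv_p_padic_int_imp_Ints:
  assumes r: "r \<in> Z_inv_p TYPE('p::prime_card)" and le: "padic_norm (of_rat r :: 'p padic) \<le> 1"
  shows "r \<in> \<int>"
proof -
  obtain k m where r: "r = of_int k / of_nat CARD('p) ^ m" using r by blast
  have "padic_norm (of_rat r :: 'p padic) * padic_norm (of_nat CARD('p) ^ m :: 'p padic)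
      = padic_norm (of_int k :: 'p padic)"
    unfolding r padic_norm_mult[symmetric] by (simp add: of_rat_divide of_rat_power)
  hence "padic_norm (of_int k :: 'p padic) \<le> 1 * inverse (real CARD('p)) ^ m"
    unfolding padic_norm_p_power using le by (metis mult_right_mono inverse_nonnegative_iff_nonnegative of_nat_0_le_iff zero_le_power)
  hence "pint TYPE('p) ^ m dvd k" unfolding mult_1 padic_norm_of_int_le_iff .
  then obtain l where "k = pint TYPE('p) ^ m * l" by blast
  hence "r = of_int l" unfolding r by simp
  thus ?thesis by simp
qed

text \<open>The digits at places \<open>\<ge> 0\<close> contribute a p-adic integer, and the remaining finitely many digits
  have \<open>p\<^sup>n\<close> as a common denominator.\<close>
lemma padic_frac_approx:
  fixes x :: "'p::prime_card padic"
  shows "padic_frac x \<in> Z_inv_p TYPE('p)" and "padic_norm (x - of_rat (padic_frac x)) \<le> 1"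
proof -
  obtain g where "is_padic_expansion x g (padic_digit x)" using padic_digit_expansion by blast
  hence "is_padic_expansion x (min g 0) (padic_digit x)"
    using is_padic_expansion_extend[of x "min g 0" "nat (g - min g 0)"] by simp
  then obtain n where n: "is_padic_expansion x (- int n) (padic_digit x)"
    by (metis min.cobounded2 minus_equation_iff neg_le_0_iff_le zero_le_imp_eq_int equation_minus_iff)
  have 0: "padic_digit x j = 0" if "j < - int n" for j
    using n that unfolding is_padic_expansion_def by blast
  have "padic_frac x = (\<Sum>j\<in>{- int n..<0}. of_nat (padic_digit x j) * of_nat CARD('p) powi j)"
    unfolding padic_frac_def by (rule sum.mono_neutral_left) (use 0 in \<open>auto intro!: leI\<close>)
  also have "\<dots> = (\<Sum>i<n. of_nat (padic_digit x (- int n + int i)) * of_nat CARD('p) powi (- int n + int i))"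
    by (rule sum.reindex_bij_witness[of _ "\<lambda>i. - int n + int i" "\<lambda>j. nat (j + int n)"]) auto
  finally have eq: "padic_frac x = (\<Sum>i<n. of_nat (padic_digit x (- int n + int i)) * of_nat CARD('p) powi (- int n + int i))" .
  also have "\<dots> = (\<Sum>i<n. of_nat (padic_digit x (- int n + int i)) * of_nat CARD('p) ^ i) / of_nat CARD('p) ^ n"
    unfolding sum_divide_distrib by (intro sum.cong refl) (simp add: power_int_diff)
  also have "\<dots> = of_int (\<Sum>i<n. int (padic_digit x (- int n + int i)) * int CARD('p) ^ i) / of_nat CARD('p) ^ n"
    by simp
  finally show "padic_frac x \<in> Z_inv_p TYPE('p)" by blast
  have "of_rat (padic_frac x) = (\<Sum>i<n. of_nat (padic_digit x (- int n + int i)) * (of_nat CARD('p) :: 'p padic) powi (- int n + int i))"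
    unfolding eq of_rat_sum by (intro sum.cong refl) (simp add: of_rat_mult of_rat_divide of_rat_power power_int_diff)
  thus "padic_norm (x - of_rat (padic_frac x)) \<le> 1"
    using is_padic_expansion_tail[OF n, of n] by simp
qed

text \<open>Two elements of \<open>\<int>[1/p]\<close> that approximate \<open>x\<close> to within 1 differ by an integer, which does not
  change the value of the exponential. This makes the additivity of the character immediate although
  fractional parts are not additive.\<close>
lemma padic_char_eq_cis:
  fixes x :: "'p::prime_card padic"
  assumes "r \<in> Z_inv_p TYPE('p)" "padic_norm (x - of_rat r) \<le> 1"
  shows "padic_char x = cis (2 * pi * of_rat r)"
proof -
  have "padic_norm (of_rat (padic_frac x + - r) :: 'p padic) \<le> 1"
    using padic_norm_ultra_diff[of "of_rat (padic_frac x)" "of_rat r" x] assms(2) padic_frac_approx(2)[of x]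
    unfolding padic_norm_diff_commute[of _ x] by (simp add: of_rat_diff)
  hence "padic_frac x + - r \<in> \<int>"
    using Z_inv_p_padic_int_imp_Ints[of "padic_frac x + - r", OF Z_inv_p_add[OF padic_frac_approx(1) Z_inv_p_uminus[OF assms(1)]]] by blast
  then obtain l where "padic_frac x + - r = of_int l" by (auto elim: Ints_cases)
  hence "padic_frac x = r + of_int l" by simp
  hence "padic_char x = cis (2 * pi * of_rat r) * cis (2 * pi * of_int l)"
    by (simp add: padic_char_def cis_mult of_rat_add algebra_simps)
  also have "cis (2 * pi * of_int l) = 1" by (rule cis_multiple_2pi) simp
  finally show ?thesis by simp
qed

lemma padic_char_add: "padic_char (x + y) = padic_char x * padic_char y"
  for x y :: "'p::prime_card padic"
proof -
  have "padic_norm (x + y - of_rat (padic_frac x + padic_frac y)) \<le> 1"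
    using padic_norm_ultra[of "x - of_rat (padic_frac x)" "y - of_rat (padic_frac y)"]
      padic_frac_approx(2)[of x] padic_frac_approx(2)[of y] by (simp add: of_rat_add algebra_simps)
  from padic_char_eq_cis[OF Z_inv_p_add[OF padic_frac_approx(1) padic_frac_approx(1)] this]
  show ?thesis by (simp add: padic_char_def cis_mult of_rat_add algebra_simps)
qed

lemma padic_char_eq_1_iff: "padic_char x = 1 \<longleftrightarrow> padic_norm x \<le> 1"
  for x :: "'p::prime_card padic"
proof
  assume "padic_norm x \<le> 1"
  moreover have "(0 :: rat) \<in> Z_inv_p TYPE('p)" by (auto intro!: exI[of _ 0])
  ultimately show "padic_char x = 1" using padic_char_eq_cis[of 0 x] by simp
next
  assume "padic_char x = 1"
  hence "cos (2 * pi * of_rat (padic_frac x)) = 1" unfolding padic_char_def by (metis cis.sel(1) one_complex.sel(1))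
  then obtain l :: int where "2 * pi * of_rat (padic_frac x) = of_int l * 2 * pi"
    unfolding cos_one_2pi_int by blast
  hence "of_rat (padic_frac x) = (of_int l :: real)" by simp
  hence "padic_frac x = of_int l" by (metis of_rat_eq_iff of_rat_of_int_eq)
  hence "padic_norm (x - of_int l) \<le> 1" using padic_frac_approx(2)[of x] by simp
  thus "padic_norm x \<le> 1"
    using padic_norm_ultra[of "x - of_int l" "of_int l"] padic_norm_of_int_le_1[of l, where 'a='p] by simp
qed

lemma norm_padic_char [simp]: "cmod (padic_char x) = 1"
  by (simp add: padic_char_def)

lemma padic_char_0 [simp]: "padic_char 0 = 1"
  by (simp add: padic_char_eq_1_iff)

lemma padic_char_minus: "padic_char (- x) = cnj (padic_char x)"
proof -
  have "padic_char (- x) * padic_char x = 1" by (simp flip: padic_char_add)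
  moreover have "cnj (padic_char x) * padic_char x = 1"
    by (metis complex_norm_square mult.commute norm_padic_char of_real_1 one_power2)
  ultimately show ?thesis by (metis mult_cancel_right mult_eq_0_iff zero_neq_one)
qed

section \<open>Dilations, translations and joint measurability for the Haar measure\<close>

lemma sets_padic_haar [measurable_cong]: "sets (padic_haar :: 'p::prime_card padic measure) = sets borel"
  using is_normalized_haar_padic_haar unfolding is_normalized_haar_def by blast

lemma space_padic_haar [simp]: "space padic_haar = UNIV"
  using sets_eq_imp_space_eq[OF sets_padic_haar] by simp

lemma space_haar [simp]: "space haar = UNIV"
  by (simp add: haar_def)

lemma borel_sets_haar: "A \<in> sets borel \<Longrightarrow> A \<in> sets (haar :: 'p::prime_card padic measure)"
  unfolding haar_def by (rule sets_completionI_sets) (simp add: sets_padic_haar)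

lemma borel_measurable_haar: "f \<in> measurable borel M \<Longrightarrow> f \<in> measurable haar M"
  unfolding haar_def by (rule measurable_completion) (simp cong: measurable_cong_sets add: sets_padic_haar)

lemma emeasure_haar_borel: "A \<in> sets borel \<Longrightarrow> emeasure haar A = emeasure padic_haar A"
  unfolding haar_def by (subst emeasure_completion) (auto simp: sets_padic_haar)

lemma borel_measurable_padic_haar: "measurable (padic_haar :: 'p::prime_card padic measure) M = measurable borel M"
  by (rule measurable_cong_sets) (simp_all add: sets_padic_haar)

lemma emeasure_haar_ball:
  "emeasure haar (cball (c :: 'p::prime_card padic) (inverse (real CARD('p)) ^ n)) = ennreal (inverse (real CARD('p)) ^ n)"
  by (subst emeasure_haar_borel) (auto simp: normalized_haar_ball[OF is_normalized_haar_padic_haar] simp del: mem_cball)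

interpretation haar: sigma_finite_measure "haar :: 'p::prime_card padic measure"
proof
  let ?B = "\<lambda>q :: rat. cball (of_rat q :: 'p padic) (inverse (real CARD('p)) ^ 0)"
  have "x \<in> (\<Union>q. ?B q)" for x
    using padic_dense_rat[of x 0] unfolding UN_iff mem_cball_padic by blast
  moreover have "?B q \<in> sets haar" for q by (rule borel_sets_haar) simp
  ultimately show "\<exists>A :: 'p padic set set. countable A \<and> A \<subseteq> sets haar \<and> \<Union> A = space haar \<and> (\<forall>a\<in>A. emeasure haar a \<noteq> \<infinity>)"
    using emeasure_haar_ball[where 'p = 'p and n = 0] by (intro exI[of _ "range ?B"]) (auto simp del: mem_cball power_0)
qed

interpretation haar2: pair_sigma_finite
  "haar :: 'p::prime_card padic measure" "haar :: 'p::prime_card padic measure" ..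

interpretation haar: complete_measure "haar :: 'p::prime_card padic measure"
  unfolding haar_def ..

definition dilation :: "int \<Rightarrow> 'p::prime_card padic \<Rightarrow> 'p padic" where
  "dilation j x = of_nat CARD('p) powi j * x"

lemma dilation_dilation [simp]: "dilation j (dilation k x) = dilation (j + k) x"
  by (simp add: dilation_def power_int_add)

lemma dilation_0 [simp]: "dilation 0 x = x"
  by (simp add: dilation_def)

lemma padic_norm_dilation: "padic_norm (dilation j x :: 'p::prime_card padic) = real CARD('p) powi (- j) * padic_norm x"
  by (simp add: dilation_def padic_norm_mult padic_norm_powi power_int_minus power_int_inverse)

lemma padic_dilate_eq_vimage: "padic_dilate j A = dilation (- j) -` A"
proof (intro equalityI subsetI)
  fix x assume "x \<in> dilation (- j) -` A"
  hence "dilation j (dilation (- j) x) \<in> dilation j ` A" by blast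
  thus "x \<in> padic_dilate j A" by (simp add: padic_dilate_def flip: dilation_def)
next
  fix x assume "x \<in> padic_dilate j A"
  then obtain a where "a \<in> A" "x = dilation j a" unfolding padic_dilate_def dilation_def by blast
  thus "x \<in> dilation (- j) -` A" by simp
qed

lemma continuous_on_dilation: "continuous_on UNIV (dilation j :: 'p::prime_card padic \<Rightarrow> _)"
  unfolding continuous_on_iff
proof (intro ballI allI impI)
  fix x :: "'p padic" and e :: real assume "e > 0"
  have pos: "real CARD('p) powi (- j) > 0" by simp
  show "\<exists>d>0. \<forall>x'\<in>UNIV. dist x' x < d \<longrightarrow> dist (dilation j x') (dilation j x) < e"
  proof (intro exI[of _ "e / real CARD('p) powi (- j)"] conjI ballI impI)
    fix x' assume "dist x' x < e / real CARD('p) powi (- j)"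
    hence "real CARD('p) powi (- j) * padic_norm (x' - x) < e"
      using pos by (simp add: dist_padic_def pos_less_divide_eq mult.commute)
    moreover have "dilation j x' - dilation j x = dilation j (x' - x)"
      by (simp add: dilation_def algebra_simps)
    ultimately show "dist (dilation j x') (dilation j x) < e"
      unfolding dist_padic_def by (simp add: padic_norm_dilation)
  qed (use \<open>e > 0\<close> pos in auto)
qed

lemma dilation_measurable_borel [measurable]: "dilation j \<in> borel \<rightarrow>\<^sub>M borel"
  by (rule borel_measurable_continuous_onI[OF continuous_on_dilation])

lemma dilation_vimage_borel: "A \<in> sets borel \<Longrightarrow> dilation j -` A \<in> sets borel"
  using measurable_sets[OF dilation_measurable_borel, of A j] by simp

text \<open>For \<open>j = - 1\<close> both sides are measures that agree on balls. The case \<open>j = 1\<close> is its inverse, and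
  the other exponents follow by iteration.\<close>
lemma emeasure_padic_haar_dilation_vimage:
  fixes A :: "'p::prime_card padic set"
  assumes "A \<in> sets borel"
  shows "emeasure padic_haar (dilation j -` A) = ennreal (real CARD('p) powi j) * emeasure padic_haar A"
proof -
  let ?\<mu> = "emeasure (padic_haar :: 'p padic measure)" and ?q = "inverse (real CARD('p))"
  have q: "?q > 0" by simp
  have ball: "emeasure (distr padic_haar borel (dilation (- 1))) (cball c (?q ^ n)) = ennreal (?q ^ Suc n)"
    for c :: "'p padic" and n
  proof -
    have "dilation (- 1) -` cball c (?q ^ n) = cball (dilation 1 c) (?q ^ Suc n)"
    proof (rule Set.set_eqI)
      fix x
      have "dilation (- 1) x - c = dilation (- 1) (x - dilation 1 c)"
        by (simp add: dilation_def algebra_simps)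
      hence "padic_norm (dilation (- 1) x - c) = real CARD('p) * padic_norm (x - dilation 1 c)"
        by (simp add: padic_norm_dilation)
      thus "x \<in> dilation (- 1) -` cball c (?q ^ n) \<longleftrightarrow> x \<in> cball (dilation 1 c) (?q ^ Suc n)"
        unfolding vimage_eq mem_cball_padic by (simp add: field_simps)
    qed
    thus ?thesis
      by (simp add: emeasure_distr borel_measurable_padic_haar
          normalized_haar_ball[OF is_normalized_haar_padic_haar] del: mem_cball power_Suc)
  qed
  have ball': "emeasure (density padic_haar (\<lambda>_. ennreal ?q)) (cball c (?q ^ n)) = ennreal (?q ^ Suc n)"
    for c :: "'p padic" and n
    by (simp add: emeasure_density_const sets_padic_haar ennreal_mult
          normalized_haar_ball[OF is_normalized_haar_padic_haar] del: mem_cball)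
  have "distr padic_haar borel (dilation (- 1)) = density padic_haar (\<lambda>_ :: 'p padic. ennreal ?q)"
    by (rule padic_measure_eqI) (simp_all only: ball ball' sets_distr sets_density sets_padic_haar, simp)
  note distr = this
  have down: "?\<mu> (dilation (- 1) -` A) = ennreal ?q * ?\<mu> A" if "A \<in> sets borel" for A :: "'p padic set"
  proof -
    have "?\<mu> (dilation (- 1) -` A) = emeasure (distr padic_haar borel (dilation (- 1))) A"
      using that by (simp add: emeasure_distr borel_measurable_padic_haar)
    also have "\<dots> = ennreal ?q * ?\<mu> A"
      unfolding distr using that by (simp add: emeasure_density_const sets_padic_haar)
    finally show ?thesis .
  qed
  have up: "?\<mu> (dilation 1 -` A) = ennreal (real CARD('p)) * ?\<mu> A" if A: "A \<in> sets borel" for A :: "'p padic set"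
  proof -
    have "?\<mu> A = ?\<mu> (dilation (- 1) -` (dilation 1 -` A))" by (simp add: vimage_def)
    also have "\<dots> = ennreal ?q * ?\<mu> (dilation 1 -` A)" by (rule down[OF dilation_vimage_borel[OF A]])
    finally have "ennreal (real CARD('p)) * ?\<mu> A = (ennreal (real CARD('p)) * ennreal ?q) * ?\<mu> (dilation 1 -` A)"
      by (simp add: mult.assoc)
    also have "ennreal (real CARD('p)) * ennreal ?q = 1" by (simp add: ennreal_mult[symmetric])
    finally show ?thesis by simp
  qed
  show ?thesis
  proof (induction j rule: int_induct[where k = 0])
    case base
    show ?case by (simp add: vimage_def)
  next
    case (step1 i)
    have "dilation (i + 1) -` A = dilation 1 -` (dilation i -` A)" by (simp add: vimage_def)
    thus ?case using step1 up[OF dilation_vimage_borel[OF assms]]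
      by (simp add: power_int_add ennreal_mult mult_ac)
  next
    case (step2 i)
    have "dilation (i - 1) -` A = dilation (- 1) -` (dilation i -` A)" by (simp add: vimage_def)
    thus ?case using step2 down[OF dilation_vimage_borel[OF assms]]
      by (simp add: power_int_diff ennreal_mult divide_inverse mult_ac)
  qed
qed

text \<open>Dilations preserve null sets, so the formula for Borel sets passes to the completion.\<close>
lemma haar_dilation:
  "dilation j \<in> (haar :: 'p::prime_card padic measure) \<rightarrow>\<^sub>M haar"
  "distr haar haar (dilation j) = density haar (\<lambda>_ :: 'p::prime_card padic. ennreal (real CARD('p) powi j))"
proof -
  let ?c = "ennreal (real CARD('p) powi j)"
  let ?D = "density padic_haar (\<lambda>_ :: 'p padic. ?c)"
  have pos: "?c > 0" by simp
  have meas: "dilation j \<in> haar \<rightarrow>\<^sub>M (padic_haar :: 'p padic measure)"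
    by (simp add: measurable_cong_sets[OF refl sets_padic_haar] borel_measurable_haar)
  have "distr haar padic_haar (dilation j) = distr padic_haar padic_haar (dilation j)"
    unfolding haar_def by (rule distr_completion)
      (simp add: measurable_cong_sets[OF sets_padic_haar sets_padic_haar])
  also have "\<dots> = ?D"
    by (rule measure_eqI) (auto simp: emeasure_distr emeasure_density_const sets_padic_haar
        emeasure_padic_haar_dilation_vimage measurable_cong_sets[OF sets_padic_haar sets_padic_haar])
  finally have eq: "distr haar padic_haar (dilation j) = ?D" .
  have null: "null_sets ?D = null_sets padic_haar"
    using pos by (auto simp: null_sets_def emeasure_density_const)
  have "completion ?D = distr haar (completion padic_haar) (dilation j)"
    unfolding eq[symmetric] by (rule haar.completion_distr_eq[OF meas]) (simp only: eq null)
  moreover have "completion ?D = density haar (\<lambda>_. ?c)"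
    unfolding haar_def by (rule completion_density_eq) (use pos in auto)
  ultimately show "distr haar haar (dilation j) = density haar (\<lambda>_ :: 'p padic. ?c)"
    unfolding haar_def[symmetric] by simp
  show "dilation j \<in> haar \<rightarrow>\<^sub>M (haar :: 'p padic measure)"
    using haar.measurable_completion2[OF meas] unfolding eq null haar_def[symmetric] by simp
qed

lemma sets_padic_dilate:
  "A \<in> sets haar \<Longrightarrow> padic_dilate j A \<in> sets (haar :: 'p::prime_card padic measure)"
  unfolding padic_dilate_eq_vimage using measurable_sets[OF haar_dilation(1), of A "- j"] by simp

lemma emeasure_padic_dilate:
  fixes A :: "'p::prime_card padic set"
  assumes "A \<in> sets haar"
  shows "emeasure haar (padic_dilate j A) = ennreal (real CARD('p) powi (- j)) * emeasure haar A"
proof -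
  have "emeasure haar (padic_dilate j A) = emeasure (distr haar haar (dilation (- j))) A"
    unfolding padic_dilate_eq_vimage using assms by (simp add: emeasure_distr haar_dilation(1))
  also have "\<dots> = ennreal (real CARD('p) powi (- j)) * emeasure haar A"
    unfolding haar_dilation(2) using assms by (simp add: emeasure_density_const)
  finally show ?thesis .
qed

lemma integrable_dilation:
  fixes f :: "'p::prime_card padic \<Rightarrow> 'b::{banach, second_countable_topology}"
  assumes "integrable haar f"
  shows "integrable haar (\<lambda>x. f (dilation j x))"
proof -
  have "integrable (distr haar haar (dilation j)) f"
    unfolding haar_dilation(2) using assms by (subst integrable_density) auto
  thus ?thesis by (rule integrable_distr[OF haar_dilation(1)])
qed

lemma integral_dilation:
  fixes f :: "'p::prime_card padic \<Rightarrow> 'b::{banach, second_countable_topology}"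
  assumes "f \<in> borel_measurable haar"
  shows "(LINT x|haar. f (dilation j x)) = (real CARD('p) powi j) *\<^sub>R (LINT x|haar. f x)"
proof -
  have "(LINT x|haar. f (dilation j x)) = (LINT x|distr haar haar (dilation j). f x)"
    by (rule integral_distr[OF haar_dilation(1) assms, symmetric])
  also have "\<dots> = (real CARD('p) powi j) *\<^sub>R (LINT x|haar. f x)"
    unfolding haar_dilation(2) using assms by (subst integral_density) auto
  finally show ?thesis .
qed

lemma padic_haar_translation:
  "distr padic_haar borel ((+) a) = (padic_haar :: 'p::prime_card padic measure)"
  "(+) a \<in> (borel :: 'p padic measure) \<rightarrow>\<^sub>M borel"
proof -
  show meas: "(+) a \<in> (borel :: 'p padic measure) \<rightarrow>\<^sub>M borel" for a
  proof (rule borel_measurable_continuous_onI)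
    show "continuous_on UNIV ((+) a)"
      unfolding continuous_on_iff by (auto simp: dist_padic_def)
  qed
  show "distr padic_haar borel ((+) a) = (padic_haar :: 'p::prime_card padic measure)"
  proof (rule measure_eqI)
    fix A assume "A \<in> sets (distr padic_haar borel ((+) a))"
    hence A: "A \<in> sets borel" by simp
    have "(+) a -` A = (+) (- a) ` A" by (auto intro!: image_eqI[of _ _ "a + _"])
    moreover have "emeasure padic_haar ((+) (- a) ` A) = emeasure padic_haar A"
      using A is_normalized_haar_padic_haar unfolding is_normalized_haar_def by blast
    ultimately show "emeasure (distr padic_haar borel ((+) a)) A = emeasure padic_haar A"
      using A meas[of a] by (simp only: emeasure_distr borel_measurable_padic_haar space_padic_haar Int_UNIV_right)
  qed (simp add: sets_padic_haar)
qed

lemma integral_translation: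
  fixes f :: "'p::prime_card padic \<Rightarrow> 'b::{banach, second_countable_topology}"
  assumes "f \<in> borel_measurable borel"
  shows "(LINT x|haar. f (a + x)) = (LINT x|haar. f x)"
proof -
  have "(\<lambda>x. f (a + x)) \<in> borel_measurable borel"
    using measurable_compose[OF padic_haar_translation(2) assms] by simp
  hence "(LINT x|haar. f (a + x)) = (LINT x|padic_haar. f (a + x))"
    unfolding haar_def by (intro integral_completion) (simp add: borel_measurable_padic_haar)
  also have "\<dots> = (LINT x|distr padic_haar borel ((+) a). f x)"
    by (rule integral_distr[symmetric]) (simp_all add: assms borel_measurable_padic_haar padic_haar_translation(2))
  also have "\<dots> = (LINT x|haar. f x)"
    unfolding padic_haar_translation(1) haar_def
    by (rule integral_completion[symmetric]) (simp add: borel_measurable_padic_haar assms)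
  finally show ?thesis .
qed

text \<open>A preimage is a union of products of two balls, and balls with rational centres suffice, so the
  union is countable.\<close>
lemma measurable_locally_constant_pair:
  fixes F :: "'p::prime_card padic \<times> 'p padic \<Rightarrow> 'b"
  assumes "\<And>x y. \<exists>n. \<forall>x'\<in>padic_ball x n. \<forall>y'\<in>padic_ball y n. F (x', y') = F (x, y)"
    and "range F \<subseteq> space M"
  shows "F \<in> (borel \<Otimes>\<^sub>M borel) \<rightarrow>\<^sub>M M"
proof (rule measurableI)
  fix S assume "S \<in> sets M"
  let ?I = "{(q :: rat, r :: rat, n). padic_ball (of_rat q) n \<times> padic_ball (of_rat r) n \<subseteq> F -` S}"
  have "F -` S = (\<Union>(q, r, n)\<in>?I. padic_ball (of_rat q) n \<times> padic_ball (of_rat r) n)"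
  proof (intro equalityI subsetI)
    fix z assume z: "z \<in> F -` S"
    obtain x y where xy: "z = (x, y)" by (cases z)
    obtain n where n: "\<forall>x'\<in>padic_ball x n. \<forall>y'\<in>padic_ball y n. F (x', y') = F (x, y)"
      using assms(1) by blast
    obtain q where q: "padic_norm (x - of_rat q) \<le> inverse (real CARD('p)) ^ n"
      using padic_dense_rat by blast
    obtain r where r: "padic_norm (y - of_rat r) \<le> inverse (real CARD('p)) ^ n"
      using padic_dense_rat by blast
    have eq: "padic_ball x n = padic_ball (of_rat q) n" "padic_ball y n = padic_ball (of_rat r) n"
      by (rule cball_padic_eq[OF q], rule cball_padic_eq[OF r])
    have "x \<in> padic_ball (of_rat q) n" "y \<in> padic_ball (of_rat r) n"
      using q r unfolding mem_cball_padic .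
    moreover have "(q, r, n) \<in> ?I" using n z unfolding xy eq by auto
    ultimately show "z \<in> (\<Union>(q, r, n)\<in>?I. padic_ball (of_rat q) n \<times> padic_ball (of_rat r) n)"
      unfolding xy by blast
  qed blast
  also have "\<dots> \<in> sets (borel \<Otimes>\<^sub>M borel)"
    by (intro sets.countable_UN'') (auto intro!: pair_measureI simp del: mem_cball)
  finally show "F -` S \<inter> space (borel \<Otimes>\<^sub>M borel) \<in> sets (borel \<Otimes>\<^sub>M borel)"
    by (simp add: space_pair_measure)
qed (use assms(2) in auto)

lemma measurable_haar_pair:
  "F \<in> (borel \<Otimes>\<^sub>M borel) \<rightarrow>\<^sub>M M \<Longrightarrow> F \<in> ((haar :: 'p::prime_card padic measure) \<Otimes>\<^sub>M (haar :: 'p padic measure)) \<rightarrow>\<^sub>M M"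
proof -
  assume F: "F \<in> (borel \<Otimes>\<^sub>M borel) \<rightarrow>\<^sub>M M"
  have "id \<in> (haar :: 'p padic measure) \<rightarrow>\<^sub>M borel" by (rule borel_measurable_haar) simp
  hence "(\<lambda>z. (id (fst z), id (snd z))) \<in> ((haar :: 'p padic measure) \<Otimes>\<^sub>M (haar :: 'p padic measure)) \<rightarrow>\<^sub>M (borel \<Otimes>\<^sub>M borel)"
    by (intro measurable_Pair measurable_compose[OF measurable_fst] measurable_compose[OF measurable_snd])
  from measurable_compose[OF this F] show ?thesis by simp
qed

text \<open>By the ultrametric inequality, \<open>\<xi> * x\<close> changes by a p-adic integer when both factors move by little,
  and the character does not notice that.\<close>
lemma padic_char_mult_measurable:
  "(\<lambda>(\<xi>, x). padic_char (\<xi> * x)) \<in> ((borel :: 'p::prime_card padic measure) \<Otimes>\<^sub>M borel) \<rightarrow>\<^sub>M borel"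
proof (rule measurable_locally_constant_pair)
  fix x y :: "'p padic"
  let ?q = "inverse (real CARD('p))"
  define c where "c = max 1 (max (padic_norm x) (padic_norm y))"
  have c: "c > 0" "1 \<le> c" "padic_norm x \<le> c" "padic_norm y \<le> c" by (auto simp: c_def)
  have "\<forall>\<^sub>F n in sequentially. ?q ^ n < 1 / c"
    using c by (intro order_tendstoD[OF tendsto_p_power]) simp
  then obtain n where n: "?q ^ n * c \<le> 1"
    using c by (auto simp: eventually_sequentially field_simps intro: less_imp_le)
  have q1: "?q ^ n \<le> 1" using CARD_gt_1[where 'p='p] by (intro power_le_one) (auto simp: field_simps)
  show "\<exists>n. \<forall>x'\<in>padic_ball x n. \<forall>y'\<in>padic_ball y n. (case (x', y') of (\<xi>, x) \<Rightarrow> padic_char (\<xi> * x))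
      = (case (x, y) of (\<xi>, x) \<Rightarrow> padic_char (\<xi> * x))"
  proof (intro exI[of _ n] ballI)
    fix x' y' assume "x' \<in> padic_ball x n" "y' \<in> padic_ball y n"
    hence x': "padic_norm (x' - x) \<le> ?q ^ n" and y': "padic_norm (y' - y) \<le> ?q ^ n"
      unfolding mem_cball_padic .
    have "padic_norm y' \<le> c"
      using padic_norm_ultra[of "y' - y" y] y' q1 c by simp
    hence "padic_norm ((x' - x) * y') \<le> ?q ^ n * c"
      unfolding padic_norm_mult using x' by (intro mult_mono) auto
    moreover have "padic_norm (x * (y' - y)) \<le> c * ?q ^ n"
      unfolding padic_norm_mult using y' c by (intro mult_mono) auto
    ultimately have "padic_norm ((x' - x) * y' + x * (y' - y)) \<le> 1"
      using padic_norm_ultra[of "(x' - x) * y'" "x * (y' - y)"] n by (simp add: mult.commute)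
    hence "padic_char ((x' - x) * y' + x * (y' - y)) = 1" by (simp only: padic_char_eq_1_iff)
    hence "padic_char (((x' - x) * y' + x * (y' - y)) + x * y) = padic_char (x * y)"
      unfolding padic_char_add by simp
    thus "(case (x', y') of (\<xi>, x) \<Rightarrow> padic_char (\<xi> * x)) = (case (x, y) of (\<xi>, x) \<Rightarrow> padic_char (\<xi> * x))"
      by (simp add: algebra_simps)
  qed
qed auto

lemma padic_char_mult_measurable_right: "(\<lambda>x. padic_char (t * x)) \<in> borel \<rightarrow>\<^sub>M borel"
  using measurable_compose[OF measurable_Pair1' padic_char_mult_measurable, of t] by simp

text \<open>Every point of a ball is a centre of it, so membership is locally constant in both variables.\<close>
lemma ball_indicator_measurable:
  "(\<lambda>(x, y). indicator (padic_ball x n) y :: ennreal) \<in>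
    ((borel :: 'p::prime_card padic measure) \<Otimes>\<^sub>M borel) \<rightarrow>\<^sub>M borel"
proof (rule measurable_locally_constant_pair)
  fix x y :: "'p padic"
  have iff: "y' \<in> padic_ball x' n \<longleftrightarrow> y \<in> padic_ball x n"
    if x': "x' \<in> padic_ball x n" and y': "y' \<in> padic_ball y n" for x' y'
  proof -
    have "padic_ball x' n = padic_ball x n"
      by (rule cball_padic_eq) (use x' in \<open>simp only: mem_cball_padic\<close>)
    moreover have "padic_ball y n = padic_ball y' n"
      by (rule cball_padic_eq) (use y' in \<open>simp only: mem_cball_padic padic_norm_diff_commute[of y]\<close>)
    moreover have "y' \<in> padic_ball x n \<longleftrightarrow> x \<in> padic_ball y' n" "y \<in> padic_ball x n \<longleftrightarrow> x \<in> padic_ball y n"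
      by (simp_all add: dist_commute)
    ultimately show ?thesis by simp
  qed
  show "\<exists>n'. \<forall>x'\<in>padic_ball x n'. \<forall>y'\<in>padic_ball y n'.
      (case (x', y') of (x, y) \<Rightarrow> (indicator (padic_ball x n) y :: ennreal)) = (case (x, y) of (x, y) \<Rightarrow> indicator (padic_ball x n) y)"
  proof (intro exI[of _ n] ballI)
    fix x' y' assume "x' \<in> padic_ball x n" "y' \<in> padic_ball y n"
    from iff[OF this]
    show "(case (x', y') of (x, y) \<Rightarrow> (indicator (padic_ball x n) y :: ennreal)) = (case (x, y) of (x, y) \<Rightarrow> indicator (padic_ball x n) y)"
      by (simp only: prod.case indicator_def)
  qed
qed auto

lemma dilation_AE:
  assumes "AE x in (haar :: 'p::prime_card padic measure). P x"
  shows "AE x in haar. P (dilation j x)"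
proof (rule AE_distrD[OF haar_dilation(1)])
  show "AE x in distr haar haar (dilation j). P x"
    unfolding haar_dilation(2) using assms by (simp add: AE_density)
qed

lemma mem_padic_dilate_iff: "x \<in> padic_dilate j A \<longleftrightarrow> dilation (- j) x \<in> A"
  by (simp add: padic_dilate_eq_vimage)

section \<open>The character on large balls\<close>

abbreviation (input) big_ball :: "'p::prime_card itself \<Rightarrow> nat \<Rightarrow> 'p padic set" where
  "big_ball T N \<equiv> cball 0 (real CARD('p) ^ N)"

lemma eventually_mem_big_ball: "\<forall>\<^sub>F N in sequentially. (x :: 'p::prime_card padic) \<in> big_ball TYPE('p) N"
proof -
  obtain n where n: "padic_norm x < real CARD('p) ^ n"
    using real_arch_pow[OF CARD_gt_1[where 'p='p]] by blast
  show ?thesis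
  proof (rule eventually_sequentiallyI[of n])
    fix N assume "n \<le> N"
    hence "real CARD('p) ^ n \<le> real CARD('p) ^ N"
      using CARD_gt_1[where 'p='p] by (intro power_increasing) auto
    thus "x \<in> big_ball TYPE('p) N" unfolding mem_cball_padic using n by simp
  qed
qed

lemma emeasure_big_ball: "emeasure haar (big_ball TYPE('p::prime_card) N) = ennreal (real CARD('p) ^ N)"
proof -
  let ?q = "inverse (real CARD('p))"
  have p: "real CARD('p) ^ N > 0" by simp
  have "big_ball TYPE('p) N = dilation (int N) -` padic_ball 0 0"
  proof (rule Set.set_eqI)
    fix x :: "'p padic"
    have "padic_norm (dilation (int N) x) = padic_norm x / real CARD('p) ^ N"
      by (simp add: padic_norm_dilation power_int_minus field_simps)
    thus "x \<in> big_ball TYPE('p) N \<longleftrightarrow> x \<in> dilation (int N) -` padic_ball 0 0"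
      unfolding vimage_eq mem_cball_padic using p by (simp add: divide_le_eq)
  qed
  hence "emeasure padic_haar (big_ball TYPE('p) N) = ennreal (real CARD('p) powi int N) * ennreal (?q ^ 0)"
    unfolding normalized_haar_ball[OF is_normalized_haar_padic_haar, of 0 0, symmetric]
    by (simp add: emeasure_padic_haar_dilation_vimage del: mem_cball power_0)
  thus ?thesis by (simp add: emeasure_haar_borel del: mem_cball)
qed

lemma cball_sets_haar [measurable, simp]: "cball (c :: 'p::prime_card padic) r \<in> sets haar"
  by (rule borel_sets_haar) simp

lemma has_bochner_integral_complex_indicator:
  assumes "A \<in> sets M" "emeasure M A < \<infinity>"
  shows "has_bochner_integral M (indicator A :: _ \<Rightarrow> complex) (of_real (measure M A))"
  using has_bochner_integral_indicator[OF assms, of "1 :: complex"]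
  by (simp add: scaleR_conv_of_real of_real_indicator)

lemma borel_measurable_cnj [measurable]: "cnj \<in> borel \<rightarrow>\<^sub>M borel"
  by (intro borel_measurable_continuous_onI continuous_intros)

lemma has_bochner_integral_big_ball:
  "has_bochner_integral haar (indicator (big_ball TYPE('p::prime_card) N) :: _ \<Rightarrow> complex) (of_real (real CARD('p) ^ N))"
  using has_bochner_integral_complex_indicator[of "big_ball TYPE('p) N" haar]
  by (simp add: emeasure_big_ball measure_def del: mem_cball)

lemmas integrable_indicator_big_ball = integrable.intros[OF has_bochner_integral_big_ball]

text \<open>Orthogonality of characters. If \<open>t\<close> is small, the character is 1 on the whole domain of
  integration. Otherwise some \<open>\<xi>\<^sub>0\<close> in the ball has \<open>\<chi> (t \<xi>\<^sub>0) \<noteq> 1\<close>; the ball is a subgroup, so translating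
  by \<open>\<xi>\<^sub>0\<close> multiplies the integral by \<open>\<chi> (t \<xi>\<^sub>0)\<close>, which forces it to vanish.\<close>
lemma integral_char_big_ball:
  fixes t :: "'p::prime_card padic"
  shows "(LINT \<xi>|haar. padic_char (t * \<xi>) * indicator (big_ball TYPE('p) N) \<xi>)
    = of_real (real CARD('p) ^ N) * indicator (padic_ball 0 N) t" (is "?I = _")
proof (cases "t \<in> padic_ball 0 N")
  case True
  hence t: "padic_norm t \<le> inverse (real CARD('p)) ^ N" unfolding mem_cball_padic by simp
  have "padic_char (t * \<xi>) * indicator (big_ball TYPE('p) N) \<xi> = (indicator (big_ball TYPE('p) N) \<xi> :: complex)" for \<xi>
  proof (cases "\<xi> \<in> big_ball TYPE('p) N")
    case True
    hence "padic_norm \<xi> \<le> real CARD('p) ^ N" unfolding mem_cball_padic by simp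
    hence "padic_norm (t * \<xi>) \<le> inverse (real CARD('p)) ^ N * real CARD('p) ^ N"
      unfolding padic_norm_mult using t by (intro mult_mono) auto
    hence "padic_norm (t * \<xi>) \<le> 1" by (simp add: power_inverse)
    thus ?thesis by (simp add: padic_char_eq_1_iff[THEN iffD2])
  qed simp
  hence "?I = (LINT \<xi>|haar. indicator (big_ball TYPE('p) N) \<xi> :: complex)" by presburger
  also have "\<dots> = of_real (real CARD('p) ^ N)"
    by (rule has_bochner_integral_integral_eq[OF has_bochner_integral_big_ball])
  finally show ?thesis using True by simp
next
  case False
  hence t: "padic_norm t > inverse (real CARD('p)) ^ N" unfolding mem_cball_padic by simp
  \<comment> \<open>A point of maximal norm \<open>p\<^sup>N\<close> in the ball.\<close>
  define \<xi>0 where "\<xi>0 = dilation (- int N) (1 :: 'p padic)"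
  have n: "padic_norm \<xi>0 = real CARD('p) ^ N" by (simp add: \<xi>0_def padic_norm_dilation)
  have "padic_norm (t * \<xi>0) > inverse (real CARD('p)) ^ N * real CARD('p) ^ N"
    unfolding padic_norm_mult n using t by (intro mult_strict_right_mono) auto
  hence "padic_norm (t * \<xi>0) > 1" by (simp add: power_inverse)
  hence ne: "padic_char (t * \<xi>0) \<noteq> 1" by (simp add: padic_char_eq_1_iff)
  have shift: "indicator (big_ball TYPE('p) N) (\<xi>0 + \<xi>) = (indicator (big_ball TYPE('p) N) \<xi> :: complex)" for \<xi>
  proof -
    have "padic_norm (\<xi>0 + \<xi>) \<le> real CARD('p) ^ N \<longleftrightarrow> padic_norm \<xi> \<le> real CARD('p) ^ N"
      using padic_norm_ultra[of \<xi>0 \<xi>] padic_norm_ultra[of "- \<xi>0" "\<xi>0 + \<xi>"] n by auto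
    thus ?thesis by (simp add: indicator_def mem_cball_padic[where c = 0, simplified])
  qed
  have meas: "(\<lambda>\<xi>. padic_char (t * \<xi>) * indicator (big_ball TYPE('p) N) \<xi>) \<in> borel_measurable borel"
    by (intro borel_measurable_times padic_char_mult_measurable_right borel_measurable_indicator) simp
  have "?I = (LINT \<xi>|haar. padic_char (t * (\<xi>0 + \<xi>)) * indicator (big_ball TYPE('p) N) (\<xi>0 + \<xi>))"
    by (rule integral_translation[OF meas, symmetric])
  also have "\<dots> = (LINT \<xi>|haar. padic_char (t * \<xi>0) * (padic_char (t * \<xi>) * indicator (big_ball TYPE('p) N) \<xi>))"
    unfolding shift by (simp add: distrib_left padic_char_add mult.assoc)
  also have "\<dots> = padic_char (t * \<xi>0) * ?I" by (rule integral_mult_right_zero)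
  finally have "?I = 0" using ne by simp
  thus ?thesis using False by simp
qed

section \<open>The Fourier integral and Bessel's inequality\<close>

lemma integrable_char_mult:
  assumes "integrable haar f"
  shows "integrable haar (\<lambda>x. padic_char (t * x) * f x)"
proof (rule Bochner_Integration.integrable_bound[OF assms])
  show "(\<lambda>x. padic_char (t * x) * f x) \<in> borel_measurable haar"
    using borel_measurable_haar[OF padic_char_mult_measurable_right] assms by measurable
qed (simp add: norm_mult)

lemma padic_fourier_integral_measurable [measurable]:
  fixes f :: "'p::prime_card padic \<Rightarrow> complex"
  assumes [measurable]: "f \<in> borel_measurable haar"
  shows "padic_fourier_integral f \<in> borel_measurable haar"
proof -
  note [measurable] = measurable_haar_pair[OF padic_char_mult_measurable]
  have "(\<lambda>\<xi>. LINT x|haar. (case (\<xi>, x) of (\<xi>, x) \<Rightarrow> padic_char (\<xi> * x)) * f x) \<in> borel_measurable haar"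
    by measurable
  thus ?thesis by (simp add: padic_fourier_integral_def[abs_def])
qed

lemma norm_padic_fourier_integral_le: "cmod (padic_fourier_integral f \<xi>) \<le> (LINT x|haar. cmod (f x))"
  unfolding padic_fourier_integral_def
  by (rule order_trans[OF integral_norm_bound]) (simp add: norm_mult)

text \<open>Fubini's theorem: the kernel \<open>\<chi> (\<xi> x)\<close> is symmetric.\<close>
lemma padic_multiplication_formula:
  fixes f v :: "'p::prime_card padic \<Rightarrow> complex"
  assumes f: "integrable haar f" and v: "integrable haar v"
  shows "(LINT \<xi>|haar. padic_fourier_integral f \<xi> * v \<xi>) = (LINT x|haar. f x * padic_fourier_integral v x)"
proof -
  note [measurable] = measurable_haar_pair[OF padic_char_mult_measurable]
  have [measurable]: "f \<in> borel_measurable haar" "v \<in> borel_measurable haar" using f v by auto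
  let ?F = "\<lambda>z :: 'p padic \<times> 'p padic. (case z of (\<xi>, x) \<Rightarrow> padic_char (\<xi> * x)) * (f (snd z) * v (fst z))"
  have "integrable (haar \<Otimes>\<^sub>M haar) ?F"
  proof (rule haar2.Fubini_integrable)
    show "?F \<in> borel_measurable (haar \<Otimes>\<^sub>M haar)" by measurable
    have "integrable haar (\<lambda>x. (LINT y|haar. cmod (f y)) * cmod (v x))" using v by simp
    thus "integrable haar (\<lambda>x. LINT y|haar. cmod (?F (x, y)))" by (simp add: norm_mult)
    show "AE x in haar. integrable haar (\<lambda>y. ?F (x, y))"
      using integrable_mult_left[OF integrable_char_mult[OF f]] by (simp add: mult.assoc)
  qed
  hence "integrable (haar \<Otimes>\<^sub>M haar) (case_prod (\<lambda>\<xi> x. padic_char (\<xi> * x) * (f x * v \<xi>)))"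
    by (simp add: case_prod_beta')
  from haar2.Fubini_integral[OF this, symmetric]
  have "(LINT \<xi>|haar. LINT x|haar. padic_char (\<xi> * x) * (f x * v \<xi>)) = (LINT x|haar. LINT \<xi>|haar. padic_char (\<xi> * x) * (f x * v \<xi>))" .
  moreover have "(LINT x|haar. padic_char (\<xi> * x) * (f x * v \<xi>)) = padic_fourier_integral f \<xi> * v \<xi>" for \<xi>
    unfolding padic_fourier_integral_def by (subst integral_mult_left_zero[symmetric]) (simp add: mult.assoc)
  moreover have "(LINT \<xi>|haar. padic_char (\<xi> * x) * (f x * v \<xi>)) = f x * padic_fourier_integral v x" for x
    unfolding padic_fourier_integral_def by (subst integral_mult_right_zero[symmetric]) (simp add: mult_ac)
  ultimately show ?thesis by simp
qed

text \<open>The mean of \<open>f\<close> over the ball of radius \<open>p\<^sup>-\<^sup>N\<close> around \<open>x\<close>, whose measure is \<open>p\<^sup>-\<^sup>N\<close>.\<close>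
definition ball_average :: "nat \<Rightarrow> ('p::prime_card padic \<Rightarrow> complex) \<Rightarrow> 'p padic \<Rightarrow> complex" where
  "ball_average N f x = of_real (real CARD('p) ^ N) * (LINT y|haar. indicator (padic_ball x N) y * f y)"

lemma integrable_big_ball_mult_fourier:
  fixes f :: "'p::prime_card padic \<Rightarrow> complex"
  assumes "integrable haar f"
  shows "integrable haar (\<lambda>\<xi>. indicator (big_ball TYPE('p) N) \<xi> * cnj (padic_fourier_integral f \<xi>))"
proof (rule Bochner_Integration.integrable_bound)
  show "integrable haar (\<lambda>\<xi>. (LINT x|haar. cmod (f x)) * cmod (indicator (big_ball TYPE('p) N) \<xi> :: complex))"
    using integrable_indicator_big_ball[where 'p='p and N=N] by simp
  show "(\<lambda>\<xi>. indicator (big_ball TYPE('p) N) \<xi> * cnj (padic_fourier_integral f \<xi>)) \<in> borel_measurable haar"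
    using assms by measurable
qed (auto simp: norm_mult norm_padic_fourier_integral_le indicator_def)

text \<open>The multiplication formula moves the Fourier transform from \<open>f\<close> to a character cut off at the big
  ball, where it produces the normalized indicator of a small ball around \<open>x\<close>.\<close>
lemma fourier_truncated_fourier:
  fixes f :: "'p::prime_card padic \<Rightarrow> complex"
  assumes f: "integrable haar f"
  shows "padic_fourier_integral (\<lambda>\<xi>. indicator (big_ball TYPE('p) N) \<xi> * cnj (padic_fourier_integral f \<xi>)) x
    = cnj (ball_average N f x)"
proof -
  let ?v = "\<lambda>\<xi>. padic_char (- x * \<xi>) * indicator (big_ball TYPE('p) N) \<xi>"
  have v: "integrable haar ?v" by (rule integrable_char_mult[OF integrable_indicator_big_ball])
  have fv: "padic_fourier_integral ?v y = of_real (real CARD('p) ^ N) * indicator (padic_ball x N) y" for y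
  proof -
    have "padic_fourier_integral ?v y = (LINT \<xi>|haar. padic_char ((y - x) * \<xi>) * indicator (big_ball TYPE('p) N) \<xi>)"
      unfolding padic_fourier_integral_def mult.assoc[symmetric] padic_char_add[symmetric]
      by (simp add: algebra_simps)
    also have "\<dots> = of_real (real CARD('p) ^ N) * indicator (padic_ball 0 N) (y - x)"
      by (rule integral_char_big_ball)
    also have "indicator (padic_ball 0 N) (y - x) = (indicator (padic_ball x N) y :: complex)"
      by (simp add: indicator_def mem_cball_padic del: mem_cball)
    finally show ?thesis .
  qed
  have "padic_fourier_integral (\<lambda>\<xi>. indicator (big_ball TYPE('p) N) \<xi> * cnj (padic_fourier_integral f \<xi>)) x
      = (LINT \<xi>|haar. cnj (padic_fourier_integral f \<xi> * ?v \<xi>))"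
    unfolding padic_fourier_integral_def[of _ x]
    by (intro Bochner_Integration.integral_cong refl) (simp add: padic_char_minus indicator_def)
  also have "\<dots> = cnj (LINT \<xi>|haar. padic_fourier_integral f \<xi> * ?v \<xi>)"
    by (rule Bochner_Integration.integral_cnj)
  also have "(LINT \<xi>|haar. padic_fourier_integral f \<xi> * ?v \<xi>) = (LINT y|haar. f y * padic_fourier_integral ?v y)"
    by (rule padic_multiplication_formula[OF f v])
  also have "\<dots> = ball_average N f x"
    unfolding fv ball_average_def integral_mult_right_zero[symmetric]
    by (intro Bochner_Integration.integral_cong refl) (simp add: mult_ac)
  finally show ?thesis .
qed

lemma ball_average_measurable [measurable]:
  assumes "integrable haar f"
  shows "ball_average N f \<in> borel_measurable haar"
proof -
  have "ball_average N f x = cnj (padic_fourier_integral (\<lambda>\<xi>. indicator (big_ball TYPE('a) N) \<xi> * cnj (padic_fourier_integral f \<xi>)) x)" for x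
    unfolding fourier_truncated_fourier[OF assms] by simp
  moreover have "f \<in> borel_measurable haar" using assms by auto
  ultimately show ?thesis by (simp cong: measurable_cong)
qed

text \<open>The multiplication formula for \<open>f\<close> and the truncated conjugate of the transform of \<open>g\<close>.\<close>
lemma truncated_parseval:
  fixes f g :: "'p::prime_card padic \<Rightarrow> complex"
  assumes "integrable haar f" "integrable haar g"
  shows "(LINT \<xi>|haar. indicator (big_ball TYPE('p) N) \<xi> * (padic_fourier_integral f \<xi> * cnj (padic_fourier_integral g \<xi>)))
    = (LINT x|haar. f x * cnj (ball_average N g x))"
  using padic_multiplication_formula[OF assms(1) integrable_big_ball_mult_fourier[OF assms(2), of N]]
  unfolding fourier_truncated_fourier[OF assms(2)] by (simp add: mult_ac)

text \<open>Tonelli's theorem: since \<open>y\<close> lies in the ball around \<open>x\<close> if and only if \<open>x\<close> lies in the ball around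
  \<open>y\<close>, averaging preserves the integral of a nonnegative function.\<close>
lemma nn_integral_ball_kernel:
  fixes \<phi> :: "'p::prime_card padic \<Rightarrow> ennreal"
  assumes [measurable]: "\<phi> \<in> borel_measurable haar"
  shows "(\<integral>\<^sup>+x. ennreal (real CARD('p) ^ N) * (\<integral>\<^sup>+y. indicator (padic_ball x N) y * \<phi> y \<partial>haar) \<partial>haar) = (\<integral>\<^sup>+y. \<phi> y \<partial>haar)"
proof -
  note K = measurable_haar_pair[OF ball_indicator_measurable[of N, where 'p='p]]
  have m: "(\<lambda>z. (case z of (x, y) \<Rightarrow> indicator (padic_ball x N) y) * \<phi> (snd z)) \<in> borel_measurable (haar \<Otimes>\<^sub>M haar)"
    using K by measurable
  have m1: "(\<lambda>x. \<integral>\<^sup>+y. indicator (padic_ball x N) y * \<phi> y \<partial>haar) \<in> borel_measurable haar"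
    using haar.borel_measurable_nn_integral_fst[OF m] by simp
  have "(\<integral>\<^sup>+x. ennreal (real CARD('p) ^ N) * (\<integral>\<^sup>+y. indicator (padic_ball x N) y * \<phi> y \<partial>haar) \<partial>haar)
      = ennreal (real CARD('p) ^ N) * (\<integral>\<^sup>+x. \<integral>\<^sup>+y. indicator (padic_ball x N) y * \<phi> y \<partial>haar \<partial>haar)"
    by (rule nn_integral_cmult[OF m1])
  also have "(\<integral>\<^sup>+x. \<integral>\<^sup>+y. indicator (padic_ball x N) y * \<phi> y \<partial>haar \<partial>haar)
      = (\<integral>\<^sup>+y. \<integral>\<^sup>+x. indicator (padic_ball x N) y * \<phi> y \<partial>haar \<partial>haar)"
    using haar2.Fubini'[of "\<lambda>x y. indicator (padic_ball x N) y * \<phi> y"] m by (simp add: case_prod_beta')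
  also have "\<dots> = (\<integral>\<^sup>+y. ennreal (inverse (real CARD('p)) ^ N) * \<phi> y \<partial>haar)"
  proof (intro nn_integral_cong)
    fix y :: "'p padic"
    have "(\<integral>\<^sup>+x. indicator (padic_ball x N) y * \<phi> y \<partial>haar) = (\<integral>\<^sup>+x. \<phi> y * indicator (padic_ball y N) x \<partial>haar)"
      by (intro nn_integral_cong) (simp add: indicator_def dist_commute mult.commute)
    also have "\<dots> = \<phi> y * ennreal (inverse (real CARD('p)) ^ N)"
      by (subst nn_integral_cmult_indicator) (simp_all add: emeasure_haar_ball del: mem_cball)
    finally show "(\<integral>\<^sup>+x. indicator (padic_ball x N) y * \<phi> y \<partial>haar) = ennreal (inverse (real CARD('p)) ^ N) * \<phi> y"
      by (simp add: mult.commute)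
  qed
  also have "\<dots> = ennreal (inverse (real CARD('p)) ^ N) * (\<integral>\<^sup>+y. \<phi> y \<partial>haar)"
    by (rule nn_integral_cmult) measurable
  also have "ennreal (real CARD('p) ^ N) * \<dots> = (ennreal (real CARD('p) ^ N) * ennreal (inverse (real CARD('p)) ^ N)) * (\<integral>\<^sup>+y. \<phi> y \<partial>haar)"
    by (simp only: mult.assoc)
  also have "ennreal (real CARD('p) ^ N) * ennreal (inverse (real CARD('p)) ^ N) = 1"
    by (simp add: ennreal_mult[symmetric] power_mult_distrib[symmetric])
  finally show ?thesis by simp
qed

lemma norm_ball_average_le:
  fixes f :: "'p::prime_card padic \<Rightarrow> complex"
  assumes f: "integrable haar f"
  shows "ennreal (cmod (ball_average N f x))
    \<le> ennreal (real CARD('p) ^ N) * (\<integral>\<^sup>+y. indicator (padic_ball x N) y * ennreal (cmod (f y)) \<partial>haar)"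
proof -
  have "integrable haar (\<lambda>y. indicator (padic_ball x N) y *\<^sub>R f y)"
    by (rule integrable_mult_indicator[OF _ f]) simp
  hence int: "integrable haar (\<lambda>y. indicator (padic_ball x N) y * f y)" 
    by (simp add: scaleR_conv_of_real of_real_indicator)
  have "ennreal (cmod (ball_average N f x)) = ennreal (real CARD('p) ^ N) * ennreal (cmod (LINT y|haar. indicator (padic_ball x N) y * f y))"
    unfolding ball_average_def norm_mult by (simp add: ennreal_mult norm_power)
  also have "\<dots> \<le> ennreal (real CARD('p) ^ N) * (\<integral>\<^sup>+y. ennreal (cmod (indicator (padic_ball x N) y * f y)) \<partial>haar)"
    by (intro mult_left_mono integral_norm_bound_ennreal int) simp
  also have "(\<lambda>y. ennreal (cmod (indicator (padic_ball x N) y * f y))) = (\<lambda>y. indicator (padic_ball x N) y * ennreal (cmod (f y)))"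
    by (auto simp: indicator_def)
  finally show ?thesis .
qed

lemma ball_average_L1_contraction:
  fixes f :: "'p::prime_card padic \<Rightarrow> complex"
  assumes f: "integrable haar f"
  shows "integrable haar (ball_average N f)"
    and "(LINT x|haar. cmod (ball_average N f x)) \<le> (LINT x|haar. cmod (f x))"
proof -
  have [measurable]: "f \<in> borel_measurable haar" using f by auto
  have "(\<integral>\<^sup>+x. ennreal (cmod (ball_average N f x)) \<partial>haar)
      \<le> (\<integral>\<^sup>+x. ennreal (real CARD('p) ^ N) * (\<integral>\<^sup>+y. indicator (padic_ball x N) y * ennreal (cmod (f y)) \<partial>haar) \<partial>haar)"
    by (intro nn_integral_mono norm_ball_average_le f)
  also have "\<dots> = (\<integral>\<^sup>+x. ennreal (cmod (f x)) \<partial>haar)"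
    by (rule nn_integral_ball_kernel) measurable
  finally have le: "(\<integral>\<^sup>+x. ennreal (cmod (ball_average N f x)) \<partial>haar) \<le> (\<integral>\<^sup>+x. ennreal (cmod (f x)) \<partial>haar)" .
  also have fin: "(\<integral>\<^sup>+x. ennreal (cmod (f x)) \<partial>haar) < \<infinity>" using f by (simp add: integrable_iff_bounded)
  finally show int: "integrable haar (ball_average N f)"
    using f by (intro integrableI_bounded) auto
  have "ennreal (LINT x|haar. cmod (ball_average N f x)) \<le> ennreal (LINT x|haar. cmod (f x))"
    using le by (simp add: nn_integral_eq_integral int f)
  thus "(LINT x|haar. cmod (ball_average N f x)) \<le> (LINT x|haar. cmod (f x))"
    by simp
qed

text \<open>The inner product is a double integral of \<open>f x * cnj (f y)\<close> against the averaging kernel. As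
  \<open>\<bar>f x\<bar> \<bar>f y\<bar> \<le> (\<bar>f x\<bar>\<^sup>2 + \<bar>f y\<bar>\<^sup>2) / 2\<close>, and the kernel has integral 1 in each variable, the
  bound follows. If the integrand is not integrable, its integral is 0 by convention.\<close>
lemma ball_average_L2_bound:
  fixes f :: "'p::prime_card padic \<Rightarrow> complex"
  assumes f: "integrable haar f"
  shows "ennreal (cmod (LINT x|haar. f x * cnj (ball_average N f x))) \<le> (\<integral>\<^sup>+x. ennreal ((cmod (f x))\<^sup>2) \<partial>haar)"
proof (cases "integrable haar (\<lambda>x. f x * cnj (ball_average N f x))")
  case True
  have [measurable]: "f \<in> borel_measurable haar" using f by auto
  let ?p = "ennreal (real CARD('p) ^ N)" and ?I = "\<integral>\<^sup>+x. ennreal ((cmod (f x))\<^sup>2) \<partial>haar"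
  let ?h = "\<lambda>x. ennreal ((cmod (f x))\<^sup>2 / 2)"
  have half: "(\<integral>\<^sup>+x. ?h x \<partial>haar) + (\<integral>\<^sup>+x. ?h x \<partial>haar) = ?I"
    by (subst nn_integral_add[symmetric]) (simp_all add: ennreal_plus[symmetric] del: ennreal_plus)
  have "ennreal (cmod (LINT x|haar. f x * cnj (ball_average N f x)))
      \<le> (\<integral>\<^sup>+x. ennreal (cmod (f x * cnj (ball_average N f x))) \<partial>haar)"
    by (rule integral_norm_bound_ennreal[OF True])
  also have "\<dots> \<le> (\<integral>\<^sup>+x. ?h x + ?p * (\<integral>\<^sup>+y. indicator (padic_ball x N) y * ?h y \<partial>haar) \<partial>haar)"
  proof (rule nn_integral_mono)
    fix x :: "'p padic"
    have "ennreal (cmod (f x * cnj (ball_average N f x)))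
        \<le> ennreal (cmod (f x)) * (?p * (\<integral>\<^sup>+y. indicator (padic_ball x N) y * ennreal (cmod (f y)) \<partial>haar))"
      unfolding norm_mult complex_mod_cnj using norm_ball_average_le[OF f, of N x]
      by (simp add: ennreal_mult mult_left_mono)
    also have "\<dots> = ?p * (\<integral>\<^sup>+y. ennreal (cmod (f x)) * (indicator (padic_ball x N) y * ennreal (cmod (f y))) \<partial>haar)"
      by (subst nn_integral_cmult) (simp_all add: mult_ac del: mem_cball)
    also have "\<dots> \<le> ?p * (\<integral>\<^sup>+y. ?h x * indicator (padic_ball x N) y + indicator (padic_ball x N) y * ?h y \<partial>haar)"
    proof (intro mult_left_mono nn_integral_mono)
      fix y
      have "cmod (f x) * cmod (f y) \<le> (cmod (f x))\<^sup>2 / 2 + (cmod (f y))\<^sup>2 / 2"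
        using sum_squares_bound[of "cmod (f x)" "cmod (f y)"] by simp
      hence "ennreal (cmod (f x)) * ennreal (cmod (f y)) \<le> ?h x + ?h y"
        by (simp add: ennreal_mult[symmetric] ennreal_plus[symmetric] del: ennreal_plus)
      thus "ennreal (cmod (f x)) * (indicator (padic_ball x N) y * ennreal (cmod (f y)))
          \<le> ?h x * indicator (padic_ball x N) y + indicator (padic_ball x N) y * ?h y"
        by (simp add: indicator_def)
    qed simp
    also have "\<dots> = ?p * (?h x * emeasure haar (padic_ball x N) + (\<integral>\<^sup>+y. indicator (padic_ball x N) y * ?h y \<partial>haar))"
      by (subst nn_integral_add) (simp_all add: nn_integral_cmult_indicator del: mem_cball)
    also have "\<dots> = ?h x * (?p * emeasure haar (padic_ball x N)) + ?p * (\<integral>\<^sup>+y. indicator (padic_ball x N) y * ?h y \<partial>haar)"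
      by (simp add: distrib_left mult_ac del: mem_cball)
    also have "?p * emeasure haar (padic_ball x N) = 1"
      unfolding emeasure_haar_ball
      by (simp add: ennreal_mult[symmetric] power_mult_distrib[symmetric])
    finally show "ennreal (cmod (f x * cnj (ball_average N f x)))
        \<le> ?h x + ?p * (\<integral>\<^sup>+y. indicator (padic_ball x N) y * ?h y \<partial>haar)" by simp
  qed
  also have "\<dots> = (\<integral>\<^sup>+x. ?h x \<partial>haar) + (\<integral>\<^sup>+x. ?p * (\<integral>\<^sup>+y. indicator (padic_ball x N) y * ?h y \<partial>haar) \<partial>haar)"
  proof (rule nn_integral_add)
    have "(\<lambda>z. (case z of (x, y) \<Rightarrow> indicator (padic_ball x N) y) * ?h (snd z)) \<in> borel_measurable (haar \<Otimes>\<^sub>M haar)"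
      using measurable_haar_pair[OF ball_indicator_measurable[of N, where 'p='p]] by measurable
    from haar.borel_measurable_nn_integral_fst[OF this]
    show "(\<lambda>x. ?p * (\<integral>\<^sup>+y. indicator (padic_ball x N) y * ?h y \<partial>haar)) \<in> borel_measurable haar" by simp
  qed measurable
  also have "\<dots> = ?I" by (subst nn_integral_ball_kernel) (simp_all add: half)
  finally show ?thesis .
qed (simp add: not_integrable_integral_eq)

text \<open>The truncated Parseval identity with \<open>f = g\<close> bounds the integral over each big ball; then the
  balls exhaust the field.\<close>
lemma fourier_bessel:
  fixes f :: "'p::prime_card padic \<Rightarrow> complex"
  assumes f: "integrable haar f"
  shows "(\<integral>\<^sup>+\<xi>. ennreal ((cmod (padic_fourier_integral f \<xi>))\<^sup>2) \<partial>haar) \<le> (\<integral>\<^sup>+x. ennreal ((cmod (f x))\<^sup>2) \<partial>haar)"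
proof -
  have [measurable]: "f \<in> borel_measurable haar" using f by auto
  let ?g = "\<lambda>N \<xi>. indicator (big_ball TYPE('p) N) \<xi> * ennreal ((cmod (padic_fourier_integral f \<xi>))\<^sup>2)"
  have le: "(\<integral>\<^sup>+\<xi>. ?g N \<xi> \<partial>haar) \<le> (\<integral>\<^sup>+x. ennreal ((cmod (f x))\<^sup>2) \<partial>haar)" for N
  proof -
    let ?h = "\<lambda>\<xi>. indicator (big_ball TYPE('p) N) \<xi> * (cmod (padic_fourier_integral f \<xi>))\<^sup>2"
    have eq: "indicator (big_ball TYPE('p) N) \<xi> * (padic_fourier_integral f \<xi> * cnj (padic_fourier_integral f \<xi>)) = complex_of_real (?h \<xi>)" for \<xi>
      by (simp add: indicator_def complex_norm_square[symmetric])
    have "integrable haar (\<lambda>\<xi>. padic_fourier_integral f \<xi> * (indicator (big_ball TYPE('p) N) \<xi> * cnj (padic_fourier_integral f \<xi>)))"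
    proof (rule Bochner_Integration.integrable_bound)
      show "integrable haar (\<lambda>\<xi>. (LINT x|haar. cmod (f x)) * cmod (indicator (big_ball TYPE('p) N) \<xi> * cnj (padic_fourier_integral f \<xi>)))"
        using integrable_big_ball_mult_fourier[OF f, of N] by simp
    qed (auto simp: norm_mult intro!: mult_right_mono norm_padic_fourier_integral_le)
    hence "integrable haar (\<lambda>\<xi>. complex_of_real (?h \<xi>))" unfolding eq[symmetric] by (simp add: mult_ac)
    hence int: "integrable haar ?h" by (simp only: complex_of_real_integrable_eq)
    have "(\<integral>\<^sup>+\<xi>. ?g N \<xi> \<partial>haar) = (\<integral>\<^sup>+\<xi>. ennreal (?h \<xi>) \<partial>haar)"
      by (intro nn_integral_cong) (simp add: indicator_def)
    also have "\<dots> = ennreal (LINT \<xi>|haar. ?h \<xi>)"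
      by (rule nn_integral_eq_integral[OF int]) simp
    also have "(LINT \<xi>|haar. ?h \<xi>) = cmod (LINT \<xi>|haar. complex_of_real (?h \<xi>))"
      by (simp add: integral_nonneg del: of_real_mult of_real_power)
    also have "(LINT \<xi>|haar. complex_of_real (?h \<xi>)) = (LINT x|haar. f x * cnj (ball_average N f x))"
      using truncated_parseval[OF f f, of N] unfolding eq .
    finally show ?thesis using ball_average_L2_bound[OF f, of N] by simp
  qed
  have "(SUP N. ?g N \<xi>) = ennreal ((cmod (padic_fourier_integral f \<xi>))\<^sup>2)" for \<xi>
  proof (rule antisym)
    obtain N where "\<xi> \<in> big_ball TYPE('p) N"
      using eventually_mem_big_ball[of \<xi>] unfolding eventually_sequentially by blast
    thus "ennreal ((cmod (padic_fourier_integral f \<xi>))\<^sup>2) \<le> (SUP N. ?g N \<xi>)"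
      by (intro SUP_upper2[of N]) auto
  qed (auto intro!: SUP_least simp: indicator_def)
  hence "(\<integral>\<^sup>+\<xi>. ennreal ((cmod (padic_fourier_integral f \<xi>))\<^sup>2) \<partial>haar) = (\<integral>\<^sup>+\<xi>. (SUP N. ?g N \<xi>) \<partial>haar)"
    by simp
  also have "\<dots> = (SUP N. \<integral>\<^sup>+\<xi>. ?g N \<xi> \<partial>haar)"
  proof (rule nn_integral_monotone_convergence_SUP)
    have "big_ball TYPE('p) N \<subseteq> big_ball TYPE('p) M" if "N \<le> M" for N M
      using that CARD_gt_1[where 'p='p] by (intro subset_cball power_increasing) auto
    thus "incseq ?g" by (auto simp: incseq_def le_fun_def indicator_def simp del: mem_cball)
  qed measurable
  also have "\<dots> \<le> (\<integral>\<^sup>+x. ennreal ((cmod (f x))\<^sup>2) \<partial>haar)"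
    by (intro SUP_least le)
  finally show ?thesis .
qed

section \<open>Convergence of ball averages in mean\<close>

text \<open>All integrable functions have this property; the name serves the proof of that by approximation.\<close>
definition ball_approximable :: "('p::prime_card padic \<Rightarrow> complex) \<Rightarrow> bool" where
  "ball_approximable f \<longleftrightarrow> integrable haar f \<and>
     (\<lambda>N. LINT x|haar. cmod (ball_average N f x - f x)) \<longlonglongrightarrow> 0"

lemma integrable_ball_mult:
  assumes "integrable haar f"
  shows "integrable haar (\<lambda>y. indicator (cball x r) y * (f y :: complex))"
  using integrable_mult_indicator[OF _ assms, of "cball x r"]
  by (simp add: scaleR_conv_of_real of_real_indicator)

lemma ball_average_add:
  assumes "integrable haar f" "integrable haar g"
  shows "ball_average N (\<lambda>x. f x + g x) x = ball_average N f x + ball_average N g x"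
  using assms by (simp add: ball_average_def distrib_left integrable_ball_mult)

lemma ball_average_mult: "ball_average N (\<lambda>x. c * f x) x = c * ball_average N f x"
  unfolding ball_average_def mult.left_commute[of _ c] integral_mult_right_zero ..

lemma integrable_cmod_ball_average_diff:
  "integrable haar f \<Longrightarrow> integrable haar (\<lambda>x. cmod (ball_average N f x - f x))"
  by (intro integrable_norm Bochner_Integration.integrable_diff ball_average_L1_contraction)

lemma ball_approximable_add:
  assumes f: "ball_approximable f" and g: "ball_approximable g"
  shows "ball_approximable (\<lambda>x. f x + g x)"
proof -
  have int: "integrable haar f" "integrable haar g" using f g by (auto simp: ball_approximable_def)
  let ?a = "\<lambda>f N. LINT x|haar. cmod (ball_average N f x - f x)"
  have "(\<lambda>N. ?a (\<lambda>x. f x + g x) N) \<longlonglongrightarrow> 0"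
  proof (rule tendsto_sandwich[OF _ _ tendsto_const])
    show "(\<lambda>N. ?a f N + ?a g N) \<longlonglongrightarrow> 0"
      using f g tendsto_add[of "?a f" 0 sequentially "?a g" 0] by (simp add: ball_approximable_def)
    show "\<forall>\<^sub>F N in sequentially. ?a (\<lambda>x. f x + g x) N \<le> ?a f N + ?a g N"
    proof (intro always_eventually allI)
      fix N
      have "?a (\<lambda>x. f x + g x) N \<le> (LINT x|haar. cmod (ball_average N f x - f x) + cmod (ball_average N g x - g x))"
      proof (rule integral_mono)
        fix x
        have "ball_average N (\<lambda>x. f x + g x) x - (f x + g x) = (ball_average N f x - f x) + (ball_average N g x - g x)"
          by (simp add: ball_average_add[OF int])
        thus "cmod (ball_average N (\<lambda>x. f x + g x) x - (f x + g x))
          \<le> cmod (ball_average N f x - f x) + cmod (ball_average N g x - g x)"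
          by (simp only: norm_triangle_ineq)
      qed (intro integrable_cmod_ball_average_diff Bochner_Integration.integrable_add int)+
      thus "?a (\<lambda>x. f x + g x) N \<le> ?a f N + ?a g N"
        by (simp add: int integrable_cmod_ball_average_diff)
    qed
  qed (simp add: integral_nonneg)
  thus ?thesis using int by (simp add: ball_approximable_def)
qed

lemma ball_approximable_mult:
  assumes f: "ball_approximable f"
  shows "ball_approximable (\<lambda>x. c * f x)"
proof -
  have "cmod (ball_average N (\<lambda>x. c * f x) x - c * f x) = cmod c * cmod (ball_average N f x - f x)" for N x
    unfolding ball_average_mult by (simp add: norm_mult[symmetric] right_diff_distrib)
  thus ?thesis using f by (auto simp: ball_approximable_def intro: tendsto_mult_right_zero)
qed

text \<open>Averaging is a contraction in mean, so the class is closed under limits in mean.\<close>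
lemma ball_approximable_limit:
  assumes s: "\<And>i. ball_approximable (s i)" and f: "integrable haar f"
    and lim: "(\<lambda>i :: nat. LINT x|haar. cmod (f x - s i x)) \<longlonglongrightarrow> 0"
  shows "ball_approximable f"
proof -
  let ?a = "\<lambda>f N. LINT x|haar. cmod (ball_average N f x - f x)"
  have int: "integrable haar (s i)" for i using s by (simp add: ball_approximable_def)
  have split: "?a f N \<le> 2 * (LINT x|haar. cmod (f x - s i x)) + ?a (s i) N" for N i
  proof -
    let ?d = "\<lambda>x. f x - s i x"
    have d: "integrable haar ?d" by (intro Bochner_Integration.integrable_diff f int)
    have "ball_average N (\<lambda>x. s i x + ?d x) x = ball_average N (s i) x + ball_average N ?d x" for x
      by (rule ball_average_add[OF int d])
    hence eq: "ball_average N f x - f x = ball_average N ?d x + (ball_average N (s i) x - s i x) - ?d x" for x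
      by simp
    have "?a f N \<le> (LINT x|haar. cmod (ball_average N ?d x) + cmod (ball_average N (s i) x - s i x) + cmod (?d x))"
    proof (rule integral_mono)
      fix x
      show "cmod (ball_average N f x - f x) \<le> cmod (ball_average N ?d x) + cmod (ball_average N (s i) x - s i x) + cmod (?d x)"
        unfolding eq by (rule order_trans[OF norm_triangle_ineq4]) (simp add: norm_triangle_ineq)
    qed (intro integrable_cmod_ball_average_diff Bochner_Integration.integrable_add integrable_norm
        ball_average_L1_contraction f d int)+
    also have "\<dots> = (LINT x|haar. cmod (ball_average N ?d x)) + ?a (s i) N + (LINT x|haar. cmod (?d x))"
      using d int[of i] by (simp add: integrable_cmod_ball_average_diff ball_average_L1_contraction(1) del: Bochner_Integration.integrable_diff)
    also have "(LINT x|haar. cmod (ball_average N ?d x)) \<le> (LINT x|haar. cmod (?d x))"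
      by (rule ball_average_L1_contraction(2)[OF d])
    finally show ?thesis by simp
  qed
  have "(?a f) \<longlonglongrightarrow> 0"
  proof (rule LIMSEQ_I)
    fix e :: real assume "e > 0"
    hence "\<forall>\<^sub>F i in sequentially. (LINT x|haar. cmod (f x - s i x)) < e / 4"
      using lim by (intro order_tendstoD) auto
    then obtain i where i: "(LINT x|haar. cmod (f x - s i x)) < e / 4"
      by (auto simp: eventually_sequentially)
    have "(?a (s i)) \<longlonglongrightarrow> 0" using s by (simp add: ball_approximable_def)
    hence "\<forall>\<^sub>F N in sequentially. ?a (s i) N < e / 2"
      using \<open>e > 0\<close> by (intro order_tendstoD) auto
    then obtain N0 where N0: "\<And>N. N \<ge> N0 \<Longrightarrow> ?a (s i) N < e / 2"
      by (auto simp: eventually_sequentially)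
    have "norm (?a f N - 0) < e" if "N \<ge> N0" for N
    proof -
      have "?a f N \<ge> 0" by (simp add: integral_nonneg)
      thus ?thesis using split[of N i] i N0[OF that] by simp
    qed
    thus "\<exists>N0. \<forall>N\<ge>N0. norm (?a f N - 0) < e" by blast
  qed
  thus ?thesis using f by (simp add: ball_approximable_def)
qed

lemma ball_approximable_dominated:
  assumes s: "\<And>i :: nat. ball_approximable (s i)" and f: "f \<in> borel_measurable haar" and w: "integrable haar w"
    and lim: "AE x in haar. (\<lambda>i. s i x) \<longlonglongrightarrow> f x" and dom: "\<And>i x. cmod (s i x) \<le> w x"
  shows "ball_approximable f"
proof (rule ball_approximable_limit[OF s])
  have int: "integrable haar (s i)" for i using s by (simp add: ball_approximable_def)
  show f': "integrable haar f"
    by (rule integrable_dominated_convergence[OF f _ w lim]) (use int dom in auto)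
  have "(\<lambda>i. LINT x|haar. cmod (f x - s i x)) \<longlonglongrightarrow> (LINT x|(haar :: 'a padic measure). 0)"
  proof (rule integral_dominated_convergence[where w = "\<lambda>x. cmod (f x) + w x"])
    show "AE x in haar. (\<lambda>i. cmod (f x - s i x)) \<longlonglongrightarrow> 0"
      using lim
    proof eventually_elim
      case (elim x)
      have "(\<lambda>i. cmod (f x - s i x)) \<longlonglongrightarrow> cmod (f x - f x)" by (intro tendsto_intros elim)
      thus ?case by simp
    qed
    show "AE x in haar. norm (cmod (f x - s i x)) \<le> cmod (f x) + w x" for i
      using norm_triangle_ineq4[of "f _" "s i _"] dom[of i]
      by (intro AE_I2) (metis abs_norm_cancel add_left_mono order_trans real_norm_def)
  qed (use f f' w int in auto)
  thus "(\<lambda>i. LINT x|haar. cmod (f x - s i x)) \<longlonglongrightarrow> 0" by simp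
qed

text \<open>Averages over balls of smaller radius reproduce the indicator exactly.\<close>
lemma ball_approximable_ball:
  fixes c :: "'p::prime_card padic"
  assumes m: "inverse (real CARD('p)) ^ m \<le> r" and fin: "emeasure haar (cball c r) < \<infinity>"
  shows "ball_approximable (indicator (cball c r))"
proof -
  have int: "integrable haar (indicator (cball c r) :: _ \<Rightarrow> complex)"
    using has_bochner_integral_complex_indicator[OF cball_sets_haar fin] by (rule integrable.intros)
  have eq: "ball_average N (indicator (cball c r)) x = indicator (cball c r) x" if "N \<ge> m" for N x
  proof -
    have le: "inverse (real CARD('p)) ^ N \<le> r"
      using that CARD_gt_1[where 'p='p] by (intro order_trans[OF power_decreasing m]) (auto simp: field_simps)
    have iff: "y \<in> cball c r \<longleftrightarrow> x \<in> cball c r" if "y \<in> padic_ball x N" for y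
    proof -
      have "padic_norm (y - x) \<le> r" using that le unfolding mem_cball_padic by simp
      hence "cball y r = cball x r" by (rule cball_padic_eq)
      moreover have "z \<in> cball c r \<longleftrightarrow> c \<in> cball z r" for z by (simp add: dist_commute)
      ultimately show ?thesis by blast
    qed
    have "(LINT y|haar. indicator (padic_ball x N) y * (indicator (cball c r) y :: complex))
        = (LINT y|haar. indicator (padic_ball x N) y * indicator (cball c r) x)"
    proof (intro Bochner_Integration.integral_cong refl)
      fix y
      show "indicator (padic_ball x N) y * (indicator (cball c r) y :: complex) = indicator (padic_ball x N) y * indicator (cball c r) x"
      proof (cases "y \<in> padic_ball x N")
        case True
        show ?thesis using iff[OF True] by (simp only: indicator_def)
      qed (simp del: mem_cball)
    qed
    also have "\<dots> = (LINT y|haar. indicator (padic_ball x N) y) * indicator (cball c r) x"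
      by (rule integral_mult_left_zero)
    also have "(LINT y|haar. indicator (padic_ball x N) y :: complex) = of_real (inverse (real CARD('p)) ^ N)"
      using has_bochner_integral_integral_eq[OF has_bochner_integral_complex_indicator[of "padic_ball x N" haar]]
      by (simp add: emeasure_haar_ball measure_def del: mem_cball)
    finally show ?thesis by (simp add: ball_average_def power_inverse)
  qed
  have "(\<lambda>N. LINT x|haar. cmod (ball_average N (indicator (cball c r)) x - indicator (cball c r) x)) \<longlonglongrightarrow> 0"
    by (rule tendsto_eventually) (auto simp: eventually_sequentially eq intro!: exI[of _ m])
  thus ?thesis using int by (simp add: ball_approximable_def)
qed

lemma ball_approximable_big_ball: "ball_approximable (indicator (big_ball TYPE('p::prime_card) R))"
proof (rule ball_approximable_ball[of 0])
  show "inverse (real CARD('p)) ^ 0 \<le> real CARD('p) ^ R"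
    using CARD_gt_1[where 'p='p] by simp
qed (simp add: emeasure_big_ball)

text \<open>Balls are an intersection-stable generator, and the sets with the property form a Dynkin system.
  Cutting off at a big ball keeps all indicators, in particular those of complements, integrable.\<close>
lemma ball_approximable_borel:
  fixes E :: "'p::prime_card padic set"
  assumes "E \<in> sets borel"
  shows "ball_approximable (indicator (E \<inter> big_ball TYPE('p) R))"
proof -
  let ?K = "big_ball TYPE('p) R" and ?q = "inverse (real CARD('p))"
  have zero: "ball_approximable (\<lambda>_ :: 'p padic. 0)"
    using ball_approximable_mult[OF ball_approximable_big_ball, of 0] by simp
  have "padic_balls \<subseteq> Pow (UNIV :: 'p padic set)" by simp
  with Int_stable_padic_balls show ?thesis using assms unfolding borel_eq_padic_balls
  proof (induction rule: sigma_sets_induct_disjoint)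
    case (basic B)
    show ?case
    proof (cases "B \<inter> ?K = {}")
      case True
      thus ?thesis using zero by (simp add: indicator_def)
    next
      case False
      then obtain c n x where B: "B = padic_ball c n" and x: "x \<in> B" "x \<in> ?K"
        using basic unfolding padic_balls_def by blast
      have Bx: "B = padic_ball x n"
        using x(1) unfolding B mem_cball_padic by (intro cball_padic_eq) (simp add: padic_norm_diff_commute)
      have "?K = cball x (real CARD('p) ^ R)"
        using x(2) unfolding mem_cball_padic by (intro cball_padic_eq) (simp add: padic_norm_diff_commute)
      moreover have "?q ^ n \<le> real CARD('p) ^ R"
      proof -
        have "?q ^ n \<le> 1" "1 \<le> real CARD('p) ^ R"
          using CARD_gt_1[where 'p='p] by (auto intro!: power_le_one simp: field_simps)
        thus ?thesis by linarith
      qed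
      ultimately have "B \<subseteq> ?K" unfolding Bx by (simp add: subset_cball)
      hence "B \<inter> ?K = padic_ball x n" using Bx by blast
      moreover have "ball_approximable (indicator (padic_ball x n))"
        by (rule ball_approximable_ball[of n]) (simp_all add: emeasure_haar_ball)
      ultimately show ?thesis by metis
    qed
  next
    case empty
    show ?case using zero by (simp add: indicator_def)
  next
    case (compl A)
    have "indicator ((UNIV - A) \<inter> ?K) = (\<lambda>x. indicator ?K x + (- 1 :: complex) * indicator (A \<inter> ?K) x)"
      by (auto simp: indicator_def fun_eq_iff)
    thus ?case using ball_approximable_add[OF ball_approximable_big_ball ball_approximable_mult[OF compl.IH, of "- 1"]]
      by simp
  next
    case (union A)
    have fin: "ball_approximable (indicator ((\<Union>i<n. A i) \<inter> ?K))" for n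
    proof (induction n)
      case 0
      show ?case using zero by (simp add: indicator_def)
    next
      case (Suc n)
      have "A i \<inter> A n = {}" if "i < n" for i
        using union.hyps(1) that by (auto simp: disjoint_family_on_def)
      hence "indicator ((\<Union>i<Suc n. A i) \<inter> ?K)
          = (\<lambda>x. indicator ((\<Union>i<n. A i) \<inter> ?K) x + indicator (A n \<inter> ?K) x :: complex)"
        by (fastforce simp: indicator_def fun_eq_iff less_Suc_eq)
      thus ?case using ball_approximable_add[OF Suc union.IH[of n]] by simp
    qed
    show ?case
    proof (rule ball_approximable_dominated[OF fin])
      have "A i \<in> sets haar" for i
        using union.hyps(2) by (intro borel_sets_haar) (auto simp: borel_eq_padic_balls)
      thus "indicator ((\<Union>i. A i) \<inter> ?K) \<in> borel_measurable haar" by auto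
      show "integrable haar (\<lambda>x. cmod (indicator ?K x))"
        by (rule integrable_norm[OF integrable_indicator_big_ball])
      show "AE x in haar. (\<lambda>i. indicator ((\<Union>i<i. A i) \<inter> ?K) x) \<longlonglongrightarrow> (indicator ((\<Union>i. A i) \<inter> ?K) x :: complex)"
        unfolding indicator_inter_arith by (intro AE_I2 tendsto_intros LIMSEQ_indicator_UN)
    qed (auto simp: indicator_def)
  qed
qed

lemma ball_approximable_set:
  fixes A :: "'p::prime_card padic set"
  assumes A: "A \<in> sets haar" "emeasure haar A < \<infinity>"
  shows "ball_approximable (indicator A)"
proof -
  define B where "B = main_part padic_haar A"
  have A': "A \<in> sets (completion padic_haar)" using A by (simp add: haar_def)
  have B: "B \<in> sets borel" unfolding B_def using main_part_sets[OF A'] by (simp add: sets_padic_haar)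
  have BA: "B \<subseteq> A" using main_part_null_part_Un[OF A'] by (auto simp: B_def)
  have "AE x in padic_haar. x \<notin> null_part padic_haar A" by (rule AE_notin_null_part[OF A'])
  hence ae: "AE x in haar. x \<in> B \<longleftrightarrow> x \<in> A"
    unfolding haar_def
  proof (rule AE_mp[OF AE_completion], intro AE_I2 impI)
    fix x assume "x \<notin> null_part padic_haar A"
    thus "x \<in> B \<longleftrightarrow> x \<in> A" using main_part_null_part_Un[OF A'] by (auto simp: B_def)
  qed
  show ?thesis
  proof (rule ball_approximable_dominated[OF ball_approximable_borel[OF B]])
    show "integrable haar (\<lambda>x. indicator A x :: real)" using A by simp
    show "AE x in haar. (\<lambda>i. indicator (B \<inter> big_ball TYPE('p) i) x) \<longlonglongrightarrow> (indicator A x :: complex)"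
      using ae
    proof eventually_elim
      case (elim x)
      show ?case
        by (rule tendsto_eventually, rule eventually_mono[OF eventually_mem_big_ball[of x]])
           (use elim in \<open>simp add: indicator_def del: mem_cball\<close>)
    qed
  qed (use A BA in \<open>auto simp: indicator_def\<close>)
qed

text \<open>Lebesgue's differentiation theorem in its mean form.\<close>
lemma integrable_imp_ball_approximable:
  fixes f :: "'p::prime_card padic \<Rightarrow> complex"
  assumes "integrable haar f"
  shows "ball_approximable f"
  using assms
proof (induction rule: integrable_induct)
  case (base A c)
  have "(\<lambda>x. indicator A x *\<^sub>R c) = (\<lambda>x. c * indicator A x)"
    by (simp add: scaleR_conv_of_real of_real_indicator mult.commute)
  thus ?case using ball_approximable_mult[OF ball_approximable_set[OF base]] by simp
next
  case (add f g)
  thus ?case by (simp add: ball_approximable_add)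
next
  case (lim f s)
  show ?case
    by (rule ball_approximable_dominated[of s f "\<lambda>x. 2 * cmod (f x)"]) (use lim in auto)
qed

section \<open>Plancherel's theorem for integrable functions\<close>

lemma padic_L2_iff_nn:
  "f \<in> padic_L2 \<longleftrightarrow> f \<in> borel_measurable haar \<and> (\<integral>\<^sup>+x. ennreal ((cmod (f x))\<^sup>2) \<partial>haar) < \<infinity>"
  by (auto simp: padic_L2_def integrable_iff_bounded)

lemma nn_integral_padic_L2:
  "f \<in> padic_L2 \<Longrightarrow> (\<integral>\<^sup>+x. ennreal ((cmod (f x))\<^sup>2) \<partial>haar) = ennreal (LINT x|haar. (cmod (f x))\<^sup>2)"
  by (rule nn_integral_eq_integral) (auto simp: padic_L2_def)

lemma fourier_L2:
  assumes "integrable haar f" "f \<in> padic_L2"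
  shows "padic_fourier_integral f \<in> padic_L2"
    and "(LINT \<xi>|haar. (cmod (padic_fourier_integral f \<xi>))\<^sup>2) \<le> (LINT x|haar. (cmod (f x))\<^sup>2)"
proof -
  note le = fourier_bessel[OF assms(1)]
  show L2: "padic_fourier_integral f \<in> padic_L2"
    using le assms by (auto simp: padic_L2_iff_nn)
  have "0 \<le> (LINT x|haar. (cmod (f x))\<^sup>2)" by (simp add: integral_nonneg)
  thus "(LINT \<xi>|haar. (cmod (padic_fourier_integral f \<xi>))\<^sup>2) \<le> (LINT x|haar. (cmod (f x))\<^sup>2)"
    using le unfolding nn_integral_padic_L2[OF L2] nn_integral_padic_L2[OF assms(2)] by simp
qed

lemma integrable_L2_mult:
  assumes "f \<in> padic_L2" "g \<in> padic_L2"
  shows "integrable haar (\<lambda>x. f x * g x)"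
proof (rule Bochner_Integration.integrable_bound)
  show "integrable haar (\<lambda>x. (cmod (f x))\<^sup>2 + (cmod (g x))\<^sup>2)"
    using assms by (auto simp: padic_L2_def)
  have "cmod (f x * g x) \<le> (cmod (f x))\<^sup>2 + (cmod (g x))\<^sup>2" for x
  proof -
    have "0 \<le> cmod (f x) * cmod (g x)" by simp
    thus ?thesis using sum_squares_bound[of "cmod (f x)" "cmod (g x)"] unfolding norm_mult by linarith
  qed
  thus "AE x in haar. cmod (f x * g x) \<le> norm ((cmod (f x))\<^sup>2 + (cmod (g x))\<^sup>2)" by simp
qed (use assms in \<open>auto simp: padic_L2_def\<close>)

lemma padic_L2_cnj: "f \<in> padic_L2 \<Longrightarrow> (\<lambda>x. cnj (f x)) \<in> padic_L2"
  by (auto simp: padic_L2_def)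

text \<open>The hypotheses say that \<open>s\<close> is \<open>f\<close> cut off to a set on which it is bounded. Put \<open>a = \<parallel>s\<parallel>\<^sup>2\<close> and \<open>b\<close> for the
  squared norm of the transform of \<open>f\<close>. As \<open>s\<close> is bounded and the averages of \<open>f\<close> converge in mean,
  the inner products of \<open>s\<close> with the averages of \<open>f\<close> tend to \<open>a\<close>. On the frequency side they are at most
  \<open>(a + b) / 2\<close> by Bessel's inequality for \<open>s\<close>, and \<open>a \<le> (a + b) / 2\<close> gives \<open>a \<le> b\<close>.\<close>
lemma fourier_plancherel_bounded:
  fixes f s :: "'p::prime_card padic \<Rightarrow> complex"
  assumes f: "integrable haar f" "f \<in> padic_L2" and s: "integrable haar s" "s \<in> padic_L2"
    and bdd: "\<And>x. cmod (s x) \<le> B" and sf: "\<And>x. s x * cnj (f x) = of_real ((cmod (s x))\<^sup>2)"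
  shows "(LINT x|haar. (cmod (s x))\<^sup>2) \<le> (LINT \<xi>|haar. (cmod (padic_fourier_integral f \<xi>))\<^sup>2)"
proof -
  let ?F = "padic_fourier_integral f" and ?S = "padic_fourier_integral s"
  let ?a = "LINT x|haar. (cmod (s x))\<^sup>2" and ?b = "LINT \<xi>|haar. (cmod (?F \<xi>))\<^sup>2"
  let ?c = "\<lambda>N. LINT x|haar. s x * cnj (ball_average N f x)"
  have [measurable]: "f \<in> borel_measurable haar" "s \<in> borel_measurable haar" using f s by auto
  \<comment> \<open>The bound holds at every point, in particular at an arbitrary one.\<close>
  have B0: "B \<ge> 0" using bdd[of undefined] norm_ge_zero order_trans by blast
  have int1: "integrable haar (\<lambda>x. s x * cnj (g x))" if "integrable haar g" for g
  proof (rule Bochner_Integration.integrable_bound)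
    show "integrable haar (\<lambda>x. B * cmod (g x))" using that by simp
    have "g \<in> borel_measurable haar" using that by auto
    thus "(\<lambda>x. s x * cnj (g x)) \<in> borel_measurable haar" by measurable
  qed (use bdd B0 in \<open>auto simp: norm_mult intro!: mult_right_mono\<close>)
  have approx: "(\<lambda>N. LINT x|haar. cmod (ball_average N f x - f x)) \<longlonglongrightarrow> 0"
    using integrable_imp_ball_approximable[OF f(1)] by (simp add: ball_approximable_def)
  have "?c \<longlonglongrightarrow> of_real ?a"
  proof (rule LIM_zero_cancel, rule tendsto_norm_zero_cancel, rule tendsto_sandwich[OF _ _ tendsto_const])
    show "(\<lambda>N. B * (LINT x|haar. cmod (ball_average N f x - f x))) \<longlonglongrightarrow> 0"
      using tendsto_mult_right_zero[OF approx] .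
    show "\<forall>\<^sub>F N in sequentially. cmod (?c N - of_real ?a) \<le> B * (LINT x|haar. cmod (ball_average N f x - f x))"
    proof (intro always_eventually allI)
      fix N
      have d: "integrable haar (\<lambda>x. ball_average N f x - f x)"
        by (intro Bochner_Integration.integrable_diff ball_average_L1_contraction f)
      have "of_real ?a = (LINT x|haar. s x * cnj (f x))" unfolding sf by (simp del: of_real_power)
      hence "?c N - of_real ?a = (LINT x|haar. s x * cnj (ball_average N f x) - s x * cnj (f x))"
        using int1[OF f(1)] int1[OF ball_average_L1_contraction(1)[OF f(1)]] by simp
      also have "\<dots> = (LINT x|haar. s x * cnj (ball_average N f x - f x))"
        by (simp add: algebra_simps)
      also have "cmod \<dots> \<le> (LINT x|haar. B * cmod (ball_average N f x - f x))"
      proof (rule order_trans[OF integral_norm_bound integral_mono])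
        show "cmod (s x * cnj (ball_average N f x - f x)) \<le> B * cmod (ball_average N f x - f x)" for x
          unfolding norm_mult complex_mod_cnj using bdd by (rule mult_right_mono) simp
      qed (intro integrable_norm int1 d integrable_mult_right)+
      finally show "cmod (?c N - of_real ?a) \<le> B * (LINT x|haar. cmod (ball_average N f x - f x))" by simp
    qed
  qed auto
  hence "(\<lambda>N. cmod (?c N)) \<longlonglongrightarrow> cmod (of_real ?a)" by (rule tendsto_norm)
  moreover have "cmod (?c N) \<le> (?a + ?b) / 2" for N
  proof -
    let ?h = "\<lambda>\<xi>. indicator (big_ball TYPE('p) N) \<xi> * (?S \<xi> * cnj (?F \<xi>))"
    have SF: "?S \<in> padic_L2" "?F \<in> padic_L2" using fourier_L2 s f by blast+
    hence SFi: "integrable haar (\<lambda>\<xi>. ((cmod (?S \<xi>))\<^sup>2 + (cmod (?F \<xi>))\<^sup>2) / 2)" by (auto simp: padic_L2_def)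
    have int: "integrable haar ?h"
      using integrable_mult_indicator[OF _ integrable_L2_mult[OF SF(1) padic_L2_cnj[OF SF(2)]], of "big_ball TYPE('p) N"]
      by (simp add: scaleR_conv_of_real of_real_indicator)
    have "?c N = (LINT \<xi>|haar. ?h \<xi>)" by (rule truncated_parseval[OF s(1) f(1), symmetric])
    also have "cmod \<dots> \<le> (LINT \<xi>|haar. ((cmod (?S \<xi>))\<^sup>2 + (cmod (?F \<xi>))\<^sup>2) / 2)"
    proof (rule order_trans[OF integral_norm_bound integral_mono[OF integrable_norm[OF int] SFi]])
      fix \<xi>
      have "cmod (?h \<xi>) \<le> cmod (?S \<xi>) * cmod (?F \<xi>)"
        by (simp add: norm_mult indicator_def)
      also have "\<dots> \<le> ((cmod (?S \<xi>))\<^sup>2 + (cmod (?F \<xi>))\<^sup>2) / 2"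
        using sum_squares_bound[of "cmod (?S \<xi>)" "cmod (?F \<xi>)"] by simp
      finally show "cmod (?h \<xi>) \<le> ((cmod (?S \<xi>))\<^sup>2 + (cmod (?F \<xi>))\<^sup>2) / 2" .
    qed
    also have "\<dots> = ((LINT \<xi>|haar. (cmod (?S \<xi>))\<^sup>2) + ?b) / 2"
      using SF by (simp add: padic_L2_def)
    also have "\<dots> \<le> (?a + ?b) / 2" using fourier_L2(2)[OF s] by simp
    finally show ?thesis .
  qed
  ultimately have "cmod (of_real ?a) \<le> (?a + ?b) / 2"
    by (intro tendsto_upperbound[of "\<lambda>N. cmod (?c N)" _ sequentially]) auto
  moreover have "?a \<ge> 0" by (simp add: integral_nonneg)
  ultimately show ?thesis by simp
qed

text \<open>One inequality is Bessel's. For the other, \<open>f\<close> is cut off where it exceeds \<open>m\<close>, and \<open>m\<close> tends to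
  infinity.\<close>
theorem fourier_plancherel:
  fixes f :: "'p::prime_card padic \<Rightarrow> complex"
  assumes f: "integrable haar f" "f \<in> padic_L2"
  shows "padic_L2_norm (padic_fourier_integral f) = padic_L2_norm f"
proof -
  let ?b = "LINT \<xi>|haar. (cmod (padic_fourier_integral f \<xi>))\<^sup>2"
  define s where "s m x = (if cmod (f x) \<le> real m then f x else 0)" for m :: nat and x
  have [measurable]: "f \<in> borel_measurable haar" using f by auto
  have [measurable]: "s m \<in> borel_measurable haar" for m unfolding s_def[abs_def] by measurable
  have fi: "integrable haar (\<lambda>x. (cmod (f x))\<^sup>2)" using f by (simp add: padic_L2_def)
  have le: "(LINT x|haar. (cmod (s m x))\<^sup>2) \<le> ?b" for m
  proof (rule fourier_plancherel_bounded[OF f])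
    show "integrable haar (s m)"
      by (rule Bochner_Integration.integrable_bound[OF f(1)]) (auto simp: s_def)
    have "integrable haar (\<lambda>x. (cmod (s m x))\<^sup>2)"
      by (rule Bochner_Integration.integrable_bound[OF fi]) (auto simp: s_def)
    thus "s m \<in> padic_L2" by (simp add: padic_L2_def)
    show "cmod (s m x) \<le> real m" for x by (simp add: s_def)
    show "s m x * cnj (f x) = of_real ((cmod (s m x))\<^sup>2)" for x
      by (simp add: s_def complex_norm_square del: of_real_power)
  qed
  have "(\<lambda>m. LINT x|haar. (cmod (s m x))\<^sup>2) \<longlonglongrightarrow> (LINT x|haar. (cmod (f x))\<^sup>2)"
  proof (rule integral_dominated_convergence[where w = "\<lambda>x. (cmod (f x))\<^sup>2"])
    show "AE x in haar. (\<lambda>m. (cmod (s m x))\<^sup>2) \<longlonglongrightarrow> (cmod (f x))\<^sup>2"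
    proof (intro AE_I2 tendsto_eventually)
      fix x
      obtain n where n: "cmod (f x) \<le> real n" using real_arch_simple by blast
      show "\<forall>\<^sub>F m in sequentially. (cmod (s m x))\<^sup>2 = (cmod (f x))\<^sup>2"
        by (rule eventually_sequentiallyI[of n]) (use n in \<open>simp add: s_def\<close>)
    qed
  qed (use fi in \<open>auto simp: s_def\<close>)
  hence "(LINT x|haar. (cmod (f x))\<^sup>2) \<le> ?b"
    by (rule tendsto_upperbound) (use le in auto)
  thus ?thesis using fourier_L2(2)[OF f] unfolding padic_L2_norm_def by simp
qed

section \<open>The Fourier transform on square-integrable functions\<close>

lemma padic_L2_norm_nonneg [simp]: "padic_L2_norm f \<ge> 0"
  by (simp add: padic_L2_norm_def integral_nonneg)

lemma padic_L2_norm_power2: "(padic_L2_norm f)\<^sup>2 = (LINT x|haar. (cmod (f x))\<^sup>2)"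
  by (simp add: padic_L2_norm_def integral_nonneg)

lemma padic_L2_mult: "f \<in> padic_L2 \<Longrightarrow> (\<lambda>x. c * f x) \<in> padic_L2"
  by (auto simp: padic_L2_def norm_mult power_mult_distrib)

text \<open>A substitute for the Cauchy--Schwarz inequality: integrated and optimized over \<open>t\<close>, it yields the
  triangle inequality for the norm.\<close>
lemma norm_add_power2_le:
  assumes "t > 0"
  shows "(cmod (a + b))\<^sup>2 \<le> (1 + t) * (cmod a)\<^sup>2 + (1 + 1 / t) * (cmod b)\<^sup>2"
proof -
  have "(cmod (a + b))\<^sup>2 \<le> (cmod a + cmod b)\<^sup>2"
    by (intro power_mono norm_triangle_ineq) simp
  also have "\<dots> \<le> (1 + t) * (cmod a)\<^sup>2 + (1 + 1 / t) * (cmod b)\<^sup>2"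
  proof -
    have "0 \<le> (t * cmod a - cmod b)\<^sup>2 / t" using assms by simp
    thus ?thesis using assms by (simp add: field_simps power2_eq_square)
  qed
  finally show ?thesis .
qed

lemma padic_L2_add:
  assumes "f \<in> padic_L2" "g \<in> padic_L2"
  shows "(\<lambda>x. f x + g x) \<in> padic_L2"
proof -
  have "integrable haar (\<lambda>x. (cmod (f x + g x))\<^sup>2)"
  proof (rule Bochner_Integration.integrable_bound)
    show "integrable haar (\<lambda>x. 2 * (cmod (f x))\<^sup>2 + 2 * (cmod (g x))\<^sup>2)"
      using assms by (auto simp: padic_L2_def)
    show "AE x in haar. norm ((cmod (f x + g x))\<^sup>2) \<le> norm (2 * (cmod (f x))\<^sup>2 + 2 * (cmod (g x))\<^sup>2)"
      using norm_add_power2_le[of 1] by simp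
  qed (use assms in \<open>auto simp: padic_L2_def\<close>)
  thus ?thesis using assms by (auto simp: padic_L2_def)
qed

lemma padic_L2_diff:
  "f \<in> padic_L2 \<Longrightarrow> g \<in> padic_L2 \<Longrightarrow> (\<lambda>x. f x - g x) \<in> padic_L2"
  using padic_L2_add[of f "\<lambda>x. - 1 * g x"] padic_L2_mult[of g "- 1"] by simp

text \<open>The optimal choice in the preceding inequality is \<open>t = \<parallel>g\<parallel> / \<parallel>f\<parallel>\<close>; both norms are enlarged by
  \<open>e / 2\<close> so that the quotient is meaningful.\<close>
lemma padic_L2_norm_triangle:
  assumes f: "f \<in> padic_L2" and g: "g \<in> padic_L2"
  shows "padic_L2_norm (\<lambda>x. f x + g x) \<le> padic_L2_norm f + padic_L2_norm g"
proof (rule field_le_epsilon)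
  fix e :: real assume "e > 0"
  define a b where "a = padic_L2_norm f + e / 2" and "b = padic_L2_norm g + e / 2"
  have ab: "a > 0" "b > 0" using \<open>e > 0\<close> by (auto simp: a_def b_def intro: add_nonneg_pos)
  have le: "(padic_L2_norm f)\<^sup>2 \<le> a\<^sup>2" "(padic_L2_norm g)\<^sup>2 \<le> b\<^sup>2"
    using \<open>e > 0\<close> by (auto simp: a_def b_def intro!: power_mono)
  have int: "integrable haar (\<lambda>x. (cmod (f x))\<^sup>2)" "integrable haar (\<lambda>x. (cmod (g x))\<^sup>2)"
    using f g by (auto simp: padic_L2_def)
  have "(padic_L2_norm (\<lambda>x. f x + g x))\<^sup>2 \<le> (LINT x|haar. (1 + b / a) * (cmod (f x))\<^sup>2 + (1 + 1 / (b / a)) * (cmod (g x))\<^sup>2)"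
    unfolding padic_L2_norm_power2
    by (rule integral_mono)
       (use padic_L2_add[OF f g] int ab norm_add_power2_le[of "b / a"] in \<open>auto simp: padic_L2_def\<close>)
  also have "\<dots> = (1 + b / a) * (padic_L2_norm f)\<^sup>2 + (1 + 1 / (b / a)) * (padic_L2_norm g)\<^sup>2"
    using int by (simp add: padic_L2_norm_power2)
  also have "\<dots> \<le> (1 + b / a) * a\<^sup>2 + (1 + 1 / (b / a)) * b\<^sup>2"
    using ab by (intro add_mono mult_left_mono le) auto
  also have "\<dots> = (a + b)\<^sup>2"
    using ab by (simp add: field_simps power2_eq_square)
  finally have "padic_L2_norm (\<lambda>x. f x + g x) \<le> a + b"
    by (rule power2_le_imp_le) (use ab in simp)
  thus "padic_L2_norm (\<lambda>x. f x + g x) \<le> padic_L2_norm f + padic_L2_norm g + e"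
    by (simp add: a_def b_def)
qed

lemma padic_L2_norm_diff_commute: "padic_L2_norm (\<lambda>x. f x - g x) = padic_L2_norm (\<lambda>x. g x - f x)"
  by (simp add: padic_L2_norm_def norm_minus_commute)

lemma padic_L2_norm_tendsto:
  assumes h: "\<And>k. h k \<in> padic_L2" and f: "f \<in> padic_L2"
    and lim: "(\<lambda>k. padic_L2_norm (\<lambda>x. h k x - f x)) \<longlonglongrightarrow> 0"
  shows "(\<lambda>k. padic_L2_norm (h k)) \<longlonglongrightarrow> padic_L2_norm f"
proof (rule LIM_zero_cancel, rule tendsto_rabs_zero_cancel, rule tendsto_sandwich[OF _ _ tendsto_const lim])
  show "\<forall>\<^sub>F k in sequentially. \<bar>padic_L2_norm (h k) - padic_L2_norm f\<bar> \<le> padic_L2_norm (\<lambda>x. h k x - f x)"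
  proof (intro always_eventually allI)
    fix k
    show "\<bar>padic_L2_norm (h k) - padic_L2_norm f\<bar> \<le> padic_L2_norm (\<lambda>x. h k x - f x)"
      using padic_L2_norm_triangle[OF f padic_L2_diff[OF h f], of k]
        padic_L2_norm_triangle[OF h padic_L2_diff[OF f h], of k k] padic_L2_norm_diff_commute[of f "h k"]
      by simp
  qed
qed auto

text \<open>Plancherel's theorem passes to the closure of the graph because the norm is continuous.\<close>
lemma is_fourier_transform_isometry:
  assumes "is_fourier_transform f g"
  shows "padic_L2_norm g = padic_L2_norm f"
proof -
  obtain h where f: "f \<in> padic_L2" and g: "g \<in> padic_L2"
    and h: "\<And>k :: nat. integrable haar (h k)" "\<And>k. h k \<in> padic_L2" "\<And>k. padic_fourier_integral (h k) \<in> padic_L2"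
    and lim: "(\<lambda>k. padic_L2_norm (\<lambda>x. h k x - f x)) \<longlonglongrightarrow> 0"
      "(\<lambda>k. padic_L2_norm (\<lambda>\<xi>. padic_fourier_integral (h k) \<xi> - g \<xi>)) \<longlonglongrightarrow> 0"
    using assms unfolding is_fourier_transform_def by blast
  have "(\<lambda>k. padic_L2_norm (h k)) \<longlonglongrightarrow> padic_L2_norm g"
    using padic_L2_norm_tendsto[OF h(3) g lim(2)] unfolding fourier_plancherel[OF h(1,2)] .
  with padic_L2_norm_tendsto[OF h(2) f lim(1)] show ?thesis using LIMSEQ_unique by blast
qed

lemma is_fourier_transform_add:
  assumes "is_fourier_transform f g" "is_fourier_transform f' g'"
  shows "is_fourier_transform (\<lambda>x. f x + f' x) (\<lambda>\<xi>. g \<xi> + g' \<xi>)"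
proof -
  obtain h where f: "f \<in> padic_L2" and g: "g \<in> padic_L2"
    and h: "\<And>k :: nat. integrable haar (h k)" "\<And>k. h k \<in> padic_L2" "\<And>k. padic_fourier_integral (h k) \<in> padic_L2"
    and lim: "(\<lambda>k. padic_L2_norm (\<lambda>x. h k x - f x)) \<longlonglongrightarrow> 0"
      "(\<lambda>k. padic_L2_norm (\<lambda>\<xi>. padic_fourier_integral (h k) \<xi> - g \<xi>)) \<longlonglongrightarrow> 0"
    using assms(1) unfolding is_fourier_transform_def by blast
  obtain h' where f': "f' \<in> padic_L2" and g': "g' \<in> padic_L2"
    and h': "\<And>k :: nat. integrable haar (h' k)" "\<And>k. h' k \<in> padic_L2" "\<And>k. padic_fourier_integral (h' k) \<in> padic_L2"
    and lim': "(\<lambda>k. padic_L2_norm (\<lambda>x. h' k x - f' x)) \<longlonglongrightarrow> 0"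
      "(\<lambda>k. padic_L2_norm (\<lambda>\<xi>. padic_fourier_integral (h' k) \<xi> - g' \<xi>)) \<longlonglongrightarrow> 0"
    using assms(2) unfolding is_fourier_transform_def by blast
  have F: "padic_fourier_integral (\<lambda>x. h k x + h' k x) = (\<lambda>\<xi>. padic_fourier_integral (h k) \<xi> + padic_fourier_integral (h' k) \<xi>)" for k
    by (simp add: padic_fourier_integral_def[abs_def] distrib_left integrable_char_mult h h')
  have conv: "(\<lambda>k. padic_L2_norm (\<lambda>x. (u k x + u' k x) - (v x + v' x))) \<longlonglongrightarrow> 0"
    if u: "\<And>k. u k \<in> padic_L2" "\<And>k. u' k \<in> padic_L2" and v: "v \<in> padic_L2" "v' \<in> padic_L2"
      and l: "(\<lambda>k. padic_L2_norm (\<lambda>x. u k x - v x)) \<longlonglongrightarrow> 0" "(\<lambda>k. padic_L2_norm (\<lambda>x. u' k x - v' x)) \<longlonglongrightarrow> 0"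
    for u u' :: "nat \<Rightarrow> 'a padic \<Rightarrow> complex" and v v'
  proof (rule tendsto_sandwich[OF _ _ tendsto_const])
    show "(\<lambda>k. padic_L2_norm (\<lambda>x. u k x - v x) + padic_L2_norm (\<lambda>x. u' k x - v' x)) \<longlonglongrightarrow> 0"
      using tendsto_add[OF l] by simp
    show "\<forall>\<^sub>F k in sequentially. padic_L2_norm (\<lambda>x. (u k x + u' k x) - (v x + v' x))
        \<le> padic_L2_norm (\<lambda>x. u k x - v x) + padic_L2_norm (\<lambda>x. u' k x - v' x)"
      using padic_L2_norm_triangle[OF padic_L2_diff[OF u(1) v(1)] padic_L2_diff[OF u(2) v(2)]]
      by (intro always_eventually allI) (simp add: algebra_simps)
  qed simp
  show ?thesis
    unfolding is_fourier_transform_def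
  proof (intro conjI exI[of _ "\<lambda>k x. h k x + h' k x"] allI)
    show "(\<lambda>k. padic_L2_norm (\<lambda>x. h k x + h' k x - (f x + f' x))) \<longlonglongrightarrow> 0"
      by (rule conv[OF h(2) h'(2) f f' lim(1) lim'(1)])
    show "(\<lambda>k. padic_L2_norm (\<lambda>\<xi>. padic_fourier_integral (\<lambda>x. h k x + h' k x) \<xi> - (g \<xi> + g' \<xi>))) \<longlonglongrightarrow> 0"
      unfolding F by (rule conv[OF h(3) h'(3) g g' lim(2) lim'(2)])
    show "padic_fourier_integral (\<lambda>x. h k x + h' k x) \<in> padic_L2" for k
      unfolding F by (rule padic_L2_add[OF h(3) h'(3)])
  qed (intro padic_L2_add f f' g g' h h' Bochner_Integration.integrable_add)+
qed

lemma padic_L2_norm_add_power2: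
  assumes f: "f \<in> padic_L2" and g: "g \<in> padic_L2"
  shows "(padic_L2_norm (\<lambda>x. f x + g x))\<^sup>2 = (padic_L2_norm f)\<^sup>2 + (padic_L2_norm g)\<^sup>2 + 2 * Re (padic_L2_inner f g)"
proof -
  have int: "integrable haar (\<lambda>x. f x * cnj (g x))" by (rule integrable_L2_mult[OF f padic_L2_cnj[OF g]])
  have eq: "(cmod (a + b))\<^sup>2 = (cmod a)\<^sup>2 + (cmod b)\<^sup>2 + 2 * Re (a * cnj b)" for a b
    unfolding cmod_power2 by (simp add: power2_eq_square algebra_simps)
  have "(padic_L2_norm (\<lambda>x. f x + g x))\<^sup>2 = (LINT x|haar. (cmod (f x))\<^sup>2 + (cmod (g x))\<^sup>2 + 2 * Re (f x * cnj (g x)))"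
    unfolding padic_L2_norm_power2 eq ..
  also have "\<dots> = (LINT x|haar. (cmod (f x))\<^sup>2) + (LINT x|haar. (cmod (g x))\<^sup>2) + 2 * (LINT x|haar. Re (f x * cnj (g x)))"
    using f g integrable_Re[OF int] by (simp add: padic_L2_def del: times_complex.sel)
  also have "(LINT x|haar. Re (f x * cnj (g x))) = Re (padic_L2_inner f g)"
    unfolding padic_L2_inner_def by (rule integral_Re[OF int])
  finally show ?thesis by (simp add: padic_L2_norm_power2)
qed

text \<open>Polarization of the isometry. Only the real part is recovered from the norm of a sum, and the
  inner products of indicators considered below are real.\<close>
lemma is_fourier_transform_parseval:
  assumes "is_fourier_transform f g" "is_fourier_transform f' g'"
  shows "Re (padic_L2_inner g g') = Re (padic_L2_inner f f')"
proof -
  have L2: "f \<in> padic_L2" "g \<in> padic_L2" "f' \<in> padic_L2" "g' \<in> padic_L2"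
    using assms by (auto simp: is_fourier_transform_def)
  show ?thesis
    using padic_L2_norm_add_power2[OF L2(1,3)] padic_L2_norm_add_power2[OF L2(2,4)]
      is_fourier_transform_isometry[OF is_fourier_transform_add[OF assms]]
      is_fourier_transform_isometry[OF assms(1)] is_fourier_transform_isometry[OF assms(2)] by simp
qed

section \<open>Fourier transforms of dilated functions\<close>

text \<open>The unitary action of the group of dilations, as it occurs in the wavelet system.\<close>
definition unitary_dilation :: "int \<Rightarrow> ('p::prime_card padic \<Rightarrow> complex) \<Rightarrow> 'p padic \<Rightarrow> complex" where
  "unitary_dilation j f x = of_real (real CARD('p) powr (real_of_int j / 2)) * f (dilation (- j) x)"

lemma powr_half_power2: "(real CARD('p::prime_card) powr (real_of_int j / 2))\<^sup>2 = real CARD('p) powi j"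
proof -
  have "(real CARD('p) powr (real_of_int j / 2))\<^sup>2 = real CARD('p) powr (real_of_int j)"
    unfolding power2_eq_square powr_add[symmetric] by simp
  thus ?thesis by (simp add: powr_real_of_int')
qed

lemma padic_L2_unitary_dilation:
  fixes f :: "'p::prime_card padic \<Rightarrow> complex"
  assumes "f \<in> padic_L2"
  shows "unitary_dilation j f \<in> padic_L2"
proof -
  have "(\<lambda>x. f (dilation (- j) x)) \<in> padic_L2"
    using assms integrable_dilation[of "\<lambda>x. (cmod (f x))\<^sup>2"] measurable_compose[OF haar_dilation(1)]
    by (auto simp: padic_L2_def)
  from padic_L2_mult[OF this] show ?thesis by (simp add: unitary_dilation_def[abs_def])
qed

lemma padic_L2_norm_unitary_dilation:
  fixes f :: "'p::prime_card padic \<Rightarrow> complex"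
  assumes [measurable]: "f \<in> borel_measurable haar"
  shows "padic_L2_norm (unitary_dilation j f) = padic_L2_norm f"
proof -
  have "(padic_L2_norm (unitary_dilation j f))\<^sup>2 = (LINT x|haar. real CARD('p) powi j * (cmod (f (dilation (- j) x)))\<^sup>2)"
    unfolding padic_L2_norm_power2 unitary_dilation_def norm_mult power_mult_distrib
    by (simp add: powr_half_power2)
  also have "\<dots> = real CARD('p) powi j * (LINT x|haar. (cmod (f (dilation (- j) x)))\<^sup>2)"
    by (rule integral_mult_right_zero)
  also have "(LINT x|haar. (cmod (f (dilation (- j) x)))\<^sup>2) = real CARD('p) powi (- j) *\<^sub>R (LINT x|haar. (cmod (f x))\<^sup>2)"
    by (rule integral_dilation) measurable
  finally have "(padic_L2_norm (unitary_dilation j f))\<^sup>2 = (padic_L2_norm f)\<^sup>2"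
    by (simp add: padic_L2_norm_power2 power_int_minus)
  thus ?thesis by simp
qed

text \<open>Dilation by \<open>p\<^sup>j\<close> in the argument of the character can be moved from one variable to the other; the
  change of variables contributes \<open>p\<^sup>-\<^sup>j\<close>, which turns the factor \<open>p\<^sup>j\<^sup>/\<^sup>2\<close> into \<open>p\<^sup>-\<^sup>j\<^sup>/\<^sup>2\<close>.\<close>
lemma padic_fourier_integral_unitary_dilation:
  fixes f :: "'p::prime_card padic \<Rightarrow> complex"
  assumes f: "integrable haar f"
  shows "padic_fourier_integral (unitary_dilation j f) = unitary_dilation (- j) (padic_fourier_integral f)"
proof
  fix \<xi> :: "'p padic"
  let ?c = "of_real (real CARD('p) powr (real_of_int j / 2)) :: complex"
  let ?F = "\<lambda>y. padic_char (dilation j \<xi> * y) * f y"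
  have "padic_char (\<xi> * x) = padic_char (dilation j \<xi> * dilation (- j) x)" for x
  proof -
    have "dilation j \<xi> * dilation (- j) x = \<xi> * dilation j (dilation (- j) x)"
      by (simp only: dilation_def mult_ac)
    thus ?thesis by simp
  qed
  hence "padic_fourier_integral (unitary_dilation j f) \<xi> = (LINT x|haar. ?c * ?F (dilation (- j) x))"
    unfolding padic_fourier_integral_def unitary_dilation_def by (simp add: mult_ac)
  also have "\<dots> = ?c * (LINT x|haar. ?F (dilation (- j) x))" by (rule integral_mult_right_zero)
  also have "(LINT x|haar. ?F (dilation (- j) x)) = real CARD('p) powi (- j) *\<^sub>R (LINT x|haar. ?F x)"
    by (rule integral_dilation) (use integrable_char_mult[OF f] in auto)
  also have "?c * \<dots> = of_real (real CARD('p) powr (real_of_int j / 2) * real CARD('p) powi (- j)) * (LINT x|haar. ?F x)"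
    by (simp add: scaleR_conv_of_real)
  also have "real CARD('p) powi (- j) = real CARD('p) powr (real_of_int (- j))"
    by (rule powr_real_of_int'[symmetric]) auto
  also have "real CARD('p) powr (real_of_int j / 2) * \<dots> = real CARD('p) powr (real_of_int (- j) / 2)"
    unfolding powr_add[symmetric] by simp
  finally show "padic_fourier_integral (unitary_dilation j f) \<xi> = unitary_dilation (- j) (padic_fourier_integral f) \<xi>"
    by (simp add: unitary_dilation_def padic_fourier_integral_def)
qed

lemma is_fourier_transform_unitary_dilation:
  fixes f :: "'p::prime_card padic \<Rightarrow> complex"
  assumes "is_fourier_transform f g"
  shows "is_fourier_transform (unitary_dilation j f) (unitary_dilation (- j) g)"
proof -
  obtain h where f: "f \<in> padic_L2" and g: "g \<in> padic_L2"
    and h: "\<And>k :: nat. integrable haar (h k)" "\<And>k. h k \<in> padic_L2" "\<And>k. padic_fourier_integral (h k) \<in> padic_L2"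
    and lim: "(\<lambda>k. padic_L2_norm (\<lambda>x. h k x - f x)) \<longlonglongrightarrow> 0"
      "(\<lambda>k. padic_L2_norm (\<lambda>\<xi>. padic_fourier_integral (h k) \<xi> - g \<xi>)) \<longlonglongrightarrow> 0"
    using assms unfolding is_fourier_transform_def by blast
  have norm: "padic_L2_norm (\<lambda>x. unitary_dilation i u x - unitary_dilation i v x) = padic_L2_norm (\<lambda>x. u x - v x)"
    if "u \<in> padic_L2" "v \<in> padic_L2" for i and u v :: "'p padic \<Rightarrow> complex"
  proof -
    have "(\<lambda>x. u x - v x) \<in> borel_measurable haar" using that by (auto simp: padic_L2_def)
    from padic_L2_norm_unitary_dilation[OF this, of i] show ?thesis
      by (simp add: unitary_dilation_def[abs_def] right_diff_distrib)
  qed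
  show ?thesis
    unfolding is_fourier_transform_def
  proof (intro conjI exI[of _ "\<lambda>k. unitary_dilation j (h k)"] allI)
    show "integrable haar (unitary_dilation j (h k))" for k
      unfolding unitary_dilation_def[abs_def] by (intro integrable_mult_right integrable_dilation h)
    show "padic_fourier_integral (unitary_dilation j (h k)) \<in> padic_L2" for k
      unfolding padic_fourier_integral_unitary_dilation[OF h(1)] by (rule padic_L2_unitary_dilation[OF h(3)])
    show "(\<lambda>k. padic_L2_norm (\<lambda>x. unitary_dilation j (h k) x - unitary_dilation j f x)) \<longlonglongrightarrow> 0"
      using lim(1) by (simp only: norm h f)
    show "(\<lambda>k. padic_L2_norm (\<lambda>\<xi>. padic_fourier_integral (unitary_dilation j (h k)) \<xi> - unitary_dilation (- j) g \<xi>)) \<longlonglongrightarrow> 0"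
      using lim(2) by (simp only: norm h g padic_fourier_integral_unitary_dilation)
  qed (intro padic_L2_unitary_dilation f g h)+
qed

section \<open>Measure and disjoint dilates of multiwavelet sets\<close>

lemma zero_in_padic_frac_reps: "0 \<in> (padic_frac_reps :: 'p::prime_card padic set)"
proof -
  have "is_padic_expansion (0 :: 'p padic) 0 (\<lambda>_. 0)" by (simp add: is_padic_expansion_def)
  moreover from padic_digit_expansion[of "0 :: 'p padic"]
  obtain g where "is_padic_expansion (0 :: 'p padic) g (padic_digit (0 :: 'p padic))" ..
  ultimately have "padic_digit (0 :: 'p padic) = (\<lambda>_. 0)" by (rule is_padic_expansion_unique[symmetric])
  hence "padic_frac (0 :: 'p padic) = 0" by (simp add: padic_frac_def)
  thus ?thesis by (simp add: padic_frac_reps_def)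
qed

text \<open>The part of orthonormality that concerns the unshifted wavelets, \<open>a = 0\<close>.\<close>
lemma multiwavelet_inner:
  fixes \<psi> :: "nat \<Rightarrow> 'p::prime_card padic \<Rightarrow> complex"
  assumes "is_multiwavelet L \<psi>" "n \<in> {1..L}" "m \<in> {1..L}"
  shows "padic_L2_inner (\<psi> n) (unitary_dilation j (\<psi> m)) = (if n = m \<and> j = 0 then 1 else 0)"
proof -
  have sys: "wavelet_system \<psi> (n, j, 0) = unitary_dilation j (\<psi> n)" for n j
    by (simp add: wavelet_system_def unitary_dilation_def[abs_def] dilation_def)
  have dil0: "unitary_dilation 0 (\<psi> n) = \<psi> n" by (simp add: unitary_dilation_def[abs_def])
  have idx: "(n, 0, 0) \<in> {1..L} \<times> UNIV \<times> padic_frac_reps" "(m, j, 0) \<in> {1..L} \<times> UNIV \<times> padic_frac_reps"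
    using assms zero_in_padic_frac_reps by auto
  have "\<forall>i\<in>{1..L} \<times> UNIV \<times> padic_frac_reps. \<forall>k\<in>{1..L} \<times> UNIV \<times> padic_frac_reps.
      padic_L2_inner (wavelet_system \<psi> i) (wavelet_system \<psi> k) = (if i = k then 1 else 0)"
    using assms(1) unfolding is_multiwavelet_def is_orthonormal_basis_def by (elim conjE)
  from this[rule_format, OF idx]
  have "padic_L2_inner (wavelet_system \<psi> (n, 0, 0)) (wavelet_system \<psi> (m, j, 0))
      = (if (n, 0, 0) = (m, j, 0 :: 'p padic) then 1 else 0)"
    .
  thus ?thesis unfolding sys dil0 by auto
qed

lemma emeasure_finite_UN_AE_disjoint:
  assumes "finite I" "\<And>i. i \<in> I \<Longrightarrow> A i \<in> sets M"
    and "\<And>i j. i \<in> I \<Longrightarrow> j \<in> I \<Longrightarrow> i \<noteq> j \<Longrightarrow> A i \<inter> A j \<in> null_sets M"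
  shows "emeasure M (\<Union>i\<in>I. A i) = (\<Sum>i\<in>I. emeasure M (A i))"
  using assms
proof (induction I rule: finite_induct)
  case (insert i I)
  let ?U = "\<Union>i\<in>I. A i"
  have sets: "A i \<in> sets M" "?U \<in> sets M" using insert by auto
  have "A i \<inter> ?U = (\<Union>j\<in>I. A i \<inter> A j)" by blast
  also have "\<dots> \<in> null_sets M"
    using insert by (intro null_sets_UN' countable_finite) auto
  finally have null: "A i \<inter> ?U \<in> null_sets M" .
  have "emeasure M (A i \<union> ?U) = emeasure M (A i) + emeasure M (?U - A i \<inter> ?U)"
    using sets by (subst plus_emeasure) (auto intro!: arg_cong[of _ _ "emeasure M"])
  also have "emeasure M (?U - A i \<inter> ?U) = emeasure M ?U"
    by (rule emeasure_Diff_null_set[OF null sets(2)])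
  finally show ?case using insert by simp
qed simp

lemma ennreal_norm_power2_indicator: "ennreal ((cmod (indicator A x))\<^sup>2) = indicator A x"
  by (simp add: indicator_def)

lemma emeasure_eq_norm_fourier_transform:
  assumes "is_fourier_transform f (indicator A)" "A \<in> sets haar"
  shows "emeasure haar A = ennreal ((padic_L2_norm f)\<^sup>2)"
proof -
  have "(indicator A :: _ \<Rightarrow> complex) \<in> padic_L2" using assms by (simp add: is_fourier_transform_def)
  from nn_integral_padic_L2[OF this]
  have "(\<integral>\<^sup>+x. indicator A x \<partial>haar) = ennreal ((padic_L2_norm (indicator A))\<^sup>2)"
    unfolding padic_L2_norm_power2 ennreal_norm_power2_indicator .
  thus ?thesis using is_fourier_transform_isometry[OF assms(1)] assms(2) by simp
qed

text \<open>Parseval's identity translates the orthonormality of the unshifted wavelets into statements about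
  the sets \<open>W\<^sub>n\<close>: unit norm gives measure 1, and orthogonality gives null intersections.\<close>
lemma multiwavelet_pieces_tile:
  fixes \<psi> :: "nat \<Rightarrow> 'p::prime_card padic \<Rightarrow> complex"
  assumes mw: "is_multiwavelet L \<psi>"
    and Ws: "\<And>n. n \<in> {1..L} \<Longrightarrow> Ws n \<in> sets haar"
    and ft: "\<And>n. n \<in> {1..L} \<Longrightarrow> is_fourier_transform (\<psi> n) (indicator (Ws n))"
    and nm: "n \<in> {1..L}" "m \<in> {1..L}"
  shows "emeasure haar (Ws n) = 1"
    and "n \<noteq> m \<or> j \<noteq> 0 \<Longrightarrow> Ws n \<inter> padic_dilate j (Ws m) \<in> null_sets haar"
proof -
  have one: "emeasure haar (Ws n) = 1" if "n \<in> {1..L}" for n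
  proof -
    have "padic_L2_inner (\<psi> n) (\<psi> n) = 1"
      using multiwavelet_inner[OF mw that that, of 0] by (simp add: unitary_dilation_def[abs_def])
    hence "complex_of_real ((padic_L2_norm (\<psi> n))\<^sup>2) = 1"
      unfolding padic_L2_norm_power2 padic_L2_inner_def complex_norm_square[symmetric]
      by (simp del: of_real_power)
    hence "(padic_L2_norm (\<psi> n))\<^sup>2 = 1" by (simp only: of_real_eq_1_iff)
    thus ?thesis using emeasure_eq_norm_fourier_transform[OF ft Ws, OF that that] by simp
  qed
  show "emeasure haar (Ws n) = 1" by (rule one[OF nm(1)])
  assume ne: "n \<noteq> m \<or> j \<noteq> 0"
  let ?T = "Ws n \<inter> padic_dilate j (Ws m)"
  have T: "?T \<in> sets haar" by (intro sets.Int Ws sets_padic_dilate nm)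
  have "emeasure haar ?T \<le> emeasure haar (Ws n)" by (intro emeasure_mono Ws nm) auto
  hence fin: "emeasure haar ?T < \<infinity>" using one[OF nm(1)] by (simp add: order_le_less_trans)
  let ?c = "real CARD('p) powr (real_of_int j / 2)"
  have "Re (padic_L2_inner (indicator (Ws n)) (unitary_dilation (- (- j)) (indicator (Ws m))))
      = Re (padic_L2_inner (\<psi> n) (unitary_dilation (- j) (\<psi> m)))"
    by (intro is_fourier_transform_parseval is_fourier_transform_unitary_dilation ft nm)
  also have "\<dots> = 0" using multiwavelet_inner[OF mw nm, of "- j"] ne by auto
  also have "padic_L2_inner (indicator (Ws n)) (unitary_dilation (- (- j)) (indicator (Ws m)))
      = (LINT x|haar. of_real ?c * indicator ?T x)"
    unfolding padic_L2_inner_def unitary_dilation_def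
    by (intro Bochner_Integration.integral_cong refl) (auto simp: indicator_def mem_padic_dilate_iff)
  also have "\<dots> = of_real (?c * measure haar ?T)"
    using has_bochner_integral_integral_eq[OF has_bochner_integral_complex_indicator[OF T fin]] by simp
  finally have "measure haar ?T = 0" by simp
  hence "emeasure haar ?T = 0" using fin by (simp add: emeasure_eq_ennreal_measure)
  thus "?T \<in> null_sets haar" using T by blast
qed

lemma multiwavelet_set_measure_disjoint:
  fixes W :: "'p::prime_card padic set"
  assumes "is_multiwavelet_set L W"
  shows "emeasure haar W = ennreal (real L)"
    and "j \<noteq> 0 \<Longrightarrow> W \<inter> padic_dilate j W \<in> null_sets haar"
proof -
  obtain Ws \<psi> where Ws: "\<And>n. n \<in> {1..L} \<Longrightarrow> Ws n \<in> sets haar"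
    and ft: "\<And>n. n \<in> {1..L} \<Longrightarrow> is_fourier_transform (\<psi> n) (indicator (Ws n))"
    and W: "W = (\<Union>n\<in>{1..L}. Ws n)" and mw: "is_multiwavelet L \<psi>"
    using assms unfolding is_multiwavelet_set_def by blast
  have one: "emeasure haar (Ws n) = 1" if "n \<in> {1..L}" for n
    by (rule multiwavelet_pieces_tile(1)[OF mw Ws ft that that])
  have disj: "Ws n \<inter> padic_dilate j (Ws m) \<in> null_sets haar"
    if "n \<in> {1..L}" "m \<in> {1..L}" "n \<noteq> m \<or> j \<noteq> 0" for n m j
    by (rule multiwavelet_pieces_tile(2)[OF mw Ws ft that])
  have zero: "padic_dilate 0 A = A" for A :: "'p padic set" by (simp add: padic_dilate_eq_vimage vimage_def)
  have "emeasure haar W = (\<Sum>n\<in>{1..L}. emeasure haar (Ws n))"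
    unfolding W
  proof (rule emeasure_finite_UN_AE_disjoint)
    show "Ws i \<inter> Ws k \<in> null_sets haar" if "i \<in> {1..L}" "k \<in> {1..L}" "i \<noteq> k" for i k
      using disj[of i k 0] that unfolding zero by blast
  qed (use Ws in auto)
  also have "\<dots> = (\<Sum>n\<in>{1..L}. 1)" by (intro sum.cong refl one)
  also have "\<dots> = ennreal (real L)" by (simp add: ennreal_of_nat_eq_real_of_nat)
  finally show "emeasure haar W = ennreal (real L)" .
  assume "j \<noteq> 0"
  have "W \<inter> padic_dilate j W = (\<Union>n\<in>{1..L}. \<Union>m\<in>{1..L}. Ws n \<inter> padic_dilate j (Ws m))"
    unfolding W padic_dilate_eq_vimage by blast
  also have "\<dots> \<in> null_sets haar"
    using \<open>j \<noteq> 0\<close> by (intro null_sets_UN' countable_finite finite_atLeastAtMost disj) auto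
  finally show "W \<inter> padic_dilate j W \<in> null_sets haar" .
qed

text \<open>The empty system would have to approximate the indicator of the p-adic integers, which has norm 1.
  This excludes \<open>L = 0\<close>, where the empty union is not stable under null modifications.\<close>
lemma not_multiwavelet_0: "\<not> is_multiwavelet 0 (\<psi> :: nat \<Rightarrow> 'p::prime_card padic \<Rightarrow> complex)"
proof
  let ?f = "indicator (padic_ball 0 0) :: 'p padic \<Rightarrow> complex"
  have nn: "(\<integral>\<^sup>+x. ennreal ((cmod (?f x))\<^sup>2) \<partial>haar) = 1"
  proof -
    have "(\<integral>\<^sup>+x. ennreal ((cmod (?f x))\<^sup>2) \<partial>haar) = (\<integral>\<^sup>+x. indicator (padic_ball (0 :: 'p padic) 0) x \<partial>haar)"
      by (intro nn_integral_cong ennreal_norm_power2_indicator)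
    also have "\<dots> = ennreal (inverse (real CARD('p)) ^ 0)"
      unfolding emeasure_haar_ball[where 'p = 'p and n = 0 and c = 0, symmetric] by (rule nn_integral_indicator) simp
    finally show ?thesis by simp
  qed
  hence L2: "?f \<in> padic_L2" by (simp add: padic_L2_iff_nn del: power_0)
  have norm: "padic_L2_norm ?f = 1"
    using nn nn_integral_padic_L2[OF L2] by (simp add: padic_L2_norm_def integral_nonneg)
  assume "is_multiwavelet 0 \<psi>"
  then obtain F c where "F \<subseteq> {1..0} \<times> UNIV \<times> padic_frac_reps"
    "padic_L2_norm (\<lambda>x. ?f x - (\<Sum>i\<in>F. c i * wavelet_system \<psi> i x)) < 1"
    using L2 unfolding is_multiwavelet_def is_orthonormal_basis_def by (meson zero_less_one)
  thus False using norm by (simp del: power_0)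
qed

lemma is_fourier_transform_cong_AE:
  assumes "is_fourier_transform f g" and g': "g' \<in> borel_measurable haar" and ae: "AE x in haar. g x = g' x"
  shows "is_fourier_transform f g'"
proof -
  have g: "g \<in> padic_L2" using assms(1) by (simp add: is_fourier_transform_def)
  hence gm: "g \<in> borel_measurable haar" by (simp add: padic_L2_def)
  have g'2: "g' \<in> padic_L2"
  proof -
    have "integrable haar (\<lambda>x. (cmod (g' x))\<^sup>2) \<longleftrightarrow> integrable haar (\<lambda>x. (cmod (g x))\<^sup>2)"
      using ae gm g' by (intro integrable_cong_AE) auto
    thus ?thesis using g g' by (simp add: padic_L2_def)
  qed
  have norm: "padic_L2_norm (\<lambda>\<xi>. h \<xi> - g' \<xi>) = padic_L2_norm (\<lambda>\<xi>. h \<xi> - g \<xi>)" if "h \<in> padic_L2" for h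
  proof -
    have "h \<in> borel_measurable haar" using that by (simp add: padic_L2_def)
    thus ?thesis
      unfolding padic_L2_norm_def using ae gm g' by (intro arg_cong[of _ _ sqrt] integral_cong_AE) auto
  qed
  obtain h where h: "\<forall>k :: nat. integrable haar (h k) \<and> h k \<in> padic_L2 \<and> padic_fourier_integral (h k) \<in> padic_L2"
    and lim: "(\<lambda>k. padic_L2_norm (\<lambda>x. h k x - f x)) \<longlonglongrightarrow> 0"
      "(\<lambda>k. padic_L2_norm (\<lambda>\<xi>. padic_fourier_integral (h k) \<xi> - g \<xi>)) \<longlonglongrightarrow> 0"
    using assms(1) unfolding is_fourier_transform_def by blast
  have "(\<lambda>k. padic_L2_norm (\<lambda>\<xi>. padic_fourier_integral (h k) \<xi> - g' \<xi>)) \<longlonglongrightarrow> 0"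
    using lim(2) h by (simp only: norm)
  moreover have "f \<in> padic_L2" using assms(1) by (simp add: is_fourier_transform_def)
  ultimately show ?thesis using g'2 h lim(1) unfolding is_fourier_transform_def by blast
qed

text \<open>Each piece is intersected with the new set, and what the new set has in excess, which is null, is
  added to all of them; the wavelets stay the same.\<close>
lemma is_multiwavelet_set_cong_AE:
  fixes W W' :: "'p::prime_card padic set"
  assumes W: "is_multiwavelet_set L W" and W': "W' \<in> sets haar" and ae: "AE x in haar. x \<in> W \<longleftrightarrow> x \<in> W'"
  shows "is_multiwavelet_set L W'"
proof -
  obtain Ws \<psi> where Ws: "\<And>n. n \<in> {1..L} \<Longrightarrow> Ws n \<in> sets haar"
    and ft: "\<And>n. n \<in> {1..L} \<Longrightarrow> is_fourier_transform (\<psi> n) (indicator (Ws n))"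
    and WU: "W = (\<Union>n\<in>{1..L}. Ws n)" and mw: "is_multiwavelet L \<psi>"
    using W unfolding is_multiwavelet_set_def by blast
  have WM: "W \<in> sets haar" using W by (simp add: is_multiwavelet_set_def)
  have L: "1 \<in> {1..L}" using mw not_multiwavelet_0 by (cases L) auto
  define V where "V n = (Ws n \<inter> W') \<union> (W' - W)" for n
  have V: "V n \<in> sets haar" if "n \<in> {1..L}" for n
    unfolding V_def using Ws[OF that] W' WM by auto
  have "is_fourier_transform (\<psi> n) (indicator (V n))" if n: "n \<in> {1..L}" for n
  proof (rule is_fourier_transform_cong_AE[OF ft[OF n]])
    show "indicator (V n) \<in> borel_measurable haar" using V[OF n] by simp
    have "Ws n \<subseteq> W" using n WU by blast
    thus "AE x in haar. (indicator (Ws n) x :: complex) = indicator (V n) x"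
      using ae by (auto simp: V_def indicator_def elim: eventually_mono)
  qed
  moreover have "W' = (\<Union>n\<in>{1..L}. V n)" using L unfolding V_def WU by blast
  ultimately show ?thesis using W' V mw unfolding is_multiwavelet_set_def by blast
qed

section \<open>Generalized scaling sets\<close>

lemma measure_Int_add_measure_Diff:
  assumes "A \<in> sets M" "B \<in> sets M" "emeasure M A \<noteq> \<infinity>"
  shows "measure M A = measure M (A \<inter> B) + measure M (A - B)"
proof -
  have "emeasure M (A \<inter> B) \<le> emeasure M A" "emeasure M (A - B) \<le> emeasure M A"
    using assms by (auto intro!: emeasure_mono)
  hence "emeasure M (A \<inter> B) \<noteq> \<infinity>" "emeasure M (A - B) \<noteq> \<infinity>" using assms(3) by (auto simp: top_unique)
  hence "measure M ((A \<inter> B) \<union> (A - B)) = measure M (A \<inter> B) + measure M (A - B)"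
    using assms by (intro measure_Union) auto
  moreover have "(A \<inter> B) \<union> (A - B) = A" by blast
  ultimately show ?thesis by simp
qed

theorem lemma4p4:
  fixes G :: "'p::prime_card padic set" and L :: nat
  assumes "G \<in> sets haar"
  shows "is_generalized_scaling_set L G \<longleftrightarrow>
    (\<exists>W. is_multiwavelet_set L W \<and>
      (AE x in haar. x \<in> G \<longleftrightarrow> x \<in> (\<Union>j\<in>{1::nat..}. padic_dilate (int j) W)))"
proof
  let ?p = "real CARD('p)"
  let ?H = "padic_dilate (- 1) G"
  have p1: "?p > 1" by (rule CARD_gt_1)
  have H: "?H \<in> sets haar" by (rule sets_padic_dilate[OF assms])
  assume scaling: "is_generalized_scaling_set L G"
  hence mG: "emeasure haar G = ennreal (real L / (?p - 1))" and W: "is_multiwavelet_set L (?H - G)"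
    by (simp_all add: is_generalized_scaling_set_def)
  have mH: "emeasure haar ?H = ennreal (?p * (real L / (?p - 1)))"
    using p1 by (simp add: emeasure_padic_dilate[OF assms] mG ennreal_mult[symmetric])
  have mW: "emeasure haar (?H - G) = ennreal (real L)" by (rule multiwavelet_set_measure_disjoint(1)[OF W])
  \<comment> \<open>Comparing measures gives \<open>G \<subseteq> p\<^sup>-\<^sup>1G\<close> up to a null set.\<close>
  have "measure haar ?H = measure haar (?H \<inter> G) + measure haar (?H - G)"
    using H assms mH by (intro measure_Int_add_measure_Diff) auto
  hence "measure haar (?H \<inter> G) = ?p * (real L / (?p - 1)) - real L"
    using mH mW p1 by (simp add: measure_def)
  also have "\<dots> = measure haar G"
    using mG p1 by (simp add: measure_def field_simps)
  finally have "measure haar (?H \<inter> G) = measure haar G" .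
  moreover have "measure haar G = measure haar (G \<inter> ?H) + measure haar (G - ?H)"
    using H assms mG by (intro measure_Int_add_measure_Diff) auto
  ultimately have "measure haar (G - ?H) = 0" by (simp add: Int_commute)
  moreover have "emeasure haar (G - ?H) \<le> emeasure haar G" using assms by (intro emeasure_mono) auto
  hence "emeasure haar (G - ?H) \<noteq> \<infinity>" using mG by (auto simp: top_unique)
  ultimately have "G - ?H \<in> null_sets haar"
    using H assms by (intro null_setsI) (auto simp: emeasure_eq_ennreal_measure)
  hence "AE x in haar. x \<notin> G - ?H" by (rule AE_not_in)
  hence "AE x in haar. dilation (- int i) x \<notin> G - ?H" for i by (rule dilation_AE)
  hence inc: "AE x in haar. \<forall>i. dilation (- int i) x \<notin> G - ?H" by (simp add: AE_all_countable)
  \<comment> \<open>The measures of the dilates \<open>p\<^sup>iG\<close> tend to 0, so almost no point lies in all of them.\<close>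
  have null: "(\<Inter>i. padic_dilate (int i) G) \<in> null_sets haar" (is "?N \<in> _")
  proof (rule null_setsI)
    show N: "?N \<in> sets haar" using sets_padic_dilate[OF assms] by (intro sets.countable_INT) auto
    have "emeasure haar ?N \<le> ennreal (inverse ?p ^ i * (real L / (?p - 1)))" for i
    proof -
      have "emeasure haar ?N \<le> emeasure haar (padic_dilate (int i) G)"
        using sets_padic_dilate[OF assms] by (intro emeasure_mono) auto
      also have "\<dots> = ennreal (inverse ?p ^ i * (real L / (?p - 1)))"
        using p1 by (simp add: emeasure_padic_dilate[OF assms] mG ennreal_mult[symmetric] power_int_minus power_inverse)
      finally show ?thesis .
    qed
    moreover have "(\<lambda>i. ennreal (inverse ?p ^ i * (real L / (?p - 1)))) \<longlonglongrightarrow> ennreal (0 * (real L / (?p - 1)))"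
      by (intro tendsto_ennrealI tendsto_intros tendsto_p_power)
    ultimately have "emeasure haar ?N \<le> ennreal (0 * (real L / (?p - 1)))"
      by (intro tendsto_lowerbound) auto
    thus "emeasure haar ?N = 0" by simp
  qed
  have "AE x in haar. x \<in> G \<longleftrightarrow> x \<in> (\<Union>j\<in>{1::nat..}. padic_dilate (int j) (?H - G))"
    using inc AE_not_in[OF null]
  proof eventually_elim
    case (elim x)
    \<comment> \<open>\<open>a i\<close> says that \<open>x\<close> lies in \<open>p\<^sup>iG\<close>: this holds for smaller \<open>i\<close> if it holds for a larger one, and it fails eventually.\<close>
    define a where "a i \<longleftrightarrow> dilation (- int i) x \<in> G" for i :: nat
    have H_iff: "dilation (- int (Suc i)) x \<in> ?H \<longleftrightarrow> a i" for i
      by (simp add: mem_padic_dilate_iff a_def)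
    have dec: "a i" if "a (Suc i)" for i
      using elim(1) that H_iff[of i] unfolding a_def by blast
    have U: "x \<in> (\<Union>j\<in>{1::nat..}. padic_dilate (int j) (?H - G)) \<longleftrightarrow> (\<exists>i. a i \<and> \<not> a (Suc i))"
    proof -
      have "x \<in> (\<Union>j\<in>{1::nat..}. padic_dilate (int j) (?H - G)) \<longleftrightarrow> (\<exists>j\<ge>1. dilation (- int j) x \<in> ?H - G)"
        by (auto simp: mem_padic_dilate_iff)
      also have "\<dots> \<longleftrightarrow> (\<exists>i. dilation (- int (Suc i)) x \<in> ?H - G)"
        by (metis One_nat_def Suc_le_D Suc_le_mono le0)
      finally show ?thesis unfolding Diff_iff H_iff by (simp add: a_def)
    qed
    have "\<not> (\<forall>i. a i)" using elim(2) by (auto simp: mem_padic_dilate_iff a_def)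
    hence "a 0 \<longleftrightarrow> (\<exists>i. a i \<and> \<not> a (Suc i))"
    proof (intro iffI)
      assume "\<not> (\<forall>i. a i)" "a 0"
      thus "\<exists>i. a i \<and> \<not> a (Suc i)" by (metis nat_induct)
    next
      assume "\<exists>i. a i \<and> \<not> a (Suc i)"
      then obtain i where "a i" by blast
      thus "a 0" by (induction i) (auto dest: dec)
    qed
    thus ?case unfolding U by (simp add: a_def)
  qed
  thus "\<exists>W. is_multiwavelet_set L W \<and>
      (AE x in haar. x \<in> G \<longleftrightarrow> x \<in> (\<Union>j\<in>{1::nat..}. padic_dilate (int j) W))"
    using W by blast
next
  let ?p = "real CARD('p)"
  have p1: "?p > 1" by (rule CARD_gt_1)
  assume "\<exists>W. is_multiwavelet_set L W \<and>
      (AE x in haar. x \<in> G \<longleftrightarrow> x \<in> (\<Union>j\<in>{1::nat..}. padic_dilate (int j) W))"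
  then obtain W where W: "is_multiwavelet_set L W"
    and ae: "AE x in haar. x \<in> G \<longleftrightarrow> x \<in> (\<Union>j\<in>{1::nat..}. padic_dilate (int j) W)" by blast
  define U where "U = (\<Union>j\<in>{1::nat..}. padic_dilate (int j) W)"
  have WM: "W \<in> sets haar" using W by (simp add: is_multiwavelet_set_def)
  have UM: "U \<in> sets haar" unfolding U_def using sets_padic_dilate[OF WM] by auto
  have U_up: "x \<in> padic_dilate (- 1) U \<longleftrightarrow> x \<in> W \<or> x \<in> U" for x
  proof -
    have "x \<in> padic_dilate (- 1) U \<longleftrightarrow> (\<exists>j\<ge>1. dilation (1 - int j) x \<in> W)"
      by (auto simp: U_def mem_padic_dilate_iff)
    also have "\<dots> \<longleftrightarrow> (\<exists>i. dilation (- int i) x \<in> W)"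
    proof
      assume "\<exists>j\<ge>1. dilation (1 - int j) x \<in> W"
      then obtain j where "j \<ge> 1" "dilation (1 - int j) x \<in> W" by blast
      thus "\<exists>i. dilation (- int i) x \<in> W" by (intro exI[of _ "j - 1"]) simp
    next
      assume "\<exists>i. dilation (- int i) x \<in> W"
      then obtain i where "dilation (- int i) x \<in> W" by blast
      thus "\<exists>j\<ge>1. dilation (1 - int j) x \<in> W" by (intro exI[of _ "Suc i"]) simp
    qed
    also have "\<dots> \<longleftrightarrow> x \<in> W \<or> (\<exists>i\<ge>1. dilation (- int i) x \<in> W)"
      by (metis dilation_0 less_one linorder_not_less minus_zero of_nat_0)
    finally show ?thesis by (auto simp: U_def mem_padic_dilate_iff)
  qed
  have WU: "W \<inter> U \<in> null_sets haar"
  proof -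
    have "W \<inter> U = (\<Union>j\<in>{1::nat..}. W \<inter> padic_dilate (int j) W)" by (auto simp: U_def)
    also have "\<dots> \<in> null_sets haar"
      using multiwavelet_set_measure_disjoint(2)[OF W] by (intro null_sets_UN') auto
    finally show ?thesis .
  qed
  \<comment> \<open>Finiteness is established first, so that the identity \<open>p \<mu> U = L + \<mu> U\<close> can be solved.\<close>
  have "emeasure haar U \<le> (\<Sum>j. emeasure haar (padic_dilate (int (Suc j)) W))"
  proof -
    have "U = (\<Union>j. padic_dilate (int (Suc j)) W)"
    proof -
      have "{1::nat..} = range Suc" by (auto simp: image_iff Suc_le_eq gr0_conv_Suc)
      thus ?thesis unfolding U_def by (simp only: image_image)
    qed
    thus ?thesis using sets_padic_dilate[OF WM] by (simp only:) (intro emeasure_subadditive_countably, auto)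
  qed
  also have "\<dots> = (\<Sum>j. ennreal (inverse ?p ^ j * (inverse ?p * real L)))"
  proof (intro suminf_cong)
    fix j
    have "?p powi (- int (Suc j)) = inverse ?p ^ Suc j"
      unfolding power_int_minus power_int_of_nat by (simp only: power_inverse)
    thus "emeasure haar (padic_dilate (int (Suc j)) W) = ennreal (inverse ?p ^ j * (inverse ?p * real L))"
      unfolding emeasure_padic_dilate[OF WM] multiwavelet_set_measure_disjoint(1)[OF W]
      by (subst ennreal_mult[symmetric]) (simp_all add: mult_ac)
  qed
  also have "\<dots> < \<infinity>"
  proof -
    have "summable (\<lambda>j. inverse ?p ^ j * (inverse ?p * real L))"
      by (rule summable_mult2[OF summable_geometric]) (use p1 in \<open>simp add: field_simps\<close>)
    hence "(\<Sum>j. ennreal (inverse ?p ^ j * (inverse ?p * real L))) = ennreal (\<Sum>j. inverse ?p ^ j * (inverse ?p * real L))"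
      by (rule suminf_ennreal2[rotated]) simp
    thus ?thesis by (simp only: infinity_ennreal_def ennreal_less_top)
  qed
  finally have finU: "emeasure haar U < \<infinity>" .
  have "ennreal ?p * emeasure haar U = emeasure haar (padic_dilate (- 1) U)"
    by (simp add: emeasure_padic_dilate[OF UM])
  also have "padic_dilate (- 1) U = W \<union> U" using U_up by blast
  also have "emeasure haar (W \<union> U) = emeasure haar W + emeasure haar (U - W \<inter> U)"
    using WM UM by (subst plus_emeasure) (auto intro!: arg_cong[of _ _ "emeasure haar"])
  also have "emeasure haar (U - W \<inter> U) = emeasure haar U"
    by (rule emeasure_Diff_null_set[OF WU UM])
  finally have "ennreal ?p * emeasure haar U = ennreal (real L) + emeasure haar U"
    by (simp add: multiwavelet_set_measure_disjoint(1)[OF W])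
  moreover have eU: "emeasure haar U = ennreal (measure haar U)"
    using finU by (simp add: emeasure_eq_ennreal_measure)
  ultimately have "?p * measure haar U = real L + measure haar U"
    by (simp add: ennreal_mult[symmetric] ennreal_plus[symmetric] del: ennreal_plus)
  hence "measure haar U = real L / (?p - 1)" using p1 by (simp add: field_simps)
  moreover have "emeasure haar G = emeasure haar U"
    using ae assms UM by (intro emeasure_eq_AE) (auto simp: U_def)
  ultimately have mG: "emeasure haar G = ennreal (real L / (?p - 1))" using eU by simp
  have "is_multiwavelet_set L (padic_dilate (- 1) G - G)"
  proof (rule is_multiwavelet_set_cong_AE[OF W])
    show "padic_dilate (- 1) G - G \<in> sets haar" using assms sets_padic_dilate by blast
    show "AE x in haar. x \<in> W \<longleftrightarrow> x \<in> padic_dilate (- 1) G - G"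
      using ae[folded U_def] dilation_AE[OF ae[folded U_def], of 1] AE_not_in[OF WU]
    proof eventually_elim
      case (elim x)
      thus ?case using U_up[of x] by (auto simp: mem_padic_dilate_iff)
    qed
  qed
  thus "is_generalized_scaling_set L G"
    unfolding is_generalized_scaling_set_def using assms mG by blast
qed

end
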